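(* Let $d\ge1$, let $A\in GL_d(\mathbb{Q})$ have no (complex) eigenvalue of norm $1$, and let $G=\mathbb{Z}\ltimes_A H$, where $H\subset\mathbb{Q}^d$ is a subgroup with $A(H)=H$ and $\mathrm{rank}_{\mathbb{Q}}(H)=d$. Then for all $r\ge2$, every faithful action of $G$ by orientation-preserving $C^r$ diffeomorphisms of $[0,1]$ with no global fixed point in $(0,1)$ is conjugate to an affine action by a homeomorphism that restricted to $(0,1)$ is a $C^r$ diffeomorphism.
   Context: The $\mathbb{Q}$-rank of $H$, $\mathrm{rank}_{\mathbb{Q}}(H)$, is the smallest $d'$ such that $H$ embeds into $\mathbb{Q}^{d'}$. $\mathbb{Z}\ltimes_A H$ is the semidirect product in which the generator $a$ of $\mathbb{Z}$ acts on $H$ by $a\,b\,a^{-1}=A(b)$, $b\in H$. A global fixed point is a point fixed by all elements of $G$. Conjugate to an affine action means: there are a homomorphism $\psi:G\to\mathrm{Aff}_+(\mathbb{R})$ (the group of maps $x\mapsto\lambda x+t$, $\lambda>0$, $t\in\mathbb{R}$) and a homeomorphism $\varphi:(0,1)\to\mathbb{R}$ with $\varphi\circ g=\psi(g)\circ\varphi$ on $(0,1)$ for all $g\in G$ (one may view $\varphi$ as a homeomorphism $[0,1]\to[-\infty,\infty]$). *)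

theory Defs
  imports
    "HOL-Analysis.Analysis"
    "HOL-Algebra.Group_Action"
    "Jordan_Normal_Form.Char_Poly"
begin

definition GL_rat :: "nat \<Rightarrow> rat mat monoid" where
  "GL_rat d = units_of (ring_mat TYPE(rat) d ())"

definition rank_rat :: "('a, 'b) monoid_scheme \<Rightarrow> nat" where
  "rank_rat K =
     (LEAST n. \<exists>f. f \<in> hom K (monoid_vec TYPE(rat) n) \<and> inj_on f (carrier K))"

text \<open>The pair \<open>(m, u)\<close> stands for the element \<open>u a\<^sup>m\<close>, where \<open>u \<in> H\<close> and \<open>a\<close> is the
  generator of the cyclic factor; hence \<open>(u a\<^sup>m) (v a\<^sup>n) = (u + A\<^sup>m v) a\<^sup>m\<^sup>+\<^sup>n\<close>.\<close>

definition Z_ltimes :: "nat \<Rightarrow> rat mat \<Rightarrow> rat Matrix.vec set \<Rightarrow> (int \<times> rat Matrix.vec) monoid" where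
  "Z_ltimes d A H =
    \<lparr>carrier = UNIV \<times> H,
     mult = (\<lambda>(m, u) (n, v). (m + n, u + (A [^]\<^bsub>GL_rat d\<^esub> m) *\<^sub>v v)),
     one = (0, 0\<^sub>v d)\<rparr>"

text \<open>For real \<open>r \<ge> 0\<close> with integer part \<open>k\<close>: the function is \<open>k\<close> times continuously
  differentiable on \<open>S\<close> (one-sided derivatives at end points belonging to \<open>S\<close>) and, if \<open>r\<close> is not
  an integer, its \<open>k\<close>-th derivative is locally Hoelder with exponent \<open>r - k\<close>. The function
  \<open>F i\<close> is the \<open>i\<close>-th derivative. Intended for intervals \<open>S\<close> with more than one point.\<close>

definition Cr_on :: "real \<Rightarrow> real set \<Rightarrow> (real \<Rightarrow> real) \<Rightarrow> bool" where
  "Cr_on r S f \<longleftrightarrow>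
    (let k = nat \<lfloor>r\<rfloor>; \<alpha> = frac r in
     \<exists>F :: nat \<Rightarrow> real \<Rightarrow> real.
       F 0 = f \<and>
       (\<forall>i<k. \<forall>x\<in>S. (F i has_real_derivative F (Suc i) x) (at x within S)) \<and>
       continuous_on S (F k) \<and>
       (0 < \<alpha> \<longrightarrow>
         (\<forall>K. compact K \<and> K \<subseteq> S \<longrightarrow>
           (\<exists>C. \<forall>x\<in>K. \<forall>y\<in>K. \<bar>F k x - F k y\<bar> \<le> C * \<bar>x - y\<bar> powr \<alpha>))))"

definition Cr_diffeo :: "real \<Rightarrow> real set \<Rightarrow> real set \<Rightarrow> (real \<Rightarrow> real) \<Rightarrow> bool" where
  "Cr_diffeo r S T f \<longleftrightarrow> (\<exists>g. homeomorphism S T f g \<and> Cr_on r S f \<and> Cr_on r T g)"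

definition Aff_plus :: "(real \<Rightarrow> real) monoid" where
  "Aff_plus = (BijGroup UNIV)
     \<lparr>carrier := {f. \<exists>c t. 0 < c \<and> f = (\<lambda>x. c * x + t)}\<rparr>"

definition conj_to_affine_by ::
  "('g, 'b) monoid_scheme \<Rightarrow> ('g \<Rightarrow> real \<Rightarrow> real) \<Rightarrow> (real \<Rightarrow> real) \<Rightarrow> bool" where
  "conj_to_affine_by G \<rho> \<phi> \<longleftrightarrow>
     (\<exists>\<phi>'. homeomorphism {0<..<1} UNIV \<phi> \<phi>') \<and>
     (\<exists>\<psi> \<in> hom G Aff_plus.
        \<forall>g\<in>carrier G. \<forall>x\<in>{0<..<1}. \<phi> (\<rho> g x) = \<psi> g (\<phi> x))"

end

theory Submission
  imports Defs
begin

text \<open>Write \<open>T\<^sub>h\<close> for the action of \<open>h \<in> H\<close> and \<open>a\<close> for the generator of the cyclic factor. If \<open>f = T\<^sub>h\<close> has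
  no fixed point in \<open>(u, v)\<close> but fixes \<open>u\<close> and \<open>v\<close>, then bounded distortion provides a \<open>C\<^sup>1\<close> coordinate \<open>\<Phi>\<close> on
  \<open>(u, v)\<close> in which every \<open>C\<^sup>2\<close> diffeomorphism \<open>g\<close> that fixes \<open>u\<close>, \<open>v\<close> and commutes with \<open>f\<close> is affine with slope \<open>g'(u)\<close> (Szekeres,
  Kopell). Hyperbolicity enters only through the fact that an additive \<open>\<sigma> : H \<rightarrow> \<real>\<close> which is bounded
  along the two-sided orbits of \<open>A\<close> vanishes. Applied to \<open>\<sigma>(h) = ln T\<^sub>h'(u)\<close> it makes \<open>H\<close> act by translations
  \<open>\<tau>\<close> on each component of the complement of its fixed point set. Applied to \<open>\<tau>\<close> it excludes fixed points
  of \<open>H\<close> in \<open>(0, 1)\<close>: such components would be wandering intervals for \<open>a\<close>, and bounded distortion along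
  them bounds \<open>\<tau>\<close> on orbits of \<open>A\<close>. Hence \<open>\<Phi>\<close> lives on \<open>(0, 1)\<close>. The map \<open>a\<close> read in the coordinate \<open>\<Phi>\<close>
  rescales \<open>\<tau>(H)\<close> by some \<open>\<mu> \<noteq> 1\<close>, so that \<open>\<tau>(H)\<close> is dense and \<open>a\<close> is affine with slope \<open>\<mu>\<close>. Finally
  \<open>\<Phi>\<close> linearizes the hyperbolic fixed point of \<open>a\<close>, which bootstraps its regularity up to \<open>C\<^sup>r\<close>.\<close>

text \<open>One estimate is behind the coordinate, Kopell's rigidity and the distortion bound: a
  Lipschitz bound on ln f' controls sums of ln f' along orbits by lengths of intervals, whose total
  is bounded when the intervals overlap boundedly often. The two uses of hyperbolicity need
  different bounds. The numbers \<sigma>(A^n h) are the values of ln T_h' at a^(-n) u, bounded since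
  [0, 1] is compact. The numbers \<tau>(A^n h) may well grow in general, and it takes disjoint
  iterates of the interval to bound them. An H-fixed end of the interval inside (0, 1) provides
  this: having no global fixed point, the group must move that end by \<open>a\<close>. Additive
  functions bounded on orbits vanish because, by Cayley-Hamilton, every orbit satisfies a linear
  recurrence given by the characteristic polynomial; \<sigma> inherits it after clearing
  denominators, and a bounded two-sided solution is 0 when no root lies on the unit circle. The last
  obstacle is that \<Phi> is the integral of a merely continuous density, hence only C^1 at first.
  The missing derivatives come from whichever of \<open>a\<close> and its inverse contracts in this
  coordinate.\<close>

section \<open>Diffeomorphisms of [0, 1] with Lipschitz logarithmic derivative\<close>

text \<open>Every estimate compares logarithms of derivatives at two points, so this Lipschitz bound
  stands in for class C^2. The derivative is a separate function because at 0 and 1 it is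
  one-sided.\<close>

definition smooth01 :: "(real \<Rightarrow> real) \<Rightarrow> (real \<Rightarrow> real) \<Rightarrow> bool" where
  "smooth01 f f' \<longleftrightarrow> f 0 = 0 \<and> f 1 = 1 \<and>
     (\<forall>x\<in>{0..1}. (f has_real_derivative f' x) (at x within {0..1}) \<and> 0 < f' x) \<and>
     (\<exists>L\<ge>0. \<forall>x\<in>{0..1}. \<forall>y\<in>{0..1}. \<bar>ln (f' x) - ln (f' y)\<bar> \<le> L * \<bar>x - y\<bar>)"

lemma smooth01_endpoints:
  assumes "smooth01 f f'"
  shows "f 0 = 0" "f 1 = 1"
  using assms by (auto simp: smooth01_def)

lemma smooth01_deriv_within:
  assumes "smooth01 f f'" "x \<in> {0..1}"
  shows "(f has_real_derivative f' x) (at x within {0..1})"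
  using assms by (auto simp: smooth01_def)

lemma smooth01_pos:
  assumes "smooth01 f f'" "x \<in> {0..1}"
  shows "0 < f' x"
  using assms by (auto simp: smooth01_def)

lemma smooth01_lipschitz:
  assumes "smooth01 f f'"
  obtains L where "0 \<le> L" "\<And>x y. x \<in> {0..1} \<Longrightarrow> y \<in> {0..1} \<Longrightarrow> \<bar>ln (f' x) - ln (f' y)\<bar> \<le> L * \<bar>x - y\<bar>"
  using assms by (auto simp: smooth01_def)

lemma smooth01_continuous:
  assumes "smooth01 f f'"
  shows "continuous_on {0..1} f"
  by (rule DERIV_continuous_on[of _ f f']) (use assms in \<open>auto simp: smooth01_def\<close>)

lemma smooth01_deriv_at:
  assumes "smooth01 f f'" "x \<in> {0<..<1}"
  shows "(f has_real_derivative f' x) (at x)"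
proof -
  have "(f has_real_derivative f' x) (at x within {0..1})"
    using smooth01_deriv_within[OF assms(1)] assms(2) by auto
  moreover have "at x within {0..1} = at x"
    using assms(2) by (intro at_within_interior) auto
  ultimately show ?thesis by simp
qed

lemma smooth01_mvt:
  assumes "smooth01 f f'" "0 \<le> x" "x < y" "y \<le> 1"
  obtains z where "x < z" "z < y" "f y - f x = (y - x) * f' z"
proof -
  have cont: "continuous_on {x..y} f"
    using smooth01_continuous[OF assms(1)] by (rule continuous_on_subset) (use assms in auto)
  have der: "(f has_real_derivative f' t) (at t)" if "x < t" "t < y" for t
    using smooth01_deriv_at[OF assms(1), of t] that assms by auto
  obtain l z where lz: "x < z" "z < y" "DERIV f z :> l" "f y - f x = (y - x) * l"
    using MVT[OF assms(3) cont] der real_differentiable_def by blast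
  then have "l = f' z" using DERIV_unique der by blast
  then show ?thesis using that lz by blast
qed

lemma smooth01_less:
  assumes "smooth01 f f'" "0 \<le> x" "x < y" "y \<le> 1"
  shows "f x < f y"
proof -
  obtain z where z: "x < z" "z < y" "f y - f x = (y - x) * f' z" using smooth01_mvt[OF assms] .
  then have "0 < f' z" using smooth01_pos[OF assms(1)] assms by auto
  then have "0 < (y - x) * f' z" using assms(3) by simp
  then show ?thesis using z by simp
qed

lemma smooth01_le:
  assumes "smooth01 f f'" "0 \<le> x" "x \<le> y" "y \<le> 1"
  shows "f x \<le> f y"
  using smooth01_less[OF assms(1)] assms by (cases "x = y") force+

lemma smooth01_maps:
  assumes "smooth01 f f'" "x \<in> {0..1}"
  shows "f x \<in> {0..1}"
  using smooth01_le[OF assms(1), of 0 x] smooth01_le[OF assms(1), of x 1] assms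
  by (auto simp: smooth01_endpoints[OF assms(1)])

lemma smooth01_ln_deriv_continuous:
  assumes "smooth01 f f'"
  shows "continuous_on {0..1} (\<lambda>x. ln (f' x))"
proof -
  obtain L where L: "0 \<le> L" "\<And>x y. x \<in> {0..1} \<Longrightarrow> y \<in> {0..1} \<Longrightarrow> \<bar>ln (f' x) - ln (f' y)\<bar> \<le> L * \<bar>x - y\<bar>"
    using smooth01_lipschitz[OF assms] by blast
  have "L-lipschitz_on {0..1} (\<lambda>x. ln (f' x))"
    by (rule lipschitz_onI) (use L in \<open>auto simp: dist_real_def\<close>)
  then show ?thesis by (rule lipschitz_on_continuous_on)
qed

lemma smooth01_ln_deriv_bounded:
  assumes "smooth01 f f'"
  obtains M where "\<And>x. x \<in> {0..1} \<Longrightarrow> \<bar>ln (f' x)\<bar> \<le> M"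
proof -
  have "compact ((\<lambda>x. ln (f' x)) ` {0..1})"
    by (rule compact_continuous_image[OF smooth01_ln_deriv_continuous[OF assms]]) simp
  then have "bounded ((\<lambda>x. ln (f' x)) ` {0..1})" by (rule compact_imp_bounded)
  then obtain M where "\<forall>y\<in>(\<lambda>x. ln (f' x)) ` {0..1}. norm y \<le> M" unfolding bounded_iff by blast
  then show ?thesis by (intro that[of M]) auto
qed

lemma smooth01_interval:
  assumes "smooth01 f f'" "0 \<le> u" "v \<le> 1" "f u = u" "f v = v" "x \<in> {u<..<v}"
  shows "f x \<in> {u<..<v}"
  using smooth01_less[OF assms(1), of u x] smooth01_less[OF assms(1), of x v] assms by auto

lemma smooth01_open_maps:
  assumes "smooth01 f f'" "x \<in> {0<..<1}"
  shows "f x \<in> {0<..<1}"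
  using smooth01_interval[OF assms(1) _ _ _ _ assms(2)] smooth01_endpoints[OF assms(1)] by auto

lemma smooth01_funpow_maps:
  assumes "smooth01 f f'" "x \<in> {0..1}"
  shows "(f ^^ n) x \<in> {0..1}"
  by (induction n) (use assms smooth01_maps[OF assms(1)] in auto)

lemma smooth01_funpow_le:
  assumes "smooth01 f f'" "0 \<le> x" "x \<le> y" "y \<le> 1"
  shows "(f ^^ n) x \<le> (f ^^ n) y"
proof (induction n)
  case (Suc n)
  then show ?case
    using smooth01_le[OF assms(1), of "(f ^^ n) x" "(f ^^ n) y"] smooth01_funpow_maps[OF assms(1), of x n]
      smooth01_funpow_maps[OF assms(1), of y n] assms by auto
qed (use assms in auto)

subsection \<open>The coordinate on a component of the complement of the fixed point set\<close>

text \<open>Motion towards \<open>u\<close> is a normalization: a map that moves points upwards is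
  replaced by its inverse. Neither end needs to be hyperbolic; \<open>f' u = 1\<close> is
  allowed.\<close>

locale contracting_interval =
  fixes f f' :: "real \<Rightarrow> real" and u v :: real
  assumes smooth: "smooth01 f f'"
    and bounds: "0 \<le> u" "u < v" "v \<le> 1"
    and fixes_ends: "f u = u" "f v = v"
    and below: "x \<in> {u<..<v} \<Longrightarrow> f x < x"
begin

lemma interval_unit: "x \<in> {u<..<v} \<Longrightarrow> x \<in> {0<..<1} \<and> x \<in> {0..1}"
  using bounds by auto

lemma iterate_mem: "x \<in> {u<..<v} \<Longrightarrow> (f ^^ n) x \<in> {u<..<v}"
proof (induction n)
  case (Suc n)
  then show ?case
    using smooth01_interval[OF smooth _ _ fixes_ends, of "(f ^^ n) x"] bounds by simp
qed simp

lemma iterate_tendsto: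
  assumes x: "x \<in> {u<..<v}"
  shows "(\<lambda>n. (f ^^ n) x) \<longlonglongrightarrow> u"
proof -
  have dec: "decseq (\<lambda>n. (f ^^ n) x)"
    by (rule decseq_SucI) (use below[OF iterate_mem[OF x]] in \<open>auto intro: less_imp_le\<close>)
  have lb: "\<forall>n. u \<le> (f ^^ n) x" using iterate_mem[OF x] by (auto intro: less_imp_le)
  obtain l where l: "(\<lambda>n. (f ^^ n) x) \<longlonglongrightarrow> l" "\<forall>n. l \<le> (f ^^ n) x"
    using decseq_convergent[OF dec, of u] lb by blast
  have ul: "u \<le> l" using LIMSEQ_le_const[OF l(1), of u] lb by auto
  have lx: "l \<le> x" using l(2)[rule_format, of 0] by simp
  have "l \<in> {0..1}" using ul lx x bounds by auto
  then have "(\<lambda>n. f ((f ^^ n) x)) \<longlonglongrightarrow> f l"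
    using continuous_on_tendsto_compose[OF smooth01_continuous[OF smooth] l(1)]
      iterate_mem[OF x] interval_unit by auto
  moreover have "(\<lambda>n. f ((f ^^ n) x)) \<longlonglongrightarrow> l" using LIMSEQ_Suc[OF l(1)] by simp
  ultimately have "f l = l" using LIMSEQ_unique by blast
  then have "l = u" using below[of l] ul lx x by force
  then show ?thesis using l(1) by simp
qed

text \<open>Once \<open>(f ^^ N) q < p\<close>, the images of [p, q] under iterates that are
  \<open>N\<close> steps apart do not overlap. So they cover each point of [0, 1] at most
  \<open>N\<close> times, up to end points, and their total length is at most
  \<open>N\<close>.\<close>

lemma summable_gaps:
  assumes p: "p \<in> {u<..<v}" and q: "q \<in> {u<..<v}" and pq: "p \<le> q"
  shows "summable (\<lambda>k. (f ^^ k) q - (f ^^ k) p)"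
proof -
  have "eventually (\<lambda>n. (f ^^ n) q < p) sequentially"
    using order_tendstoD(2)[OF iterate_tendsto[OF q]] p by auto
  then obtain N where N: "(f ^^ N) q < p" by (auto simp: eventually_sequentially)
  have unit: "p \<in> {0..1}" "q \<in> {0..1}" using p q interval_unit by auto
  have nonneg: "0 \<le> (f ^^ k) q - (f ^^ k) p" for k
    using smooth01_funpow_le[OF smooth] unit pq by simp
  have le: "(f ^^ (k + N)) q \<le> (f ^^ k) p" for k
    using smooth01_funpow_le[OF smooth, of "(f ^^ N) q" p k] smooth01_funpow_maps[OF smooth unit(2), of N] unit N
    by (simp add: funpow_add)
  have bound: "(\<Sum>k<n. (f ^^ k) q - (f ^^ k) p) \<le> N" for n
  proof -
    have "(\<Sum>k<n. (f ^^ k) q - (f ^^ k) p) \<le> (\<Sum>k<n. (f ^^ k) q - (f ^^ (k + N)) q)"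
      using le by (intro sum_mono) auto
    also have "\<dots> = (\<Sum>k<n. (f ^^ k) q) - (\<Sum>k\<in>{N..<n+N}. (f ^^ k) q)"
      using sum.shift_bounds_nat_ivl[of "\<lambda>k. (f ^^ k) q" 0 N n] by (simp add: sum_subtractf atLeast0LessThan)
    also have "(\<Sum>k\<in>{N..<n+N}. (f ^^ k) q) = (\<Sum>k<n+N. (f ^^ k) q) - (\<Sum>k<N. (f ^^ k) q)"
    proof -
      have "{..<n+N} = {..<N} \<union> {N..<n+N}" by auto
      then have "(\<Sum>k<n+N. (f ^^ k) q) = (\<Sum>k<N. (f ^^ k) q) + (\<Sum>k\<in>{N..<n+N}. (f ^^ k) q)"
        by (simp add: sum.union_disjoint ivl_disj_int)
      then show ?thesis by simp
    qed
    also have "(\<Sum>k<n. (f ^^ k) q) - ((\<Sum>k<n+N. (f ^^ k) q) - (\<Sum>k<N. (f ^^ k) q)) \<le> (\<Sum>k<N. (f ^^ k) q)"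
    proof -
      have "(\<Sum>k<n. (f ^^ k) q) \<le> (\<Sum>k<n+N. (f ^^ k) q)"
        using smooth01_funpow_maps[OF smooth unit(2)] by (intro sum_mono2) auto
      then show ?thesis by simp
    qed
    also have "\<dots> \<le> (\<Sum>k<N. 1)"
      using smooth01_funpow_maps[OF smooth unit(2)] by (intro sum_mono) auto
    finally show ?thesis by simp
  qed
  show ?thesis
    by (rule summableI_nonneg_bounded[OF nonneg bound])
qed

definition base :: real where "base = (u + v) / 2"

definition summand :: "nat \<Rightarrow> real \<Rightarrow> real" where
  "summand k x = ln (f' ((f ^^ k) x)) - ln (f' ((f ^^ k) base))"

text \<open>The partial sums are the logarithms of (f^n)'(x) / (f^n)'(base), so
  \<open>exp (logD x)\<close> is the limit of normalized derivatives of iterates (the Szekeres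
  density). Without the subtraction at \<open>base\<close> the terms would tend to
  \<open>ln (f' u)\<close>, which may be nonzero.\<close>

definition logD :: "real \<Rightarrow> real" where "logD x = (\<Sum>k. summand k x)"

lemma base_mem: "base \<in> {u<..<v}"
  using bounds by (auto simp: base_def)

lemma summand_bound:
  assumes p: "p \<in> {u<..<v}" and q: "q \<in> {u<..<v}"
  obtains M where "summable M" "\<And>k x. x \<in> {p..q} \<Longrightarrow> \<bar>summand k x\<bar> \<le> M k"
proof -
  obtain L where L: "0 \<le> L" "\<And>x y. x \<in> {0..1} \<Longrightarrow> y \<in> {0..1} \<Longrightarrow> \<bar>ln (f' x) - ln (f' y)\<bar> \<le> L * \<bar>x - y\<bar>"
    using smooth01_lipschitz[OF smooth] by blast
  \<comment> \<open>The interval is widened so as to contain \<open>base\<close>; then both points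
    compared in \<open>summand\<close> lie in it.\<close>
  define p' where "p' = min p base"
  define q' where "q' = max q base"
  have p': "p' \<in> {u<..<v}" "p' \<le> base" "p' \<le> p" and q': "q' \<in> {u<..<v}" "base \<le> q'" "q \<le> q'"
    using p q base_mem by (auto simp: p'_def q'_def)
  have sm: "summable (\<lambda>k. L * ((f ^^ k) q' - (f ^^ k) p'))"
    by (intro summable_mult summable_gaps) (use p' q' in auto)
  have "\<bar>summand k x\<bar> \<le> L * ((f ^^ k) q' - (f ^^ k) p')" if x: "x \<in> {p..q}" for k x
  proof -
    have xs: "x \<in> {0..1}" "base \<in> {0..1}" "p' \<in> {0..1}" "q' \<in> {0..1}" "p' \<le> x" "x \<le> q'"
      using x p' q' p q bounds base_mem by auto
    have "\<bar>summand k x\<bar> \<le> L * \<bar>(f ^^ k) x - (f ^^ k) base\<bar>"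
      unfolding summand_def by (rule L(2)) (use xs smooth01_funpow_maps[OF smooth] in auto)
    also have "\<dots> \<le> L * ((f ^^ k) q' - (f ^^ k) p')"
    proof (rule mult_left_mono[OF _ L(1)])
      have "(f ^^ k) p' \<le> (f ^^ k) x" "(f ^^ k) x \<le> (f ^^ k) q'" "(f ^^ k) p' \<le> (f ^^ k) base" "(f ^^ k) base \<le> (f ^^ k) q'"
        using xs p' q' by (auto intro!: smooth01_funpow_le[OF smooth])
      then show "\<bar>(f ^^ k) x - (f ^^ k) base\<bar> \<le> (f ^^ k) q' - (f ^^ k) p'" by linarith
    qed
    finally show ?thesis .
  qed
  then show ?thesis using that sm by blast
qed

lemma summand_sums:
  assumes "x \<in> {u<..<v}"
  shows "(\<lambda>k. summand k x) sums logD x"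
proof -
  obtain M where M: "summable M" "\<And>k y. y \<in> {x..x} \<Longrightarrow> \<bar>summand k y\<bar> \<le> M k"
    using summand_bound[OF assms assms] by blast
  have "summable (\<lambda>k. summand k x)"
    by (rule summable_comparison_test[OF _ M(1)]) (use M(2) in auto)
  then show ?thesis unfolding logD_def by (rule summable_sums)
qed

lemma continuous_ln_deriv_iterate:
  "continuous_on {0..1} (\<lambda>x. ln (f' ((f ^^ k) x)))"
proof -
  have c: "continuous_on {0..1} (f ^^ k)"
  proof (induction k)
    case (Suc k)
    have "continuous_on {0..1} (\<lambda>x. f ((f ^^ k) x))"
      by (rule continuous_on_compose2[OF smooth01_continuous[OF smooth] Suc])
        (use smooth01_funpow_maps[OF smooth] in auto)
    then show ?case by (simp add: o_def)
  qed (simp add: id_def)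
  show ?thesis
    by (rule continuous_on_compose2[OF smooth01_ln_deriv_continuous[OF smooth] c])
      (use smooth01_funpow_maps[OF smooth] in auto)
qed

lemma continuous_logD: "continuous_on {u<..<v} logD"
proof -
  have "isCont logD x" if x: "x \<in> {u<..<v}" for x
  proof -
    define p where "p = (u + x) / 2"
    define q where "q = (x + v) / 2"
    have pq: "p \<in> {u<..<v}" "q \<in> {u<..<v}" "x \<in> {p<..<q}" using x by (auto simp: p_def q_def)
    obtain M where M: "summable M" "\<And>k y. y \<in> {p..q} \<Longrightarrow> \<bar>summand k y\<bar> \<le> M k"
      using summand_bound[OF pq(1,2)] by blast
    have lim: "uniform_limit {p..q} (\<lambda>n y. \<Sum>k<n. summand k y) logD sequentially"
      unfolding logD_def by (rule Weierstrass_m_test[OF _ M(1)]) (use M(2) in auto)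
    have "continuous_on {p..q} (\<lambda>y. \<Sum>k<n. summand k y)" for n
      unfolding summand_def
      by (intro continuous_on_sum continuous_on_diff continuous_on_const
          continuous_on_subset[OF continuous_ln_deriv_iterate]) (use pq bounds in auto)
    then have "continuous_on {p..q} logD"
      by (intro uniform_limit_theorem[OF _ lim]) auto
    then show ?thesis by (rule continuous_on_interior) (use pq(3) in auto)
  qed
  then show ?thesis by (simp add: continuous_on_eq_continuous_at)
qed

text \<open>By the chain rule for \<open>f \<circ> g = g \<circ> f\<close>, the series for
  \<open>logD (g x) - logD x\<close> telescopes.\<close>

lemma logD_commuting:
  assumes g: "smooth01 g g'" and comm: "\<And>x. x \<in> {u<..<v} \<Longrightarrow> g (f x) = f (g x)"
    and gu: "g u = u" and gv: "g v = v" and x: "x \<in> {u<..<v}"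
  shows "logD (g x) - logD x = ln (g' u) - ln (g' x)"
proof -
  have gmem: "g y \<in> {u<..<v}" if "y \<in> {u<..<v}" for y
    using smooth01_interval[OF g _ _ gu gv] bounds that by auto
  have fmem: "f y \<in> {u<..<v}" if "y \<in> {u<..<v}" for y
    using iterate_mem[OF that, of 1] by simp
  have chain: "ln (f' (g y)) - ln (f' y) = ln (g' (f y)) - ln (g' y)" if y: "y \<in> {u<..<v}" for y
  proof -
    have 1: "((\<lambda>z. f (g z)) has_real_derivative f' (g y) * g' y) (at y)"
      by (rule DERIV_chain2[OF smooth01_deriv_at[OF smooth] smooth01_deriv_at[OF g]])
        (use interval_unit y gmem in auto)
    have 2: "((\<lambda>z. g (f z)) has_real_derivative g' (f y) * f' y) (at y)"
      by (rule DERIV_chain2[OF smooth01_deriv_at[OF g] smooth01_deriv_at[OF smooth]])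
        (use interval_unit y fmem in auto)
    have "((\<lambda>z. f (g z)) has_real_derivative g' (f y) * f' y) (at y)"
      by (rule has_field_derivative_transform_within_open[OF 2, of "{u<..<v}"]) (use y comm in auto)
    then have "f' (g y) * g' y = g' (f y) * f' y" using 1 DERIV_unique by blast
    then have "ln (f' (g y) * g' y) = ln (g' (f y) * f' y)" by simp
    moreover have "0 < f' (g y)" "0 < g' y" "0 < g' (f y)" "0 < f' y"
      using smooth01_pos[OF smooth] smooth01_pos[OF g] interval_unit y gmem fmem by auto
    ultimately show ?thesis by (simp add: ln_mult_pos)
  qed
  have git: "(f ^^ k) (g x) = g ((f ^^ k) x)" for k
    by (induction k) (use comm iterate_mem[OF x] in auto)
  have "(\<lambda>k. summand k (g x) - summand k x) sums (logD (g x) - logD x)"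
    by (intro sums_diff summand_sums x gmem)
  moreover have "summand k (g x) - summand k x = ln (g' ((f ^^ Suc k) x)) - ln (g' ((f ^^ k) x))" for k
    using chain[OF iterate_mem[OF x], of k] by (simp add: summand_def git)
  moreover have "(\<lambda>k. ln (g' ((f ^^ k) x))) \<longlonglongrightarrow> ln (g' u)"
    by (rule continuous_on_tendsto_compose[OF smooth01_ln_deriv_continuous[OF g] iterate_tendsto[OF x]])
      (use bounds interval_unit[OF iterate_mem[OF x]] in auto)
  then have "(\<lambda>k. ln (g' ((f ^^ Suc k) x)) - ln (g' ((f ^^ k) x))) sums (ln (g' u) - ln (g' x))"
    using telescope_sums by fastforce
  ultimately show ?thesis using sums_unique2 by simp
qed

text \<open>\<Phi> is an antiderivative of \<open>D = exp logD\<close>. Exponentiated,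
  \<open>logD_commuting\<close> reads \<open>D (g x) * g' x = g' u * D x\<close>, which says that
  \<Phi> after \<open>g\<close> and \<open>g' u\<close> times \<Phi> have the same
  derivative.\<close>

lemma coordinate:
  obtains \<Phi> D where "\<And>x. x \<in> {u<..<v} \<Longrightarrow> (\<Phi> has_real_derivative D x) (at x)"
    "\<And>x. x \<in> {u<..<v} \<Longrightarrow> 0 < D x" "continuous_on {u<..<v} D"
    "\<And>g g'. smooth01 g g' \<Longrightarrow> (\<And>x. x \<in> {u<..<v} \<Longrightarrow> g (f x) = f (g x)) \<Longrightarrow> g u = u \<Longrightarrow> g v = v
       \<Longrightarrow> \<exists>c. \<forall>x\<in>{u<..<v}. \<Phi> (g x) = g' u * \<Phi> x + c"
proof -
  define D where "D = (\<lambda>x. exp (logD x))"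
  have D: "continuous_on {u<..<v} D" unfolding D_def
    by (intro continuous_on_exp continuous_logD)
  have "\<exists>F. \<forall>x. ereal u < ereal x \<longrightarrow> ereal x < ereal v \<longrightarrow> (F has_vector_derivative D x) (at x)"
    by (rule einterval_antiderivative)
      (use bounds D in \<open>auto simp: continuous_on_eq_continuous_at\<close>)
  then obtain \<Phi> where \<Phi>: "\<And>x. x \<in> {u<..<v} \<Longrightarrow> (\<Phi> has_real_derivative D x) (at x)"
    by (auto simp: has_real_derivative_iff_has_vector_derivative)
  have "\<exists>c. \<forall>x\<in>{u<..<v}. \<Phi> (g x) = g' u * \<Phi> x + c"
    if g: "smooth01 g g'" and comm: "\<And>x. x \<in> {u<..<v} \<Longrightarrow> g (f x) = f (g x)" and gu: "g u = u" and gv: "g v = v"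
    for g g'
  proof -
    have "((\<lambda>y. \<Phi> (g y) - g' u * \<Phi> y) has_real_derivative 0) (at x)" if x: "x \<in> {u<..<v}" for x
    proof -
      have gx: "g x \<in> {u<..<v}"
        using smooth01_interval[OF g _ _ gu gv x] bounds by auto
      have pos: "0 < g' u" "0 < g' x" using smooth01_pos[OF g] bounds x by auto
      have "D (g x) = exp (logD x + ln (g' u) - ln (g' x))"
        using logD_commuting[OF g comm gu gv x] unfolding D_def by (simp add: algebra_simps)
      also have "\<dots> = D x * g' u / g' x" using pos by (simp add: D_def exp_add exp_diff)
      finally have eq: "D (g x) * g' x = g' u * D x" using pos by simp
      have "((\<lambda>y. \<Phi> (g y)) has_real_derivative D (g x) * g' x) (at x)"
        by (rule DERIV_chain2[OF \<Phi>[OF gx] smooth01_deriv_at[OF g]]) (use interval_unit x in auto)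
      from DERIV_diff[OF this DERIV_cmult[OF \<Phi>[OF x], of "g' u"]] show ?thesis by (simp add: eq)
    qed
    then have "\<exists>c. \<forall>x\<in>{u<..<v}. \<Phi> (g x) - g' u * \<Phi> x = c"
      by (intro has_field_derivative_zero_constant)
        (auto intro: has_field_derivative_at_within)
    then show ?thesis by (metis diff_eq_eq add.commute)
  qed
  then show ?thesis using that \<Phi> D by (metis D_def exp_gt_zero)
qed

end

text \<open>Kopell's lemma. By commutation \<open>g\<close> fixes \<open>f e\<close> as well as
  \<open>e\<close>, and an affine map with two distinct fixed points is the identity.\<close>

lemma (in contracting_interval) commuting_fixed_point_imp_identity:
  assumes g: "smooth01 g g'" and comm: "\<And>x. x \<in> {u<..<v} \<Longrightarrow> g (f x) = f (g x)"
    and gu: "g u = u" and gv: "g v = v" and e: "e \<in> {u<..<v}" "g e = e" and x: "x \<in> {u<..<v}"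
  shows "g x = x"
proof -
  obtain \<Phi> D where \<Phi>: "\<And>x. x \<in> {u<..<v} \<Longrightarrow> (\<Phi> has_real_derivative D x) (at x)"
    "\<And>x. x \<in> {u<..<v} \<Longrightarrow> 0 < D x" and "\<exists>c. \<forall>x\<in>{u<..<v}. \<Phi> (g x) = g' u * \<Phi> x + c"
  proof (rule coordinate)
    fix \<Phi> D
    assume "\<And>x. x \<in> {u<..<v} \<Longrightarrow> (\<Phi> has_real_derivative D x) (at x)" "\<And>x. x \<in> {u<..<v} \<Longrightarrow> 0 < D x"
      and *: "\<And>g g'. smooth01 g g' \<Longrightarrow> (\<And>x. x \<in> {u<..<v} \<Longrightarrow> g (f x) = f (g x)) \<Longrightarrow> g u = u \<Longrightarrow> g v = v
       \<Longrightarrow> \<exists>c. \<forall>x\<in>{u<..<v}. \<Phi> (g x) = g' u * \<Phi> x + c"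
    with *[OF g comm gu gv] show ?thesis by (intro that[of \<Phi> D]) auto
  qed
  then obtain c where c: "\<And>x. x \<in> {u<..<v} \<Longrightarrow> \<Phi> (g x) = g' u * \<Phi> x + c" by blast
  have inc: "\<Phi> y < \<Phi> z" if "y \<in> {u<..<v}" "z \<in> {u<..<v}" "y < z" for y z
  proof (rule DERIV_pos_imp_increasing[OF that(3)])
    fix t assume "y \<le> t" "t \<le> z"
    then have "t \<in> {u<..<v}" using that by auto
    then show "\<exists>d. (\<Phi> has_real_derivative d) (at t) \<and> 0 < d" using \<Phi> by blast
  qed
  have fe: "f e \<in> {u<..<v}" "f e < e" using iterate_mem[OF e(1), of 1] below[OF e(1)] by auto
  have "\<Phi> e = g' u * \<Phi> e + c" "\<Phi> (f e) = g' u * \<Phi> (f e) + c"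
    using c[OF e(1)] c[OF fe(1)] comm[OF e(1)] e(2) by auto
  then have "(1 - g' u) * (\<Phi> e - \<Phi> (f e)) = 0" by (simp add: algebra_simps)
  moreover have "\<Phi> (f e) < \<Phi> e" using inc fe e by auto
  ultimately have "g' u = 1" by simp
  then have "\<Phi> (g x) = \<Phi> x" using c[OF x] c[OF e(1)] e(2) by simp
  moreover have "g x \<in> {u<..<v}" using smooth01_interval[OF g _ _ gu gv x] bounds by auto
  ultimately show ?thesis using inc[of "g x" x] inc[of x "g x"] x by (cases "g x" x rule: linorder_cases) auto
qed

section \<open>Intervals between fixed points, and bounded distortion\<close>

lemma smooth01_id: "smooth01 (\<lambda>x. x) (\<lambda>x. 1)"
  by (auto simp: smooth01_def)

text \<open>Working with derivatives within \<open>{0..1}\<close> keeps the chain rule valid at 0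
  and 1, which may be among the fixed points where it is applied.\<close>

lemma smooth01_compose_deriv_unique:
  assumes "smooth01 f f'" "smooth01 g g'" "smooth01 h h'" "smooth01 k k'"
    and eq: "\<And>x. x \<in> {0..1} \<Longrightarrow> f (g x) = h (k x)" and x: "x \<in> {0..1}"
  shows "f' (g x) * g' x = h' (k x) * k' x"
proof -
  have chain: "((\<lambda>x. f (g x)) has_real_derivative f' (g x) * g' x) (at x within {0..1})"
    if "smooth01 f f'" "smooth01 g g'" for f f' g g'
  proof -
    have "(f has_real_derivative f' (g x)) (at (g x) within (g ` {0..1}))"
      by (rule DERIV_subset[OF smooth01_deriv_within[OF that(1) smooth01_maps[OF that(2) x]]])
        (use smooth01_maps[OF that(2)] in auto)
    from DERIV_image_chain[OF this smooth01_deriv_within[OF that(2) x]] show ?thesis by (simp add: o_def)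
  qed
  have "((\<lambda>x. f (g x)) has_real_derivative h' (k x) * k' x) (at x within {0..1})"
    by (rule has_field_derivative_transform_within[OF chain[OF assms(3,4)], of 1]) (use x eq in auto)
  moreover have "at x within {0..1} \<noteq> bot"
    using x by (auto simp: trivial_limit_within islimpt_Icc)
  ultimately show ?thesis using has_field_derivative_unique[OF chain[OF assms(1,2)]] by blast
qed

text \<open>\<open>p\<close> and \<open>q\<close> are the fixed points nearest to \<open>x\<close>;
  they exist since the fixed point set is closed and contains 0 and 1. Between them
  \<open>g y - y\<close> has no zero and hence a constant sign.\<close>

lemma smooth01_component:
  assumes g: "smooth01 g g'" and x: "x \<in> {0..1}" and moved: "g x \<noteq> x"
  obtains p q where "0 \<le> p" "p < x" "x < q" "q \<le> 1" "g p = p" "g q = q"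
    "(\<forall>y\<in>{p<..<q}. g y < y) \<or> (\<forall>y\<in>{p<..<q}. y < g y)"
proof -
  define F where "F = {y \<in> {0..1}. g y = y}"
  have closed: "closed F"
  proof -
    have "continuous_on {0..1} (\<lambda>y. g y - y)"
      by (intro continuous_on_diff continuous_on_id smooth01_continuous[OF g])
    then have "closed ({0..1} \<inter> (\<lambda>y. g y - y) -` {0})"
      by (rule continuous_closed_preimage) auto
    moreover have "F = {0..1} \<inter> (\<lambda>y. g y - y) -` {0}" by (auto simp: F_def)
    ultimately show ?thesis by simp
  qed
  have F01: "0 \<in> F" "1 \<in> F" using smooth01_endpoints[OF g] by (auto simp: F_def)
  define p where "p = Sup (F \<inter> {..x})"
  define q where "q = Inf (F \<inter> {x..})"
  have bdd: "bdd_above (F \<inter> {..x})" "bdd_below (F \<inter> {x..})"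
    by (auto intro!: bdd_aboveI[of _ x] bdd_belowI[of _ x])
  have "p \<in> F \<inter> {..x}" unfolding p_def
    by (rule closed_contains_Sup) (use F01 x bdd closed in auto)
  moreover have "q \<in> F \<inter> {x..}" unfolding q_def
    by (rule closed_contains_Inf) (use F01 x bdd closed in auto)
  ultimately have pq: "p \<in> F" "q \<in> F" "p < x" "x < q" using moved by (auto simp: F_def order_less_le)
  have none: "g y \<noteq> y" if y: "y \<in> {p<..<q}" for y
  proof
    assume "g y = y"
    then have "y \<in> F" using y pq by (auto simp: F_def)
    then show False
      using cSup_upper[OF _ bdd(1), of y] cInf_lower[OF _ bdd(2), of y] y unfolding p_def q_def
      by (cases "y \<le> x") auto
  qed
  have "(\<forall>y\<in>{p<..<q}. g y < y) \<or> (\<forall>y\<in>{p<..<q}. y < g y)"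
  proof (rule ccontr)
    assume "\<not> ?thesis"
    then obtain y z where yz: "y \<in> {p<..<q}" "z \<in> {p<..<q}" "\<not> g y < y" "\<not> z < g z" by auto
    have cont: "continuous_on {p<..<q} (\<lambda>y. g y - y)"
      using pq by (intro continuous_on_diff continuous_on_id continuous_on_subset[OF smooth01_continuous[OF g]])
        (auto simp: F_def)
    have "connected ((\<lambda>y. g y - y) ` {p<..<q})"
      by (rule connected_continuous_image[OF cont]) simp
    moreover have "g z - z \<in> (\<lambda>y. g y - y) ` {p<..<q}" "g y - y \<in> (\<lambda>y. g y - y) ` {p<..<q}" using yz by auto
    ultimately have "0 \<in> (\<lambda>y. g y - y) ` {p<..<q}"
      using yz(3,4) connected_contains_Icc[of _ "g z - z" "g y - y"] by force
    then show False using none by auto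
  qed
  then show ?thesis using that pq by (auto simp: F_def)
qed

text \<open>By monotonicity the images of [u, v] line up in order, so each length is at most one
  step of the orbit of an end point, and these steps telescope inside [0, 1].\<close>

lemma disjoint_iterates_sum_le:
  assumes f: "smooth01 f f'" and uv: "0 \<le> u" "u < v" "v \<le> 1" and disj: "v \<le> f u \<or> f v \<le> u"
  shows "(\<Sum>k<n. (f ^^ k) v - (f ^^ k) u) \<le> 1"
  using disj
proof
  assume vu: "v \<le> f u"
  have fu: "f u \<in> {0..1}" using smooth01_maps[OF f] uv by auto
  have "(\<Sum>k<n. (f ^^ k) v - (f ^^ k) u) \<le> (\<Sum>k<n. (f ^^ Suc k) u - (f ^^ k) u)"
    using smooth01_funpow_le[OF f, of v "f u"] vu uv fu
    by (intro sum_mono) (auto simp: funpow_swap1)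
  also have "\<dots> = (f ^^ n) u - u" by (subst sum_lessThan_telescope) simp
  also have "\<dots> \<le> 1" using smooth01_funpow_maps[OF f, of u n] uv by auto
  finally show ?thesis .
next
  assume vu: "f v \<le> u"
  have fv: "f v \<in> {0..1}" using smooth01_maps[OF f] uv by auto
  have "(\<Sum>k<n. (f ^^ k) v - (f ^^ k) u) \<le> (\<Sum>k<n. (f ^^ k) v - (f ^^ Suc k) v)"
    using smooth01_funpow_le[OF f, of "f v" u] vu uv fv
    by (intro sum_mono) (auto simp: funpow_swap1)
  also have "\<dots> = v - (f ^^ n) v" by (subst sum_lessThan_telescope') simp
  also have "\<dots> \<le> 1" using smooth01_funpow_maps[OF f, of v n] uv by auto
  finally show ?thesis .
qed

text \<open>Comparing increments over subintervals, in cross-multiplied form, avoids both division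
  and the derivative of \<open>f ^^ n\<close>. Step \<open>k\<close> costs the factor exp (L times
  the length of the \<open>k\<close>-th image of [u, v]); these lengths add up to at most 1, so
  \<open>exp L\<close> serves for all \<open>n\<close>.\<close>

lemma bounded_distortion:
  assumes f: "smooth01 f f'" and uv: "0 \<le> u" "u < v" "v \<le> 1" and disj: "v \<le> f u \<or> f v \<le> u"
  obtains C where "0 < C" "\<And>n x y x' y'. \<lbrakk>u \<le> x; x < y; y \<le> v; u \<le> x'; x' < y'; y' \<le> v\<rbrakk> \<Longrightarrow>
     ((f ^^ n) y - (f ^^ n) x) * (y' - x') \<le> C * (((f ^^ n) y' - (f ^^ n) x') * (y - x))"
proof -
  obtain L where L: "0 \<le> L" "\<And>x y. x \<in> {0..1} \<Longrightarrow> y \<in> {0..1} \<Longrightarrow> \<bar>ln (f' x) - ln (f' y)\<bar> \<le> L * \<bar>x - y\<bar>"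
    using smooth01_lipschitz[OF f] by blast
  define E where "E n = exp (L * (\<Sum>k<n. (f ^^ k) v - (f ^^ k) u))" for n
  have mono: "(f ^^ n) x < (f ^^ n) y" if "0 \<le> x" "x < y" "y \<le> 1" for n x y
    by (induction n) (use smooth01_less[OF f] smooth01_funpow_maps[OF f, of x] smooth01_funpow_maps[OF f, of y] that in auto)
  have step: "((f ^^ n) y - (f ^^ n) x) * (y' - x') \<le> E n * (((f ^^ n) y' - (f ^^ n) x') * (y - x))"
    if xy: "u \<le> x" "x < y" "y \<le> v" "u \<le> x'" "x' < y'" "y' \<le> v" for n x y x' y'
  proof (induction n)
    case 0
    then show ?case by (simp add: E_def)
  next
    case (Suc n)
    let ?g = "f ^^ n"
    have unit: "?g t \<in> {0..1}" if "u \<le> t" "t \<le> v" for t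
      using smooth01_funpow_maps[OF f, of t] that uv by auto
    have lt: "?g x < ?g y" "?g x' < ?g y'" using mono xy uv by auto
    have ends: "?g u \<le> ?g x" "?g y \<le> ?g v" "?g u \<le> ?g x'" "?g y' \<le> ?g v"
      using xy uv by (auto intro!: smooth01_funpow_le[OF f])
    obtain s where s: "?g x < s" "s < ?g y" "f (?g y) - f (?g x) = (?g y - ?g x) * f' s"
      using smooth01_mvt[OF f _ lt(1)] unit[of x] unit[of y] xy by auto
    obtain t where t: "?g x' < t" "t < ?g y'" "f (?g y') - f (?g x') = (?g y' - ?g x') * f' t"
      using smooth01_mvt[OF f _ lt(2)] unit[of x'] unit[of y'] xy by auto
    have st: "s \<in> {0..1}" "t \<in> {0..1}" using s t unit[of x] unit[of y] unit[of x'] unit[of y'] xy by auto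
    have pos: "0 < f' s" "0 < f' t" using st smooth01_pos[OF f] by auto
    \<comment> \<open>The mean value points \<open>s\<close> and \<open>t\<close> both lie in the
      \<open>n\<close>-th image of [u, v], whose length is exactly what the exponent of
      \<open>E\<close> gains in this step.\<close>
    have "ln (f' s) - ln (f' t) \<le> L * \<bar>s - t\<bar>" using L(2)[OF st] by linarith
    also have "\<dots> \<le> L * (?g v - ?g u)" using s t ends by (intro mult_left_mono[OF _ L(1)]) auto
    finally have "ln (f' s) \<le> ln (f' t) + L * (?g v - ?g u)" by simp
    then have "f' s \<le> exp (ln (f' t) + L * (?g v - ?g u))" using pos by (metis exp_le_cancel_iff exp_ln)
    then have ratio: "f' s \<le> f' t * exp (L * (?g v - ?g u))" using pos by (simp add: exp_add)
    have "((f ^^ Suc n) y - (f ^^ Suc n) x) * (y' - x') = ((?g y - ?g x) * (y' - x')) * f' s"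
      using s(3) by simp
    also have "\<dots> \<le> (E n * ((?g y' - ?g x') * (y - x))) * (f' t * exp (L * (?g v - ?g u)))"
    proof (rule mult_mono[OF Suc ratio])
      have "0 \<le> E n" by (simp add: E_def)
      then show "0 \<le> E n * ((?g y' - ?g x') * (y - x))"
        using lt(2) xy(2) by (intro mult_nonneg_nonneg) auto
    qed (use pos in simp)
    also have "\<dots> = E (Suc n) * (((?g y' - ?g x') * f' t) * (y - x))"
      by (simp add: E_def distrib_left exp_add)
    also have "(?g y' - ?g x') * f' t = (f ^^ Suc n) y' - (f ^^ Suc n) x'" using t(3) by simp
    finally show ?case .
  qed
  have En: "E n \<le> exp L" for n
    unfolding E_def using disjoint_iterates_sum_le[OF f uv disj, of n] mult_left_mono[OF _ L(1), of _ 1] by auto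
  show ?thesis
  proof (rule that[of "exp L"])
    fix x y x' y' :: real and m :: nat
    assume xy: "u \<le> x" "x < y" "y \<le> v" "u \<le> x'" "x' < y'" "y' \<le> v"
    have "0 \<le> ((f ^^ m) y' - (f ^^ m) x') * (y - x)"
      using mono[of x' y' m] xy uv by simp
    then have "E m * (((f ^^ m) y' - (f ^^ m) x') * (y - x)) \<le> exp L * (((f ^^ m) y' - (f ^^ m) x') * (y - x))"
      using En by (rule mult_right_mono[rotated])
    with step[OF xy, of m] show "((f ^^ m) y - (f ^^ m) x) * (y' - x') \<le> exp L * (((f ^^ m) y' - (f ^^ m) x') * (y - x))"
      by linarith
  qed simp
qed

subsection \<open>The commuting family together with its hyperbolic automorphism\<close>

text \<open>The relation \<open>a_conj\<close> is the semidirect product relation. The inverses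
  \<open>b\<close> and \<open>B\<close> are part of the data so that the locale is symmetric
  (\<open>swapped\<close>): orbit estimates are then proved for forward iterates of \<open>A\<close>
  alone. The assumption \<open>hyperbolic\<close> condenses the spectral condition into the form in
  which it gets applied.\<close>

locale hyperbolic_action =
  fixes H :: "'h set" and add :: "'h \<Rightarrow> 'h \<Rightarrow> 'h" and T T' :: "'h \<Rightarrow> real \<Rightarrow> real"
    and A B :: "'h \<Rightarrow> 'h" and a a' b b' :: "real \<Rightarrow> real"
  assumes add_closed: "h \<in> H \<Longrightarrow> k \<in> H \<Longrightarrow> add h k \<in> H"
    and add_comm: "h \<in> H \<Longrightarrow> k \<in> H \<Longrightarrow> add h k = add k h"
    and T_inverse: "h \<in> H \<Longrightarrow> \<exists>k\<in>H. \<forall>x\<in>{0..1}. T k (T h x) = x \<and> T h (T k x) = x"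
    and T_add: "h \<in> H \<Longrightarrow> k \<in> H \<Longrightarrow> x \<in> {0..1} \<Longrightarrow> T (add h k) x = T h (T k x)"
    and T_smooth: "h \<in> H \<Longrightarrow> smooth01 (T h) (T' h)"
    and A_closed: "h \<in> H \<Longrightarrow> A h \<in> H" and B_closed: "h \<in> H \<Longrightarrow> B h \<in> H"
    and AB: "h \<in> H \<Longrightarrow> A (B h) = h" and BA: "h \<in> H \<Longrightarrow> B (A h) = h"
    and a_smooth: "smooth01 a a'" and b_smooth: "smooth01 b b'"
    and ab: "x \<in> {0..1} \<Longrightarrow> a (b x) = x" and ba: "x \<in> {0..1} \<Longrightarrow> b (a x) = x"
    and a_conj: "h \<in> H \<Longrightarrow> x \<in> {0..1} \<Longrightarrow> a (T h x) = T (A h) (a x)"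
    and b_conj: "h \<in> H \<Longrightarrow> x \<in> {0..1} \<Longrightarrow> b (T h x) = T (B h) (b x)"
    and hyperbolic: "\<lbrakk>\<And>h k. h \<in> H \<Longrightarrow> k \<in> H \<Longrightarrow> \<sigma> (add h k) = \<sigma> h + \<sigma> k;
        \<And>h. h \<in> H \<Longrightarrow> \<exists>C. \<forall>n. \<bar>\<sigma> ((A ^^ n) h)\<bar> \<le> C;
        \<And>h. h \<in> H \<Longrightarrow> \<exists>C. \<forall>n. \<bar>\<sigma> ((B ^^ n) h)\<bar> \<le> C; h \<in> H\<rbrakk> \<Longrightarrow> (\<sigma> h :: real) = 0"
    and no_global_fixed_point: "x \<in> {0<..<1} \<Longrightarrow> (\<And>h. h \<in> H \<Longrightarrow> T h x = x) \<Longrightarrow> a x \<noteq> x"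
    and nontrivial: "\<exists>h\<in>H. \<exists>x\<in>{0..1}. T h x \<noteq> x"
begin

lemma swapped: "hyperbolic_action H add T T' B A b b' a a'"
proof
  show "b x \<noteq> x" if "x \<in> {0<..<1}" "\<And>h. h \<in> H \<Longrightarrow> T h x = x" for x
    using no_global_fixed_point[OF that] ab[of x] that(1) by auto
  show "\<sigma> h = 0" if "\<And>h k. h \<in> H \<Longrightarrow> k \<in> H \<Longrightarrow> \<sigma> (add h k) = \<sigma> h + \<sigma> k"
      "\<And>h. h \<in> H \<Longrightarrow> \<exists>C. \<forall>n. \<bar>\<sigma> ((B ^^ n) h)\<bar> \<le> C"
      "\<And>h. h \<in> H \<Longrightarrow> \<exists>C. \<forall>n. \<bar>\<sigma> ((A ^^ n) h)\<bar> \<le> C" "h \<in> H" for \<sigma> :: "'h \<Rightarrow> real" and h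
    by (rule hyperbolic[OF that(1,3,2,4)])
qed (fact add_closed add_comm T_inverse T_add T_smooth A_closed B_closed AB BA a_smooth b_smooth ab ba a_conj b_conj
    nontrivial)+

definition fixed :: "real \<Rightarrow> bool" where
  "fixed x \<longleftrightarrow> x \<in> {0..1} \<and> (\<forall>h\<in>H. T h x = x)"

lemma funpow_A_closed: "h \<in> H \<Longrightarrow> (A ^^ n) h \<in> H"
  by (induction n) (auto simp: A_closed)

lemma T_comm: "h \<in> H \<Longrightarrow> k \<in> H \<Longrightarrow> x \<in> {0..1} \<Longrightarrow> T h (T k x) = T k (T h x)"
  using T_add[of h k x] T_add[of k h x] add_comm by simp

lemma fixed_b: "fixed x \<Longrightarrow> fixed (b x)"
proof -
  assume x: "fixed x"
  have "T h (b x) = b x" if h: "h \<in> H" for h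
    using b_conj[of "A h" x] x A_closed[OF h] BA[OF h] by (auto simp: fixed_def)
  then show ?thesis using x smooth01_maps[OF b_smooth] by (auto simp: fixed_def)
qed

text \<open>Conjugation by \<open>a\<close> contributes the factor \<open>a' (b e)\<close> to both
  sides, where it cancels at a common fixed point. Thus the derivatives of all
  \<open>T ((A ^^ n) h)\<close> at \<open>e\<close> are values of the single function
  \<open>T' h\<close>, whose logarithm is bounded.\<close>

lemma deriv_fixed_funpow:
  assumes "fixed e" "h \<in> H"
  shows "T' ((A ^^ n) h) e = T' h ((b ^^ n) e)"
  using assms(1)
proof (induction n arbitrary: e)
  case (Suc n)
  let ?k = "(A ^^ n) h"
  have k: "?k \<in> H" using funpow_A_closed assms(2) .
  have be: "fixed (b e)" using fixed_b Suc.prems .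
  have e: "e \<in> {0..1}" "b e \<in> {0..1}" using Suc.prems be by (auto simp: fixed_def)
  have "a' (T ?k (b e)) * T' ?k (b e) = T' (A ?k) (a (b e)) * a' (b e)"
    by (rule smooth01_compose_deriv_unique[OF a_smooth T_smooth[OF k] T_smooth[OF A_closed[OF k]] a_smooth])
      (use a_conj[OF k] e in auto)
  moreover have "T ?k (b e) = b e" using be k by (auto simp: fixed_def)
  moreover have "0 < a' (b e)" using smooth01_pos[OF a_smooth e(2)] .
  ultimately have "T' (A ?k) e = T' ?k (b e)" using ab[OF e(1)] by simp
  then show ?case using Suc.IH[OF be] by (simp add: funpow_swap1)
qed simp

lemma deriv_fixed_bounded:
  assumes e: "fixed e" and h: "h \<in> H"
  shows "\<exists>C. \<forall>n. \<bar>ln (T' ((A ^^ n) h) e)\<bar> \<le> C"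
proof -
  obtain C where C: "\<And>x. x \<in> {0..1} \<Longrightarrow> \<bar>ln (T' h x)\<bar> \<le> C"
    using smooth01_ln_deriv_bounded[OF T_smooth[OF h]] by blast
  have "(b ^^ n) e \<in> {0..1}" for n using smooth01_funpow_maps[OF b_smooth] e by (auto simp: fixed_def)
  then show ?thesis using C deriv_fixed_funpow[OF e h] by metis
qed

lemma deriv_fixed_eq_1:
  assumes e: "fixed e" and h: "h \<in> H"
  shows "T' h e = 1"
proof -
  interpret swap: hyperbolic_action H add T T' B A b b' a a' by (rule swapped)
  have e01: "e \<in> {0..1}" using e by (simp add: fixed_def)
  have pos: "0 < T' k e" if "k \<in> H" for k using smooth01_pos[OF T_smooth[OF that] e01] .
  have "ln (T' h e) = 0"
  proof (rule hyperbolic[of "\<lambda>h. ln (T' h e)"])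
    fix h k assume hk: "h \<in> H" "k \<in> H"
    have "T' (add h k) e * 1 = T' h (T k e) * T' k e"
      by (rule smooth01_compose_deriv_unique[OF T_smooth smooth01_id T_smooth T_smooth])
        (use hk e01 T_add add_closed in auto)
    then have "T' (add h k) e = T' h e * T' k e" using e hk by (simp add: fixed_def)
    then show "ln (T' (add h k) e) = ln (T' h e) + ln (T' k e)" using pos hk by (simp add: ln_mult_pos)
  qed (use deriv_fixed_bounded[OF e] swap.deriv_fixed_bounded[OF e] h in auto)
  then show ?thesis using pos[OF h] by (metis exp_ln exp_zero)
qed

lemma component:
  assumes h: "h \<in> H" and x: "x \<in> {0..1}" "T h x \<noteq> x"
  obtains p q f where "p < x" "x < q" "f \<in> H" "contracting_interval (T f) (T' f) p q"
    "T h p = p" "T h q = q" "\<And>y. y \<in> {p<..<q} \<Longrightarrow> T h y \<noteq> y"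
proof -
  obtain p q where pq: "0 \<le> p" "p < x" "x < q" "q \<le> 1" "T h p = p" "T h q = q"
    "(\<forall>y\<in>{p<..<q}. T h y < y) \<or> (\<forall>y\<in>{p<..<q}. y < T h y)"
    using smooth01_component[OF T_smooth[OF h] x] by blast
  obtain k where k: "k \<in> H" "\<And>x. x \<in> {0..1} \<Longrightarrow> T k (T h x) = x" using T_inverse[OF h] by blast
  have "\<exists>f\<in>H. contracting_interval (T f) (T' f) p q"
    using pq(7)
  proof
    assume "\<forall>y\<in>{p<..<q}. T h y < y"
    then have "contracting_interval (T h) (T' h) p q"
      using T_smooth[OF h] pq by unfold_locales auto
    then show ?thesis using h by blast
  next
    assume *: "\<forall>y\<in>{p<..<q}. y < T h y"
    have "T k y < y" if y: "y \<in> {p<..<q}" for y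
    proof -
      have y01: "y \<in> {0..1}" using y pq by auto
      have "T k y < T k (T h y)"
        using smooth01_less[OF T_smooth[OF k(1)], of y "T h y"] * y y01 smooth01_maps[OF T_smooth[OF h] y01] by auto
      then show ?thesis using k(2)[OF y01] by simp
    qed
    then have "contracting_interval (T k) (T' k) p q"
      using T_smooth[OF k(1)] pq k(2)[of p] k(2)[of q] by unfold_locales auto
    then show ?thesis using k by blast
  qed
  then show ?thesis using that pq by (metis less_irrefl)
qed

text \<open>Commuting with \<open>T k\<close>, the map \<open>T h\<close> sends fixed points of
  \<open>T k\<close> to fixed points of \<open>T k\<close>. It keeps the sides of \<open>e\<close>,
  so it can move \<open>p\<close> and \<open>q\<close> only outwards; the same holds for its
  inverse, which gives equality.\<close>

lemma commuting_preserves_component: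
  assumes h: "h \<in> H" and k: "k \<in> H" and e: "T h e = e" "p < e" "e < q" and pq: "0 \<le> p" "q \<le> 1"
    and Tpq: "T k p = p" "T k q = q" and moved: "\<And>y. y \<in> {p<..<q} \<Longrightarrow> T k y \<noteq> y"
  shows "T h p = p" "T h q = q"
proof -
  obtain h' where h': "h' \<in> H" "\<And>x. x \<in> {0..1} \<Longrightarrow> T h' (T h x) = x \<and> T h (T h' x) = x"
    using T_inverse[OF h] by blast
  have p01: "p \<in> {0..1}" "q \<in> {0..1}" "e \<in> {0..1}" using e pq by auto
  have *: "T g p \<le> p \<and> q \<le> T g q" if g: "g \<in> H" "T g e = e" for g
  proof -
    have "T g p < e" "e < T g q" using smooth01_less[OF T_smooth[OF g(1)], of p e] smooth01_less[OF T_smooth[OF g(1)], of e q] g e pq by auto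
    moreover have "T k (T g p) = T g p" "T k (T g q) = T g q"
      using T_comm[OF k g(1) p01(1)] T_comm[OF k g(1) p01(2)] Tpq by auto
    ultimately show ?thesis using moved[of "T g p"] moved[of "T g q"] e by force
  qed
  have "T h' e = e" using h'(2)[OF p01(3)] e by simp
  then have "T h' p \<le> p" "q \<le> T h' q" using * h' by auto
  then have "p \<le> T h p" "T h q \<le> q"
    using smooth01_le[OF T_smooth[OF h], of "T h' p" p] smooth01_le[OF T_smooth[OF h], of q "T h' q"] h'(2) p01
      smooth01_maps[OF T_smooth[OF h'(1)]] by force+
  then show "T h p = p" "T h q = q" using *[OF h e(1)] by auto
qed

text \<open>If some \<open>T k\<close> moved the end \<open>e\<close>, then \<open>e\<close> would
  lie inside a component (p', q') of \<open>T k\<close>. This component is preserved by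
  \<open>T h\<close>, which fixes \<open>e\<close>, so Kopell's lemma makes \<open>T h\<close> the
  identity there. But (p', q') meets (p, q), where \<open>T h\<close> moves every point.\<close>

lemma component_ends_fixed:
  assumes h: "h \<in> H" and pq: "0 \<le> p" "p < q" "q \<le> 1" and Tpq: "T h p = p" "T h q = q"
    and moved: "\<And>y. y \<in> {p<..<q} \<Longrightarrow> T h y \<noteq> y" and e: "e \<in> {p, q}"
  shows "fixed e"
proof (rule ccontr)
  assume "\<not> fixed e"
  have e01: "e \<in> {0..1}" using e pq by auto
  then obtain k where k: "k \<in> H" "T k e \<noteq> e" using \<open>\<not> fixed e\<close> by (auto simp: fixed_def)
  obtain p' q' f where c: "p' < e" "e < q'" "f \<in> H" "contracting_interval (T f) (T' f) p' q'"
    "T k p' = p'" "T k q' = q'" "\<And>y. y \<in> {p'<..<q'} \<Longrightarrow> T k y \<noteq> y"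
    using component[OF k(1) e01 k(2)] by blast
  interpret contracting_interval "T f" "T' f" p' q' by (rule c)
  have he: "T h e = e" using e Tpq by auto
  have hpq: "T h p' = p'" "T h q' = q'"
    using commuting_preserves_component[OF h k(1) he c(1,2) bounds(1,3) c(5,6,7)] by auto
  obtain y where y: "y \<in> {p<..<q}" "y \<in> {p'<..<q'}"
  proof (cases "e = p")
    case True
    then show ?thesis using that[of "(p + min q q') / 2"] c pq by (auto simp: min_def field_simps)
  next
    case False
    then show ?thesis using that[of "(q + max p p') / 2"] c pq e by (auto simp: max_def field_simps)
  qed
  have "T h y = y"
    by (rule commuting_fixed_point_imp_identity[OF T_smooth[OF h] _ hpq _ he y(2)])
      (use T_comm[OF h c(3)] c interval_unit in auto)
  then show False using moved y by blast
qed

text \<open>As \<open>H\<close> is commutative and fixes both ends, the coordinate built from one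
  \<open>f\<close> serves all of \<open>H\<close>, and its slopes \<open>T' k u\<close> are 1 by
  \<open>deriv_fixed_eq_1\<close>. The clause \<open>\<tau> f < 0\<close> records that \<tau> is
  nonzero, the fact that will contradict hyperbolicity.\<close>

lemma translation_coordinate:
  assumes h: "h \<in> H" and x: "x \<in> {0..1}" "T h x \<noteq> x"
  obtains u v f \<Phi> D \<tau> where "u < x" "x < v" "f \<in> H" "contracting_interval (T f) (T' f) u v"
    "fixed u" "fixed v"
    "\<And>x. x \<in> {u<..<v} \<Longrightarrow> (\<Phi> has_real_derivative D x) (at x)" "\<And>x. x \<in> {u<..<v} \<Longrightarrow> 0 < D x"
    "continuous_on {u<..<v} D" "\<And>k x. k \<in> H \<Longrightarrow> x \<in> {u<..<v} \<Longrightarrow> \<Phi> (T k x) = \<Phi> x + \<tau> k"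
    "\<And>h k. h \<in> H \<Longrightarrow> k \<in> H \<Longrightarrow> \<tau> (add h k) = \<tau> h + \<tau> k" "\<tau> f < (0::real)"
proof -
  obtain u v f where c: "u < x" "x < v" "f \<in> H" "contracting_interval (T f) (T' f) u v"
    "T h u = u" "T h v = v" "\<And>y. y \<in> {u<..<v} \<Longrightarrow> T h y \<noteq> y"
    using component[OF h x] by blast
  interpret contracting_interval "T f" "T' f" u v by (rule c)
  have fixed: "fixed u" "fixed v" using component_ends_fixed[OF h bounds c(5-7)] by auto
  obtain \<Phi> D where \<Phi>: "\<And>x. x \<in> {u<..<v} \<Longrightarrow> (\<Phi> has_real_derivative D x) (at x)"
    "\<And>x. x \<in> {u<..<v} \<Longrightarrow> 0 < D x" "continuous_on {u<..<v} D"
    and "\<And>k. k \<in> H \<Longrightarrow> \<exists>c. \<forall>x\<in>{u<..<v}. \<Phi> (T k x) = \<Phi> x + c"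
  proof (rule coordinate)
    fix \<Phi> D
    assume "\<And>x. x \<in> {u<..<v} \<Longrightarrow> (\<Phi> has_real_derivative D x) (at x)" "\<And>x. x \<in> {u<..<v} \<Longrightarrow> 0 < D x"
      "continuous_on {u<..<v} D"
      and *: "\<And>g g'. smooth01 g g' \<Longrightarrow> (\<And>x. x \<in> {u<..<v} \<Longrightarrow> g (T f x) = T f (g x)) \<Longrightarrow> g u = u \<Longrightarrow> g v = v
       \<Longrightarrow> \<exists>c. \<forall>x\<in>{u<..<v}. \<Phi> (g x) = g' u * \<Phi> x + c"
    moreover have "\<exists>c. \<forall>x\<in>{u<..<v}. \<Phi> (T k x) = \<Phi> x + c" if k: "k \<in> H" for k
    proof -
      have "\<exists>c. \<forall>x\<in>{u<..<v}. \<Phi> (T k x) = T' k u * \<Phi> x + c"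
        by (rule *[OF T_smooth[OF k]]) (use T_comm[OF k c(3)] interval_unit fixed k in \<open>auto simp: fixed_def\<close>)
      then show ?thesis using deriv_fixed_eq_1[OF fixed(1) k] by simp
    qed
    ultimately show ?thesis by (intro that[of \<Phi> D]) auto
  qed
  then have "\<exists>\<tau>. \<forall>k\<in>H. \<forall>x\<in>{u<..<v}. \<Phi> (T k x) = \<Phi> x + \<tau> k" by metis
  then obtain \<tau> where \<tau>: "\<And>k x. k \<in> H \<Longrightarrow> x \<in> {u<..<v} \<Longrightarrow> \<Phi> (T k x) = \<Phi> x + \<tau> k" by blast
  have x': "x \<in> {u<..<v}" using c by auto
  have mem: "T k x \<in> {u<..<v}" if "k \<in> H" for k
    using smooth01_interval[OF T_smooth[OF that] _ _ _ _ x'] bounds fixed that by (auto simp: fixed_def)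
  have add: "\<tau> (add h k) = \<tau> h + \<tau> k" if hk: "h \<in> H" "k \<in> H" for h k
    using \<tau>[OF add_closed[OF hk] x'] \<tau>[OF hk(1) mem[OF hk(2)]] \<tau>[OF hk(2) x'] T_add[OF hk x(1)] by simp
  have "\<Phi> (T f x) < \<Phi> x"
  proof (rule DERIV_pos_imp_increasing[OF below[OF x']])
    fix t assume "T f x \<le> t" "t \<le> x"
    then have "t \<in> {u<..<v}" using mem[OF c(3)] x' by auto
    then show "\<exists>d. (\<Phi> has_real_derivative d) (at t) \<and> 0 < d" using \<Phi> by blast
  qed
  then have "\<tau> f < 0" using \<tau>[OF c(3) x'] by simp
  then show ?thesis using that[OF c(1-4) fixed \<Phi> \<tau> add] by blast
qed

end

section \<open>Continuous functions with periods\<close>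

lemma periodic_continuous_bounded:
  fixes \<beta> :: "real \<Rightarrow> real"
  assumes cont: "continuous_on UNIV \<beta>" and t: "t \<noteq> 0" and per: "\<And>y. \<beta> (y + t) = \<beta> y"
  obtains C where "\<And>y. \<bar>\<beta> y\<bar> \<le> C"
proof -
  have per_int: "\<beta> (y + of_int m * t) = \<beta> y" for y m
  proof (induction m arbitrary: y rule: int_induct[where k = 0])
    case (step1 i)
    then show ?case using per[of "y + of_int i * t"] by (simp add: algebra_simps)
  next
    case (step2 i)
    then show ?case using per[of "y + of_int (i - 1) * t"] by (simp add: algebra_simps)
  qed simp
  have "compact (\<beta> ` {-\<bar>t\<bar>..\<bar>t\<bar>})"
    by (rule compact_continuous_image[OF continuous_on_subset[OF cont]]) auto
  then have "bounded (\<beta> ` {-\<bar>t\<bar>..\<bar>t\<bar>})" by (rule compact_imp_bounded)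
  then obtain C where C: "\<forall>z\<in>\<beta> ` {-\<bar>t\<bar>..\<bar>t\<bar>}. norm z \<le> C" unfolding bounded_iff by blast
  have "\<bar>\<beta> y\<bar> \<le> C" for y
  proof -
    define z where "z = y + of_int (- \<lfloor>y / t\<rfloor>) * t"
    have "z = frac (y / t) * t" using t by (simp add: z_def frac_def field_simps)
    then have "\<bar>z\<bar> \<le> \<bar>t\<bar>"
      using frac_lt_1[of "y / t"] frac_ge_0[of "y / t"] by (simp add: abs_mult mult_left_le_one_le)
    then have "z \<in> {-\<bar>t\<bar>..\<bar>t\<bar>}" by auto
    moreover have "\<beta> z = \<beta> y" unfolding z_def by (rule per_int)
    ultimately show ?thesis using C by (metis imageI real_norm_def)
  qed
  then show ?thesis by (rule that)
qed

text \<open>The integer multiples of the periods \<open>s n\<close> approximate every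
  \<open>y\<close>, and \<beta> takes the value \<open>\<beta> 0\<close> at all of them.\<close>

lemma small_periods_imp_constant:
  fixes \<beta> :: "real \<Rightarrow> real"
  assumes cont: "continuous_on UNIV \<beta>" and s: "\<And>n. s n \<noteq> 0" "s \<longlonglongrightarrow> 0"
    and per: "\<And>n y. \<beta> (y + s n) = \<beta> y"
  shows "\<beta> y = \<beta> 0"
proof -
  have per_int: "\<beta> (of_int m * s n) = \<beta> 0" for m n
  proof (induction m rule: int_induct[where k = 0])
    case (step1 i)
    then show ?case using per[of "of_int i * s n" n] by (simp add: algebra_simps)
  next
    case (step2 i)
    then show ?case using per[of "of_int (i - 1) * s n" n] by (simp add: algebra_simps)
  qed simp
  have "(\<lambda>n. of_int \<lfloor>y / s n\<rfloor> * s n - y) \<longlonglongrightarrow> 0"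
  proof (rule Lim_null_comparison[OF _ tendsto_rabs_zero[OF s(2)]])
    have "norm (of_int \<lfloor>y / s n\<rfloor> * s n - y) \<le> \<bar>s n\<bar>" for n
    proof -
      have "of_int \<lfloor>y / s n\<rfloor> * s n - y = - (frac (y / s n) * s n)" using s(1)[of n] by (simp add: frac_def field_simps)
      then show ?thesis
        using frac_lt_1[of "y / s n"] frac_ge_0[of "y / s n"] by (simp add: abs_mult mult_left_le_one_le)
    qed
    then show "\<forall>\<^sub>F n in sequentially. norm (of_int \<lfloor>y / s n\<rfloor> * s n - y) \<le> \<bar>s n\<bar>" by simp
  qed
  then have "(\<lambda>n. of_int \<lfloor>y / s n\<rfloor> * s n) \<longlonglongrightarrow> y" by (simp add: LIM_zero_iff)
  moreover have "isCont \<beta> y" using cont by (simp add: continuous_on_eq_continuous_at)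
  ultimately have "(\<lambda>n. \<beta> (of_int \<lfloor>y / s n\<rfloor> * s n)) \<longlonglongrightarrow> \<beta> y" by (rule isCont_tendsto_compose[rotated])
  then show ?thesis using per_int by (simp add: LIMSEQ_const_iff)
qed

lemma eq_0_if_multiples_bounded:
  fixes d C :: real
  assumes "\<And>n::nat. \<bar>real n * d\<bar> \<le> C"
  shows "d = 0"
proof (rule ccontr)
  assume "d \<noteq> 0"
  then obtain n :: nat where "C < real n * \<bar>d\<bar>" using reals_Archimedean3[of "\<bar>d\<bar>"] by auto
  then show False using assms[of n] by (simp add: abs_mult)
qed

section \<open>Wandering intervals and fixed points of \<open>H\<close>\<close>

context hyperbolic_action
begin

lemma fixed_a: "fixed x \<Longrightarrow> fixed (a x)"
  by (rule hyperbolic_action.fixed_b[OF swapped])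

lemma funpow_conj:
  assumes "h \<in> H" "x \<in> {0..1}"
  shows "(b ^^ n) (T ((A ^^ n) h) x) = T h ((b ^^ n) x)"
  using assms(2)
proof (induction n arbitrary: x)
  case (Suc n)
  let ?k = "(A ^^ n) h"
  have k: "?k \<in> H" using funpow_A_closed assms(1) .
  have "b (T (A ?k) x) = T ?k (b x)" using b_conj[OF A_closed[OF k] Suc.prems] BA[OF k] by simp
  then show ?case using Suc.IH[of "b x"] smooth01_maps[OF b_smooth Suc.prems] by (simp add: funpow_swap1)
qed simp

text \<open>The maps \<open>T (A\<^sup>n h) = a\<^sup>n \<circ> T h \<circ> b\<^sup>n\<close> do not contract much, as the
  distortion of \<open>b\<^sup>n\<close> on a wandering interval is bounded.\<close>

lemma uniform_expansion:
  assumes h: "h \<in> H" and uv: "fixed u" "fixed v" "u < v" and disj: "v \<le> b u \<or> b v \<le> u"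
  obtains \<epsilon> where "0 < \<epsilon>"
    "\<And>n x y. \<lbrakk>u < x; x < y; y < v\<rbrakk> \<Longrightarrow> \<epsilon> * (y - x) \<le> T ((A ^^ n) h) y - T ((A ^^ n) h) x"
proof -
  have uv01: "0 \<le> u" "v \<le> 1" using uv by (auto simp: fixed_def)
  obtain C where C: "0 < C" "\<And>n x y x' y'. \<lbrakk>u \<le> x; x < y; y \<le> v; u \<le> x'; x' < y'; y' \<le> v\<rbrakk> \<Longrightarrow>
     ((b ^^ n) y - (b ^^ n) x) * (y' - x') \<le> C * (((b ^^ n) y' - (b ^^ n) x') * (y - x))"
    using bounded_distortion[OF b_smooth uv01(1) uv(3) uv01(2) disj] by blast
  obtain M where M: "\<And>x. x \<in> {0..1} \<Longrightarrow> \<bar>ln (T' h x)\<bar> \<le> M"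
    using smooth01_ln_deriv_bounded[OF T_smooth[OF h]] by blast
  have "(exp (-M) / C) * (y - x) \<le> T ((A ^^ n) h) y - T ((A ^^ n) h) x"
    if xy: "u < x" "x < y" "y < v" for n x y
  proof -
    let ?k = "(A ^^ n) h"
    have k: "?k \<in> H" using funpow_A_closed h .
    have xy01: "x \<in> {0..1}" "y \<in> {0..1}" using xy uv01 by auto
    have mem: "T ?k z \<in> {u<..<v}" if "z \<in> {u<..<v}" for z
      using smooth01_interval[OF T_smooth[OF k] _ _ _ _ that] uv uv01 k by (auto simp: fixed_def)
    have lt: "T ?k x < T ?k y" using smooth01_less[OF T_smooth[OF k]] xy xy01 by auto
    have b01: "(b ^^ n) x \<in> {0..1}" "(b ^^ n) y \<in> {0..1}"
      using smooth01_funpow_maps[OF b_smooth] xy01 by auto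
    have blt: "(b ^^ n) x < (b ^^ n) y"
    proof (induction n)
      case (Suc n)
      then show ?case
        using smooth01_less[OF b_smooth, of "(b ^^ n) x" "(b ^^ n) y"]
          smooth01_funpow_maps[OF b_smooth xy01(1), of n] smooth01_funpow_maps[OF b_smooth xy01(2), of n] by auto
    qed (use xy in simp)
    obtain s where s: "(b ^^ n) x < s" "s < (b ^^ n) y"
      "T h ((b ^^ n) y) - T h ((b ^^ n) x) = ((b ^^ n) y - (b ^^ n) x) * T' h s"
      using smooth01_mvt[OF T_smooth[OF h] _ blt] b01 by auto
    have s01: "s \<in> {0..1}" using s b01 by auto
    have "- M \<le> ln (T' h s)" using M[OF s01] by linarith
    then have "exp (- M) \<le> T' h s" using smooth01_pos[OF T_smooth[OF h] s01] by (metis exp_le_cancel_iff exp_ln)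
    then have "((b ^^ n) y - (b ^^ n) x) * exp (- M) \<le> T h ((b ^^ n) y) - T h ((b ^^ n) x)"
      unfolding s(3) using blt by (intro mult_left_mono) auto
    then have "((b ^^ n) y - (b ^^ n) x) * exp (- M) * (y - x) \<le> (T h ((b ^^ n) y) - T h ((b ^^ n) x)) * (y - x)"
      using xy by (intro mult_right_mono) auto
    \<comment> \<open>By \<open>funpow_conj\<close>, \<open>b ^^ n\<close> carries the action of
      \<open>(A ^^ n) h\<close> to that of \<open>h\<close>. The distortion bound for
      \<open>b ^^ n\<close> then compares [x, y] with its image under \<open>T ?k\<close>; both lie
      in (u, v) since \<open>u\<close> and \<open>v\<close> are fixed by \<open>H\<close>.\<close>
    also have "\<dots> = ((b ^^ n) (T ?k y) - (b ^^ n) (T ?k x)) * (y - x)"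
      using funpow_conj[OF h] xy01 by simp
    also have "\<dots> \<le> C * (((b ^^ n) y - (b ^^ n) x) * (T ?k y - T ?k x))"
      by (rule C(2)) (use mem[of x] mem[of y] xy lt in auto)
    finally have "((b ^^ n) y - (b ^^ n) x) * (exp (- M) * (y - x)) \<le> ((b ^^ n) y - (b ^^ n) x) * (C * (T ?k y - T ?k x))"
      by (simp add: mult_ac)
    then have "exp (- M) * (y - x) \<le> C * (T ?k y - T ?k x)" using blt by simp
    then show ?thesis using C(1) by (simp add: divide_simps mult.commute)
  qed
  moreover have "0 < exp (-M) / C" using C(1) by simp
  ultimately show ?thesis using that by blast
qed

text \<open>Since \<open>T ?k\<close> commutes with \<open>T f\<close>, the displacement of
  \<open>T f\<close> at \<open>T ?k x\<close> is the length of the image of [T f x, x] under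
  \<open>T ?k\<close>, and uniform expansion bounds it below by a \<delta> independent of
  \<open>n\<close>. So \<open>T ?k x\<close> stays in a compact part of (u, v), on which \<Phi> is
  bounded.\<close>

lemma translation_bounded:
  assumes h: "h \<in> H" and uv: "fixed u" "fixed v" and disj: "v \<le> b u \<or> b v \<le> u"
    and f: "f \<in> H" "contracting_interval (T f) (T' f) u v"
    and cont: "continuous_on {u<..<v} \<Phi>"
    and \<tau>: "\<And>k x. k \<in> H \<Longrightarrow> x \<in> {u<..<v} \<Longrightarrow> \<Phi> (T k x) = \<Phi> x + \<tau> k"
  shows "\<exists>C. \<forall>n. \<bar>\<tau> ((A ^^ n) h) :: real\<bar> \<le> C"
proof -
  interpret contracting_interval "T f" "T' f" u v by (rule f)
  define x where "x = (u + v) / 2"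
  have x: "x \<in> {u<..<v}" using bounds by (auto simp: x_def)
  have fx: "T f x \<in> {u<..<v}" "T f x < x" using iterate_mem[OF x, of 1] below[OF x] by auto
  obtain \<epsilon> where \<epsilon>: "0 < \<epsilon>"
    "\<And>n x y. \<lbrakk>u < x; x < y; y < v\<rbrakk> \<Longrightarrow> \<epsilon> * (y - x) \<le> T ((A ^^ n) h) y - T ((A ^^ n) h) x"
    using uniform_expansion[OF h uv bounds(2) disj] by blast
  define \<delta> where "\<delta> = \<epsilon> * (x - T f x)"
  have \<delta>: "0 < \<delta>" using \<epsilon> fx by (simp add: \<delta>_def)
  define K where "K = {u..v} \<inter> (\<lambda>y. y - T f y) -` {\<delta>..}"
  have "continuous_on {u..v} (\<lambda>y. y - T f y)"
    using bounds by (intro continuous_on_diff continuous_on_id continuous_on_subset[OF smooth01_continuous[OF smooth]]) auto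
  then have "closed K" unfolding K_def by (rule continuous_closed_preimage) auto
  moreover have "bounded K" unfolding K_def by (rule bounded_subset[of "{u..v}"]) auto
  ultimately have "compact K" using compact_eq_bounded_closed by blast
  \<comment> \<open>The displacement of \<open>T f\<close> vanishes at both ends, so \<delta> > 0
    keeps \<open>K\<close> away from them.\<close>
  moreover have "K \<subseteq> {u<..<v}"
    using \<delta> fixes_ends by (auto simp: K_def order_less_le)
  ultimately have "compact (\<Phi> ` K)" using cont compact_continuous_image continuous_on_subset by blast
  then have "bounded (\<Phi> ` K)" by (rule compact_imp_bounded)
  then obtain C where C: "\<forall>z\<in>\<Phi> ` K. norm z \<le> C" unfolding bounded_iff by blast
  have "\<bar>\<tau> ((A ^^ n) h)\<bar> \<le> C + \<bar>\<Phi> x\<bar>" for n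
  proof -
    let ?k = "(A ^^ n) h"
    have k: "?k \<in> H" using funpow_A_closed h .
    have mem: "T ?k x \<in> {u<..<v}"
      using smooth01_interval[OF T_smooth[OF k] _ _ _ _ x] uv bounds k by (auto simp: fixed_def)
    have "T ?k (T f x) = T f (T ?k x)" using T_comm[OF k f(1)] x interval_unit by blast
    then have "\<delta> \<le> T ?k x - T f (T ?k x)" using \<epsilon>(2)[of "T f x" x n] x fx by (simp add: \<delta>_def)
    then have "T ?k x \<in> K" using mem by (simp add: K_def)
    then have "\<bar>\<Phi> (T ?k x)\<bar> \<le> C" using C by auto
    then show ?thesis using \<tau>[OF k x] by linarith
  qed
  then show ?thesis by blast
qed

lemma no_interior_fixed:
  assumes e: "e \<in> {0<..<1}"
  shows "\<not> fixed e"
proof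
  assume fe: "fixed e"
  interpret swap: hyperbolic_action H add T T' B A b b' a a' by (rule swapped)
  obtain h x where hx: "h \<in> H" "x \<in> {0..1}" "T h x \<noteq> x" using nontrivial by blast
  obtain u v f \<Phi> D \<tau> where c: "u < x" "x < v" "f \<in> H" "contracting_interval (T f) (T' f) u v"
    "fixed u" "fixed v"
    "\<And>x. x \<in> {u<..<v} \<Longrightarrow> (\<Phi> has_real_derivative D x) (at x)"
    "\<And>k x. k \<in> H \<Longrightarrow> x \<in> {u<..<v} \<Longrightarrow> \<Phi> (T k x) = \<Phi> x + \<tau> k"
    "\<And>h k. h \<in> H \<Longrightarrow> k \<in> H \<Longrightarrow> \<tau> (add h k) = \<tau> h + \<tau> k" "\<tau> f < (0::real)"
    using translation_coordinate[OF hx] by metis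
  interpret contracting_interval "T f" "T' f" u v by (rule c)
  have nofix: "y \<le> u \<or> v \<le> y" if "fixed y" for y
    using that below[of y] c(3) by (force simp: fixed_def)
  \<comment> \<open>\<open>a\<close> and \<open>b\<close> are mutually inverse increasing maps, so
    inequalities move across. In particular disjointness for \<open>a\<close> and for
    \<open>b\<close> are equivalent, and both directions of the orbit can be bounded.\<close>
  have le_ab: "a y \<le> z \<longleftrightarrow> y \<le> b z" "b y \<le> z \<longleftrightarrow> y \<le> a z" if "y \<in> {0..1}" "z \<in> {0..1}" for y z
    using smooth01_le[OF a_smooth, of y "b z"] smooth01_le[OF b_smooth, of "a y" z]
      smooth01_le[OF b_smooth, of y "a z"] smooth01_le[OF a_smooth, of "b y" z]
      smooth01_maps[OF a_smooth] smooth01_maps[OF b_smooth] ab ba that by auto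
  have uv01: "u \<in> {0..1}" "v \<in> {0..1}" using bounds by auto
  \<comment> \<open>At least one end lies in (0, 1): \<open>u\<close>, or else \<open>v\<close>,
    which is at most \<open>e\<close>. Being fixed by \<open>H\<close>, it is moved by
    \<open>a\<close>. One of its images under \<open>a\<close> and \<open>b\<close> lies on the side
    of the interval and is again fixed by \<open>H\<close>, so it has to jump over all of (u,
    v).\<close>
  have "v \<le> a u \<or> a v \<le> u"
  proof (cases "0 < u")
    case True
    then have "u \<in> {0<..<1}" using bounds by auto
    then have "a u \<noteq> u" using no_global_fixed_point c(5) by (auto simp: fixed_def)
    then consider "u < a u" | "u < b u" using le_ab[OF uv01(1) uv01(1)] by fastforce
    then show ?thesis
      using nofix[OF fixed_a[OF c(5)]] nofix[OF fixed_b[OF c(5)]] le_ab[OF uv01(2,1)] by cases auto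
  next
    case False
    then have "v \<le> e" using nofix[OF fe] e by auto
    then have "v \<in> {0<..<1}" using bounds e by auto
    then have "a v \<noteq> v" using no_global_fixed_point c(6) by (auto simp: fixed_def)
    then consider "a v < v" | "b v < v" using le_ab[OF uv01(2) uv01(2)] by fastforce
    then show ?thesis
      using nofix[OF fixed_a[OF c(6)]] nofix[OF fixed_b[OF c(6)]] le_ab[OF uv01(2,1)] by cases auto
  qed
  then have disj: "v \<le> a u \<or> a v \<le> u" "v \<le> b u \<or> b v \<le> u" using le_ab[OF uv01(2,1)] by auto
  have cont: "continuous_on {u<..<v} \<Phi>"
    using c(7) by (intro continuous_at_imp_continuous_on ballI) (blast intro: DERIV_isCont)
  have "\<tau> f = 0"
  proof (rule hyperbolic[where \<sigma> = \<tau>])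
    show "\<exists>C. \<forall>n. \<bar>\<tau> ((A ^^ n) h)\<bar> \<le> C" if "h \<in> H" for h
      by (rule translation_bounded[OF that c(5,6) disj(2) c(3,4) cont c(8)])
    show "\<exists>C. \<forall>n. \<bar>\<tau> ((B ^^ n) h)\<bar> \<le> C" if "h \<in> H" for h
      by (rule swap.translation_bounded[OF that c(5,6) disj(1) c(3,4) cont c(8)])
  qed (fact c(9) c(3))+
  then show False using c(10) by simp
qed

end

section \<open>The affine coordinate on (0, 1)\<close>

lemma increasing_diffeo_inverse:
  assumes der: "\<And>x. x \<in> {0<..<1} \<Longrightarrow> (\<Phi> has_real_derivative D x) (at x)"
    and pos: "\<And>x. x \<in> {0<..<1} \<Longrightarrow> 0 < D x" and onto: "\<Phi> ` {0<..<1} = (UNIV :: real set)"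
  obtains \<Psi> where "\<And>y. \<Psi> y \<in> {0<..<1::real}" "\<And>y. \<Phi> (\<Psi> y) = y"
    "\<And>x. x \<in> {0<..<1} \<Longrightarrow> \<Psi> (\<Phi> x) = x"
    "\<And>y. (\<Psi> has_real_derivative inverse (D (\<Psi> y))) (at y)"
proof -
  have inc: "\<Phi> x < \<Phi> y" if xy: "x \<in> {0<..<1}" "y \<in> {0<..<1}" "x < y" for x y
  proof (rule DERIV_pos_imp_increasing[OF xy(3)])
    fix t assume "x \<le> t" "t \<le> y"
    then have "t \<in> {0<..<1}" using xy by auto
    then show "\<exists>d. (\<Phi> has_real_derivative d) (at t) \<and> 0 < d" using der pos by blast
  qed
  have inj: "inj_on \<Phi> {0<..<1}"
  proof (rule inj_onI)
    fix x y :: real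
    assume "x \<in> {0<..<1}" "y \<in> {0<..<1}" "\<Phi> x = \<Phi> y"
    then show "x = y" using inc[of x y] inc[of y x] by (cases x y rule: linorder_cases) auto
  qed
  define \<Psi> where "\<Psi> = inv_into {0<..<1} \<Phi>"
  have mem: "\<Psi> y \<in> {0<..<1}" for y unfolding \<Psi>_def by (rule inv_into_into) (simp add: onto)
  have right: "\<Phi> (\<Psi> y) = y" for y unfolding \<Psi>_def by (rule f_inv_into_f) (simp add: onto)
  have left: "\<Psi> (\<Phi> x) = x" if "x \<in> {0<..<1}" for x unfolding \<Psi>_def using inj that by (rule inv_into_f_f)
  have cont: "isCont \<Psi> y" for y
  proof -
    let ?x = "\<Psi> y"
    have "isCont \<Psi> (\<Phi> ?x)"
    proof (rule isCont_inverse_function2[where f = \<Phi> and g = \<Psi> and x = ?x and a = "?x / 2" and b = "(?x + 1) / 2"])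
      show "?x / 2 < ?x" "?x < (?x + 1) / 2" using mem[of y] by auto
      fix z assume z: "?x / 2 \<le> z" "z \<le> (?x + 1) / 2"
      have "0 < ?x" "?x < 1" using mem[of y] by auto
      then have "0 < ?x / 2" "(?x + 1) / 2 < 1" by simp_all
      then have "0 < z" "z < 1" using z by (auto intro: less_le_trans le_less_trans)
      then have z01: "z \<in> {0<..<1}" by simp
      show "\<Psi> (\<Phi> z) = z" using left z01 .
      show "isCont \<Phi> z" using der[OF z01] by (rule DERIV_isCont)
    qed
    then show ?thesis by (simp add: right)
  qed
  have "(\<Psi> has_real_derivative inverse (D (\<Psi> y))) (at y)" for y
    by (rule DERIV_inverse_function[where f = \<Phi> and a = "y - 1" and b = "y + 1"])
      (use der[OF mem, of y] pos[OF mem, of y] cont right in auto)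
  then show ?thesis using that mem right left by blast
qed

text \<open>In the coordinate, \<open>a\<close> becomes a map \<alpha> with
  \<open>\<alpha> (y + \<tau> h) = \<alpha> y + \<tau> (A h)\<close>. Subtracting the right linear
  map leaves a continuous function \<beta> with a period, hence bounded; boundedness makes every
  \<open>\<tau> h\<close> a period, and arbitrarily small periods make \<beta> constant.\<close>

lemma (in hyperbolic_action) affine_coordinate:
  obtains \<Phi> D \<tau> \<mu> c where
    "\<And>x. x \<in> {0<..<1} \<Longrightarrow> (\<Phi> has_real_derivative D x) (at x)" "\<And>x. x \<in> {0<..<1} \<Longrightarrow> 0 < D x"
    "continuous_on {0<..<1} D" "\<Phi> ` {0<..<1} = (UNIV :: real set)"
    "\<And>k x. k \<in> H \<Longrightarrow> x \<in> {0<..<1} \<Longrightarrow> \<Phi> (T k x) = \<Phi> x + \<tau> k"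
    "\<And>x. x \<in> {0<..<1} \<Longrightarrow> \<Phi> (a x) = \<mu> * \<Phi> x + c" "0 < (\<mu>::real)" "\<mu> \<noteq> 1"
proof -
  obtain h x where hx: "h \<in> H" "x \<in> {0..1}" "T h x \<noteq> x" using nontrivial by blast
  obtain u v f \<Phi> D \<tau> where c: "u < x" "x < v" "f \<in> H" "contracting_interval (T f) (T' f) u v"
    "fixed u" "fixed v"
    "\<And>x. x \<in> {u<..<v} \<Longrightarrow> (\<Phi> has_real_derivative D x) (at x)" "\<And>x. x \<in> {u<..<v} \<Longrightarrow> 0 < D x"
    "continuous_on {u<..<v} D"
    "\<And>k x. k \<in> H \<Longrightarrow> x \<in> {u<..<v} \<Longrightarrow> \<Phi> (T k x) = \<Phi> x + \<tau> k"
    "\<And>h k. h \<in> H \<Longrightarrow> k \<in> H \<Longrightarrow> \<tau> (add h k) = \<tau> h + \<tau> k" "\<tau> f < (0::real)"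
  proof (rule translation_coordinate[OF hx], goal_cases)
    case (1 u v f \<Phi> D \<tau>)
    show ?case by (rule that[OF 1(2-)])
  qed
  interpret contracting_interval "T f" "T' f" u v by (rule c)
  \<comment> \<open>Both ends are fixed by all of \<open>H\<close>, so the component is the whole of
    (0, 1).\<close>
  have "u \<notin> {0<..<1}" "v \<notin> {0<..<1}" using no_interior_fixed c(5,6) by blast+
  then have "u = 0" "v = 1" using bounds by auto
  then have der: "\<And>x. x \<in> {0<..<1} \<Longrightarrow> (\<Phi> has_real_derivative D x) (at x)"
    and pos: "\<And>x. x \<in> {0<..<1} \<Longrightarrow> 0 < D x" and contD: "continuous_on {0<..<1} D"
    and \<tau>: "\<And>k x. k \<in> H \<Longrightarrow> x \<in> {0<..<1} \<Longrightarrow> \<Phi> (T k x) = \<Phi> x + \<tau> k"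
    and below: "\<And>x. x \<in> {0<..<1} \<Longrightarrow> T f x < x"
    using c(7-10) below by auto
  note open01 = smooth01_open_maps
  have f: "f \<in> H" by (rule c(3))
  define t where "t = \<tau> f"
  have t: "t < 0" using c(12) by (simp add: t_def)
  obtain k where k: "k \<in> H" "\<And>x. x \<in> {0..1} \<Longrightarrow> T f (T k x) = x" using T_inverse[OF f] by blast
  let ?m = "1 / 2 :: real"
  \<comment> \<open>\<open>k\<close> inverts \<open>f\<close> and translates upwards; iterating
    \<open>T f\<close> and \<open>T k\<close> shows that the image of \<Phi> is unbounded on both
    sides.\<close>
  have \<tau>k: "\<tau> k = - t"
    using \<tau>[OF f, of "T k ?m"] \<tau>[OF k(1), of ?m] k(2)[of ?m] open01[OF T_smooth[OF k(1)], of ?m] by (simp add: t_def)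
  have it: "\<Phi> ((T g ^^ n) ?m) = \<Phi> ?m + n * \<tau> g \<and> (T g ^^ n) ?m \<in> {0<..<1}" if "g \<in> H" for g n
    by (induction n) (use \<tau>[OF that] open01[OF T_smooth[OF that]] in \<open>auto simp: algebra_simps\<close>)
  have contPhi: "continuous_on {0<..<1} \<Phi>"
    using der by (intro continuous_at_imp_continuous_on ballI) (blast intro: DERIV_isCont)
  have onto: "\<Phi> ` {0<..<1} = (UNIV :: real set)"
  proof -
    have conn: "connected (\<Phi> ` {0<..<1})" by (rule connected_continuous_image[OF contPhi]) simp
    have "y \<in> \<Phi> ` {0<..<1}" for y
    proof -
      obtain n :: nat where n: "\<bar>y - \<Phi> ?m\<bar> < n * (- t)" using reals_Archimedean3[of "- t"] t by auto
      have "\<Phi> ((T f ^^ n) ?m) \<in> \<Phi> ` {0<..<1}" "\<Phi> ((T k ^^ n) ?m) \<in> \<Phi> ` {0<..<1}"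
        using it[OF f, of n] it[OF k(1), of n] by blast+
      moreover have "\<Phi> ((T f ^^ n) ?m) \<le> y" "y \<le> \<Phi> ((T k ^^ n) ?m)"
        using it[OF f, of n] it[OF k(1), of n] n \<tau>k by (auto simp: t_def)
      ultimately show ?thesis using connected_contains_Icc[OF conn] by (meson atLeastAtMost_iff subsetD)
    qed
    then show ?thesis by auto
  qed
  obtain \<Psi> where \<Psi>: "\<And>y. \<Psi> y \<in> {0<..<1::real}" "\<And>y. \<Phi> (\<Psi> y) = y"
    "\<And>x. x \<in> {0<..<1} \<Longrightarrow> \<Psi> (\<Phi> x) = x"
    "\<And>y. (\<Psi> has_real_derivative inverse (D (\<Psi> y))) (at y)"
    by (rule increasing_diffeo_inverse[OF der pos onto]) auto
  define \<alpha> where "\<alpha> y = \<Phi> (a (\<Psi> y))" for y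
  have \<alpha>_shift: "\<alpha> (y + \<tau> h) = \<alpha> y + \<tau> (A h)" if h: "h \<in> H" for h y
  proof -
    have "\<Psi> (y + \<tau> h) = T h (\<Psi> y)"
      using \<tau>[OF h \<Psi>(1)[of y]] \<Psi>(2)[of y] \<Psi>(3)[OF open01[OF T_smooth[OF h] \<Psi>(1)[of y]]] by simp
    moreover have "a (T h (\<Psi> y)) = T (A h) (a (\<Psi> y))" using a_conj[OF h, of "\<Psi> y"] \<Psi>(1)[of y] by auto
    ultimately show ?thesis using \<tau>[OF A_closed[OF h] open01[OF a_smooth \<Psi>(1)[of y]]] by (simp add: \<alpha>_def)
  qed
  \<comment> \<open>This slope is the one for which \<beta> has period \<open>t\<close>.\<close>
  define \<mu> where "\<mu> = \<tau> (A f) / t"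
  define \<beta> where "\<beta> y = \<alpha> y - \<mu> * y" for y
  have cont\<alpha>: "isCont \<alpha> y" for y
  proof -
    have 1: "isCont \<Psi> y" using \<Psi>(4) by (rule DERIV_isCont)
    have 2: "isCont a (\<Psi> y)" using smooth01_deriv_at[OF a_smooth \<Psi>(1)] by (rule DERIV_isCont)
    have 3: "isCont \<Phi> (a (\<Psi> y))" using der[OF open01[OF a_smooth \<Psi>(1)]] by (rule DERIV_isCont)
    show ?thesis unfolding \<alpha>_def using isCont_o2[OF isCont_o2[OF 1 2] 3] by simp
  qed
  have cont\<beta>: "continuous_on UNIV \<beta>"
    unfolding \<beta>_def using cont\<alpha> by (intro continuous_intros continuous_at_imp_continuous_on) auto
  have \<beta>t: "\<beta> (y + t) = \<beta> y" for y
    using \<alpha>_shift[OF f, of y] t by (simp add: \<beta>_def \<mu>_def t_def field_simps)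
  obtain C where C: "\<And>y. \<bar>\<beta> y\<bar> \<le> C" using periodic_continuous_bounded[OF cont\<beta> _ \<beta>t] t by auto
  have \<tau>A: "\<tau> (A h) = \<mu> * \<tau> h" if h: "h \<in> H" for h
  proof -
    \<comment> \<open>Along the multiples of \<open>\<tau> h\<close> the function \<beta> is linear
      in \<open>n\<close>; as it is bounded, its slope is 0.\<close>
    have *: "\<beta> (real n * \<tau> h) = \<beta> 0 + real n * (\<tau> (A h) - \<mu> * \<tau> h)" for n
    proof (induction n)
      case (Suc n)
      then show ?case using \<alpha>_shift[OF h, of "real n * \<tau> h"] by (simp add: \<beta>_def algebra_simps)
    qed simp
    have "\<bar>real n * (\<tau> (A h) - \<mu> * \<tau> h)\<bar> \<le> 2 * C" for n
      using *[of n] C[of 0] C[of "real n * \<tau> h"] by linarith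
    then have "\<tau> (A h) - \<mu> * \<tau> h = 0" by (rule eq_0_if_multiples_bounded)
    then show ?thesis by simp
  qed
  \<comment> \<open>\<open>a\<close> preserves order, so \<open>T (A f)\<close>, the conjugate of
    \<open>T f\<close>, also moves points downwards.\<close>
  have \<mu>pos: "0 < \<mu>"
  proof -
    have "T f ?m < ?m" using below[of ?m] by simp
    then have "a (T f ?m) < a ?m"
      using smooth01_less[OF a_smooth, of "T f ?m" ?m] open01[OF T_smooth[OF f], of ?m] by simp
    then have lt: "T (A f) (a ?m) < a ?m" using a_conj[OF f, of ?m] by simp
    have am: "a ?m \<in> {0<..<1}" using open01[OF a_smooth, of ?m] by simp
    then have am': "T (A f) (a ?m) \<in> {0<..<1}" by (rule open01[OF T_smooth[OF A_closed[OF f]]])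
    have "\<Phi> (T (A f) (a ?m)) < \<Phi> (a ?m)"
    proof (rule DERIV_pos_imp_increasing[OF lt])
      fix s assume "T (A f) (a ?m) \<le> s" "s \<le> a ?m"
      then have "s \<in> {0<..<1}" using am am' by (auto intro: less_le_trans le_less_trans)
      then show "\<exists>d. (\<Phi> has_real_derivative d) (at s) \<and> 0 < d" using der pos by blast
    qed
    then have "\<tau> (A f) < 0" using \<tau>[OF A_closed[OF f] am] by simp
    then show ?thesis using t by (simp add: \<mu>_def zero_less_divide_iff)
  qed
  have \<tau>An: "\<tau> ((A ^^ n) h) = \<mu> ^ n * \<tau> h" if "h \<in> H" for h n
    by (induction n) (use \<tau>A[OF funpow_A_closed[OF that]] in auto)
  have \<tau>Bn: "\<tau> ((B ^^ n) h) = inverse \<mu> ^ n * \<tau> h \<and> (B ^^ n) h \<in> H" if "h \<in> H" for h n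
  proof (induction n)
    case (Suc n)
    let ?k = "(B ^^ n) h"
    have "\<tau> ?k = \<mu> * \<tau> (B ?k)" using \<tau>A[OF B_closed[of ?k]] AB[of ?k] Suc by simp
    then have "\<tau> (B ?k) = inverse \<mu> * \<tau> ?k" using \<mu>pos by simp
    then show ?case using Suc B_closed[of ?k] by simp
  qed (use that in simp)
  \<comment> \<open>With slope 1, \<tau> would be constant along the orbits of \<open>A\<close>,
    hence 0 by hyperbolicity, while \<open>\<tau> f = t < 0\<close>.\<close>
  have \<mu>1: "\<mu> \<noteq> 1"
  proof
    assume l: "\<mu> = 1"
    have "\<tau> f = 0"
    proof (rule hyperbolic[where \<sigma> = \<tau>])
      show "\<exists>C. \<forall>n. \<bar>\<tau> ((A ^^ n) h)\<bar> \<le> C" if "h \<in> H" for h using \<tau>An[OF that] l by (intro exI[of _ "\<bar>\<tau> h\<bar>"]) simp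
      show "\<exists>C. \<forall>n. \<bar>\<tau> ((B ^^ n) h)\<bar> \<le> C" if "h \<in> H" for h using \<tau>Bn[OF that] l by (intro exI[of _ "\<bar>\<tau> h\<bar>"]) simp
    qed (fact c(11) f)+
    then show False using t by (simp add: t_def)
  qed
  have per: "\<beta> (y + \<tau> h) = \<beta> y" if "h \<in> H" for h y
    using \<alpha>_shift[OF that, of y] \<tau>A[OF that] by (simp add: \<beta>_def algebra_simps)
  \<comment> \<open>The iterates of \<open>A\<close> or of \<open>B\<close>, according to the size
    of \<mu>, turn \<open>t\<close> into periods tending to 0.\<close>
  have \<beta>const: "\<beta> y = \<beta> 0" for y
  proof (cases "\<mu> < 1")
    case True
    show ?thesis
    proof (rule small_periods_imp_constant[OF cont\<beta>, where s = "\<lambda>n. \<mu> ^ n * t"])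
      show "(\<lambda>n. \<mu> ^ n * t) \<longlonglongrightarrow> 0"
        using \<mu>pos True by (intro tendsto_mult_left_zero LIMSEQ_power_zero) simp
      show "\<beta> (y + \<mu> ^ n * t) = \<beta> y" for n y
        using per[OF funpow_A_closed[OF f], of y n] \<tau>An[OF f, of n] by (simp add: t_def)
    qed (use t \<mu>pos in simp)
  next
    case False
    show ?thesis
    proof (rule small_periods_imp_constant[OF cont\<beta>, where s = "\<lambda>n. inverse \<mu> ^ n * t"])
      show "(\<lambda>n. inverse \<mu> ^ n * t) \<longlonglongrightarrow> 0"
        using \<mu>pos \<mu>1 False by (intro tendsto_mult_left_zero LIMSEQ_power_zero) (simp add: inverse_less_1_iff)
      show "\<beta> (y + inverse \<mu> ^ n * t) = \<beta> y" for n y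
        using per[of "(B ^^ n) f" y] \<tau>Bn[OF f, of n] by (simp add: t_def)
    qed (use t \<mu>pos in simp)
  qed
  have "\<Phi> (a x) = \<mu> * \<Phi> x + \<beta> 0" if "x \<in> {0<..<1}" for x
    using \<beta>const[of "\<Phi> x"] \<Psi>(3)[OF that] by (simp add: \<beta>_def \<alpha>_def)
  then show ?thesis using that[OF der pos contD onto \<tau> _ \<mu>pos \<mu>1] by blast
qed

subsection \<open>Functions with locally Hoelder continuous highest derivative\<close>

text \<open>A recursive counterpart of \<open>Cr_on\<close> for inductions on the order of
  differentiation. Derivatives are two-sided, so \<open>S\<close> is meant to be open. The exponent
  0 gives plain C^j, which treats integer and fractional \<open>r\<close> together; constants are
  required nonnegative so that bounds can be multiplied.\<close>

primrec Cholder :: "nat \<Rightarrow> real \<Rightarrow> real set \<Rightarrow> (real \<Rightarrow> real) \<Rightarrow> bool" where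
  "Cholder 0 \<alpha> S f \<longleftrightarrow> continuous_on S f \<and>
     (\<forall>K. compact K \<and> K \<subseteq> S \<longrightarrow> (\<exists>C\<ge>0. \<forall>x\<in>K. \<forall>y\<in>K. \<bar>f x - f y\<bar> \<le> C * \<bar>x - y\<bar> powr \<alpha>))"
| "Cholder (Suc j) \<alpha> S f \<longleftrightarrow>
     (\<exists>f'. (\<forall>x\<in>S. (f has_real_derivative f' x) (at x)) \<and> Cholder j \<alpha> S f')"

lemma Cholder_SucI:
  assumes "\<And>x. x \<in> S \<Longrightarrow> (f has_real_derivative f' x) (at x)" "Cholder j \<alpha> S f'"
  shows "Cholder (Suc j) \<alpha> S f"
  using assms by auto

lemma Cholder_SucE:
  assumes "Cholder (Suc j) \<alpha> S f"
  obtains f' where "\<And>x. x \<in> S \<Longrightarrow> (f has_real_derivative f' x) (at x)" "Cholder j \<alpha> S f'"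
  using assms by auto

lemma Cholder_cong:
  assumes "open S" "\<And>x. x \<in> S \<Longrightarrow> f x = g x" "Cholder j \<alpha> S f"
  shows "Cholder j \<alpha> S g"
proof (cases j)
  case 0
  have "continuous_on S g"
    using assms(3) 0 continuous_on_cong[of S S f g] assms(2) by auto
  moreover have "\<exists>C\<ge>0. \<forall>x\<in>K. \<forall>y\<in>K. \<bar>g x - g y\<bar> \<le> C * \<bar>x - y\<bar> powr \<alpha>" if K: "compact K" "K \<subseteq> S" for K
  proof -
    obtain C where "C \<ge> 0" and C: "\<forall>x\<in>K. \<forall>y\<in>K. \<bar>f x - f y\<bar> \<le> C * \<bar>x - y\<bar> powr \<alpha>"
      using assms(3) 0 K by auto
    then have "\<forall>x\<in>K. \<forall>y\<in>K. \<bar>g x - g y\<bar> \<le> C * \<bar>x - y\<bar> powr \<alpha>"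
      using assms(2) K(2) by (metis subsetD)
    then show ?thesis using \<open>C \<ge> 0\<close> by blast
  qed
  ultimately show ?thesis using 0 by simp
next
  case (Suc i)
  then obtain f' where f': "\<And>x. x \<in> S \<Longrightarrow> (f has_real_derivative f' x) (at x)" "Cholder i \<alpha> S f'"
    using assms(3) by auto
  have "(g has_real_derivative f' x) (at x)" if "x \<in> S" for x
    by (rule has_field_derivative_transform_within_open[OF f'(1)[OF that] assms(1) that assms(2)])
  then show ?thesis using f'(2) Suc by auto
qed

lemma Cholder_imp_continuous:
  assumes "Cholder j \<alpha> S f"
  shows "continuous_on S f"
proof (cases j)
  case (Suc i)
  then obtain f' where "\<And>x. x \<in> S \<Longrightarrow> (f has_real_derivative f' x) (at x)" using assms by auto
  then show ?thesis by (intro continuous_at_imp_continuous_on ballI) (blast intro: DERIV_isCont)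
qed (use assms in simp)

lemma C1_locally_lipschitz:
  fixes f :: "real \<Rightarrow> real"
  assumes S: "convex S" and der: "\<And>x. x \<in> S \<Longrightarrow> (f has_real_derivative f' x) (at x)"
    and cont: "continuous_on S f'" and K: "compact K" "K \<subseteq> S"
  obtains C where "0 \<le> C" "\<And>x y. x \<in> K \<Longrightarrow> y \<in> K \<Longrightarrow> \<bar>f x - f y\<bar> \<le> C * \<bar>x - y\<bar>"
proof (cases "K = {}")
  case True
  then show ?thesis using that[of 0] by simp
next
  case False
  \<comment> \<open>\<open>K\<close> need not be an interval, whereas the mean value estimate needs
    a convex set; the hull of a compact set is still compact.\<close>
  have hull: "convex hull K \<subseteq> S" using S K(2) by (simp add: hull_minimal)
  have "compact (f' ` (convex hull K))"
    by (rule compact_continuous_image[OF continuous_on_subset[OF cont hull] compact_convex_hull[OF K(1)]])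
  then have "bounded (f' ` (convex hull K))" by (rule compact_imp_bounded)
  then obtain C where C: "\<forall>z\<in>f' ` (convex hull K). norm z \<le> C" unfolding bounded_iff by blast
  have "\<bar>f x - f y\<bar> \<le> C * \<bar>x - y\<bar>" if "x \<in> K" "y \<in> K" for x y
  proof -
    have "norm (f x - f y) \<le> C * norm (x - y)"
    proof (rule field_differentiable_bound[of "convex hull K" f f'])
      show "(f has_field_derivative f' z) (at z within convex hull K)" if "z \<in> convex hull K" for z
        using der[of z] hull that by (blast intro: has_field_derivative_at_within)
    qed (use C that hull_inc[of _ K] in auto)
    then show ?thesis by simp
  qed
  moreover have "0 \<le> C"
  proof -
    obtain x where "x \<in> K" using False by blast
    then have "norm (f' x) \<le> C" using C hull_inc[of x K] by blast
    then show ?thesis using norm_ge_zero order_trans by blast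
  qed
  ultimately show ?thesis using that by blast
qed

lemma le_powr_on_bounded:
  fixes d :: real
  assumes "0 \<le> d" "d \<le> M" "0 \<le> \<alpha>" "\<alpha> \<le> 1"
  shows "d \<le> (1 + M) * d powr \<alpha>"
proof (cases "d \<le> 1")
  case True
  have "d = d powr 1" using assms(1) by (cases "d = 0") auto
  also have "\<dots> \<le> d powr \<alpha>" by (rule powr_mono'[OF assms(4,1) True])
  also have "\<dots> \<le> (1 + M) * d powr \<alpha>" using assms by (simp add: mult_le_cancel_right1)
  finally show ?thesis .
next
  case False
  then have "1 \<le> d powr \<alpha>" using assms(3) by (simp add: ge_one_powr_ge_zero)
  then have "(1 + M) * 1 \<le> (1 + M) * d powr \<alpha>" using assms by (intro mult_left_mono) auto
  then show ?thesis using assms(2) by simp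
qed

lemma C1_imp_Cholder_0:
  assumes S: "convex S" and der: "\<And>x. x \<in> S \<Longrightarrow> (f has_real_derivative f' x) (at x)"
    and cont: "continuous_on S f'" and \<alpha>: "0 \<le> \<alpha>" "\<alpha> \<le> 1"
  shows "Cholder 0 \<alpha> S f"
proof -
  have "continuous_on S f"
    using der by (intro continuous_at_imp_continuous_on ballI) (blast intro: DERIV_isCont)
  moreover have "\<exists>C\<ge>0. \<forall>x\<in>K. \<forall>y\<in>K. \<bar>f x - f y\<bar> \<le> C * \<bar>x - y\<bar> powr \<alpha>" if K: "compact K" "K \<subseteq> S" for K
  proof -
    obtain C where C: "0 \<le> C" "\<And>x y. x \<in> K \<Longrightarrow> y \<in> K \<Longrightarrow> \<bar>f x - f y\<bar> \<le> C * \<bar>x - y\<bar>"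
      using C1_locally_lipschitz[OF S der cont K] by blast
    define M where "M = diameter K"
    have M: "\<bar>x - y\<bar> \<le> M" if "x \<in> K" "y \<in> K" for x y
      using diameter_bounded_bound[OF compact_imp_bounded[OF K(1)] that] by (simp add: M_def dist_real_def)
    have M0: "0 \<le> M" unfolding M_def by (rule diameter_ge_0[OF compact_imp_bounded[OF K(1)]])
    have "\<bar>f x - f y\<bar> \<le> (C * (1 + M)) * \<bar>x - y\<bar> powr \<alpha>" if "x \<in> K" "y \<in> K" for x y
    proof -
      have "C * \<bar>x - y\<bar> \<le> C * ((1 + M) * \<bar>x - y\<bar> powr \<alpha>)"
        using le_powr_on_bounded[OF _ M[OF that] \<alpha>] C(1) by (intro mult_left_mono) auto
      then show ?thesis using C(2)[OF that] by (simp add: mult.assoc)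
    qed
    then show ?thesis using C(1) M0 by (intro exI[of _ "C * (1 + M)"]) auto
  qed
  ultimately show ?thesis by simp
qed

text \<open>The exponents are unrelated: one further continuous derivative, of whatever quality,
  gives local Lipschitz continuity and hence any exponent up to 1. The bootstrap passes in this way
  from C^(m+1) to exponent \<alpha> at order \<open>m\<close>.\<close>

lemma Cholder_Suc_imp:
  assumes "convex S" "0 \<le> \<alpha>" "\<alpha> \<le> 1" "Cholder (Suc j) \<beta> S f"
  shows "Cholder j \<alpha> S f"
  using assms(4)
proof (induction j arbitrary: f)
  case 0
  then obtain f' where f': "\<And>x. x \<in> S \<Longrightarrow> (f has_real_derivative f' x) (at x)" "Cholder 0 \<beta> S f'"
    by (rule Cholder_SucE) blast
  show ?case by (rule C1_imp_Cholder_0[OF assms(1) f'(1) _ assms(2,3)]) (use f'(2) in auto)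
next
  case (Suc j)
  from Suc.prems obtain f' where f': "\<And>x. x \<in> S \<Longrightarrow> (f has_real_derivative f' x) (at x)" "Cholder (Suc j) \<beta> S f'"
    by (rule Cholder_SucE) blast
  then show ?case using Suc.IH Cholder_SucI by blast
qed

text \<open>Exponent 0 asks for bounded oscillation on compact sets, which continuity provides. The
  convention that \<open>0 powr 0\<close> is 0 does no harm, since for \<open>x = y\<close> the
  left-hand side vanishes.\<close>

lemma Cholder_0_zero_iff:
  "Cholder 0 0 S f \<longleftrightarrow> continuous_on S f"
proof
  assume cont: "continuous_on S f"
  have "\<exists>C\<ge>0. \<forall>x\<in>K. \<forall>y\<in>K. \<bar>f x - f y\<bar> \<le> C * \<bar>x - y\<bar> powr 0" if K: "compact K" "K \<subseteq> S" for K
  proof -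
    have "bounded (f ` K)"
      using compact_imp_bounded[OF compact_continuous_image[OF continuous_on_subset[OF cont K(2)] K(1)]] .
    then obtain C where C: "0 < C" "\<forall>z\<in>f ` K. norm z \<le> C" unfolding bounded_pos by blast
    have "\<bar>f x - f y\<bar> \<le> (2 * C) * \<bar>x - y\<bar> powr 0" if "x \<in> K" "y \<in> K" for x y
    proof (cases "x = y")
      case False
      have "\<bar>f x\<bar> \<le> C" "\<bar>f y\<bar> \<le> C" using C(2) that by auto
      then show ?thesis using False by simp
    qed simp
    then show ?thesis using C(1) by (intro exI[of _ "2 * C"]) auto
  qed
  then show "Cholder 0 0 S f" using cont by simp
qed simp

lemma Cholder_weaken:
  "Cholder j \<alpha> S f \<Longrightarrow> Cholder j 0 S f"
proof (induction j arbitrary: f)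
  case 0
  then show ?case unfolding Cholder_0_zero_iff by simp
next
  case (Suc j)
  from Suc.prems obtain f' where "\<And>x. x \<in> S \<Longrightarrow> (f has_real_derivative f' x) (at x)" "Cholder j \<alpha> S f'" by auto
  then show ?case using Suc.IH Cholder_SucI by blast
qed

lemma Cholder_const: "Cholder j \<alpha> S (\<lambda>x. c)"
proof (induction j arbitrary: c)
  case (Suc j)
  show ?case by (rule Cholder_SucI[where f' = "\<lambda>x. 0"]) (use Suc in auto)
qed auto

lemma Cholder_add:
  "Cholder j \<alpha> S f \<Longrightarrow> Cholder j \<alpha> S g \<Longrightarrow> Cholder j \<alpha> S (\<lambda>x. f x + g x)"
proof (induction j arbitrary: f g)
  case 0
  have "\<exists>C\<ge>0. \<forall>x\<in>K. \<forall>y\<in>K. \<bar>(f x + g x) - (f y + g y)\<bar> \<le> C * \<bar>x - y\<bar> powr \<alpha>" if K: "compact K" "K \<subseteq> S" for K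
  proof -
    obtain C D where C: "0 \<le> C" "\<And>x y. x \<in> K \<Longrightarrow> y \<in> K \<Longrightarrow> \<bar>f x - f y\<bar> \<le> C * \<bar>x - y\<bar> powr \<alpha>"
      and D: "0 \<le> D" "\<And>x y. x \<in> K \<Longrightarrow> y \<in> K \<Longrightarrow> \<bar>g x - g y\<bar> \<le> D * \<bar>x - y\<bar> powr \<alpha>"
      using 0 K by (metis Cholder.simps(1))
    have "\<bar>(f x + g x) - (f y + g y)\<bar> \<le> (C + D) * \<bar>x - y\<bar> powr \<alpha>" if "x \<in> K" "y \<in> K" for x y
      using C(2)[OF that] D(2)[OF that] by (simp add: distrib_right)
    then show ?thesis using C D by (intro exI[of _ "C + D"]) auto
  qed
  then show ?case using 0 by (auto intro: continuous_on_add)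
next
  case (Suc j)
  obtain f' g' where *: "\<And>x. x \<in> S \<Longrightarrow> (f has_real_derivative f' x) (at x)" "Cholder j \<alpha> S f'"
    "\<And>x. x \<in> S \<Longrightarrow> (g has_real_derivative g' x) (at x)" "Cholder j \<alpha> S g'"
    using Cholder_SucE[OF Suc.prems(1)] Cholder_SucE[OF Suc.prems(2)] by metis
  show ?case
    by (rule Cholder_SucI[OF _ Suc.IH[OF *(2,4)]]) (use * in \<open>auto intro: DERIV_add\<close>)
qed

lemma Cholder_mult:
  assumes S: "convex S" and \<alpha>: "0 \<le> \<alpha>" "\<alpha> \<le> 1"
  shows "Cholder j \<alpha> S f \<Longrightarrow> Cholder j \<alpha> S g \<Longrightarrow> Cholder j \<alpha> S (\<lambda>x. f x * g x)"
proof (induction j arbitrary: f g)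
  case 0
  have "\<exists>C\<ge>0. \<forall>x\<in>K. \<forall>y\<in>K. \<bar>f x * g x - f y * g y\<bar> \<le> C * \<bar>x - y\<bar> powr \<alpha>" if K: "compact K" "K \<subseteq> S" for K
  proof -
    obtain C D where C: "0 \<le> C" "\<And>x y. x \<in> K \<Longrightarrow> y \<in> K \<Longrightarrow> \<bar>f x - f y\<bar> \<le> C * \<bar>x - y\<bar> powr \<alpha>"
      and D: "0 \<le> D" "\<And>x y. x \<in> K \<Longrightarrow> y \<in> K \<Longrightarrow> \<bar>g x - g y\<bar> \<le> D * \<bar>x - y\<bar> powr \<alpha>"
      using 0 K by (metis Cholder.simps(1))
    have "bounded (f ` K)" "bounded (g ` K)"
      using 0 K by (auto intro!: compact_imp_bounded compact_continuous_image intro: continuous_on_subset)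
    then obtain M N where M: "0 < M" "\<forall>z\<in>f ` K. norm z \<le> M" and N: "0 < N" "\<forall>z\<in>g ` K. norm z \<le> N"
      unfolding bounded_pos by blast
    have "\<bar>f x * g x - f y * g y\<bar> \<le> (M * D + C * N) * \<bar>x - y\<bar> powr \<alpha>" if xy: "x \<in> K" "y \<in> K" for x y
    proof -
      have "f x * g x - f y * g y = f x * (g x - g y) + (f x - f y) * g y" by (simp add: algebra_simps)
      then have "\<bar>f x * g x - f y * g y\<bar> \<le> \<bar>f x\<bar> * \<bar>g x - g y\<bar> + \<bar>f x - f y\<bar> * \<bar>g y\<bar>"
        by (metis abs_mult abs_triangle_ineq)
      also have "\<bar>f x\<bar> * \<bar>g x - g y\<bar> \<le> M * (D * \<bar>x - y\<bar> powr \<alpha>)"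
        using M N D(2)[OF xy] xy by (intro mult_mono) auto
      also have "\<bar>f x - f y\<bar> * \<bar>g y\<bar> \<le> (C * \<bar>x - y\<bar> powr \<alpha>) * N"
        using M N C xy by (intro mult_mono) auto
      finally show ?thesis by (simp add: algebra_simps)
    qed
    then show ?thesis using C D M N by (intro exI[of _ "M * D + C * N"]) auto
  qed
  then show ?case using 0 by (auto intro: continuous_on_mult)
next
  case (Suc j)
  obtain f' g' where *: "\<And>x. x \<in> S \<Longrightarrow> (f has_real_derivative f' x) (at x)" "Cholder j \<alpha> S f'"
    "\<And>x. x \<in> S \<Longrightarrow> (g has_real_derivative g' x) (at x)" "Cholder j \<alpha> S g'"
    using Cholder_SucE[OF Suc.prems(1)] Cholder_SucE[OF Suc.prems(2)] by metis
  have fg: "Cholder j \<alpha> S f" "Cholder j \<alpha> S g"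
    using Cholder_Suc_imp[OF S \<alpha>] Suc.prems by blast+
  show ?case
  proof (rule Cholder_SucI)
    show "((\<lambda>x. f x * g x) has_real_derivative (f' x * g x + g' x * f x)) (at x)" if "x \<in> S" for x
      by (rule DERIV_mult[OF *(1)[OF that] *(3)[OF that]])
    show "Cholder j \<alpha> S (\<lambda>x. f' x * g x + g' x * f x)"
      by (intro Cholder_add Suc.IH * fg)
  qed
qed

text \<open>\<open>g\<close> is assumed C^1, hence locally Lipschitz, because the composition of two
  \<alpha>-Hoelder functions is in general only Hoelder with exponent \<alpha> squared.\<close>

lemma Cholder_compose:
  assumes S: "convex S" and \<alpha>: "0 \<le> \<alpha>" "\<alpha> \<le> 1"
    and T: "convex T" "\<And>x. x \<in> S \<Longrightarrow> g x \<in> T" and g: "Cholder 1 0 S g"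
  shows "Cholder j \<alpha> T f \<Longrightarrow> Cholder j \<alpha> S g \<Longrightarrow> Cholder j \<alpha> S (\<lambda>x. f (g x))"
proof (induction j arbitrary: f)
  case 0
  have cont: "continuous_on S g" using g by (rule Cholder_imp_continuous)
  obtain g' where g': "\<And>x. x \<in> S \<Longrightarrow> (g has_real_derivative g' x) (at x)" "continuous_on S g'"
    using g by auto
  have "\<exists>C\<ge>0. \<forall>x\<in>K. \<forall>y\<in>K. \<bar>f (g x) - f (g y)\<bar> \<le> C * \<bar>x - y\<bar> powr \<alpha>" if K: "compact K" "K \<subseteq> S" for K
  proof -
    have "compact (g ` K)" "g ` K \<subseteq> T"
      using K cont T(2) by (auto intro!: compact_continuous_image intro: continuous_on_subset)
    then obtain C where C: "0 \<le> C" "\<And>x y. x \<in> g ` K \<Longrightarrow> y \<in> g ` K \<Longrightarrow> \<bar>f x - f y\<bar> \<le> C * \<bar>x - y\<bar> powr \<alpha>"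
      using 0(1) by (metis Cholder.simps(1))
    obtain L where L: "0 \<le> L" "\<And>x y. x \<in> K \<Longrightarrow> y \<in> K \<Longrightarrow> \<bar>g x - g y\<bar> \<le> L * \<bar>x - y\<bar>"
      using C1_locally_lipschitz[OF S g' K] by blast
    have "\<bar>f (g x) - f (g y)\<bar> \<le> (C * L powr \<alpha>) * \<bar>x - y\<bar> powr \<alpha>" if xy: "x \<in> K" "y \<in> K" for x y
    proof -
      have "\<bar>f (g x) - f (g y)\<bar> \<le> C * \<bar>g x - g y\<bar> powr \<alpha>" using C(2) xy by auto
      also have "\<dots> \<le> C * (L * \<bar>x - y\<bar>) powr \<alpha>"
        using C(1) L(2)[OF xy] \<alpha> by (intro mult_left_mono powr_mono2) auto
      also have "\<dots> = (C * L powr \<alpha>) * \<bar>x - y\<bar> powr \<alpha>" using L(1) by (simp add: powr_mult mult.assoc)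
      finally show ?thesis .
    qed
    then show ?thesis using C(1) by (intro exI[of _ "C * L powr \<alpha>"]) auto
  qed
  moreover have "continuous_on S (\<lambda>x. f (g x))"
    using continuous_on_compose2[of T f S g] 0(1) cont T(2) by auto
  ultimately show ?case by simp
next
  case (Suc j)
  obtain f' g' where *: "\<And>x. x \<in> T \<Longrightarrow> (f has_real_derivative f' x) (at x)" "Cholder j \<alpha> T f'"
    "\<And>x. x \<in> S \<Longrightarrow> (g has_real_derivative g' x) (at x)" "Cholder j \<alpha> S g'"
    using Cholder_SucE[OF Suc.prems(1)] Cholder_SucE[OF Suc.prems(2)] by metis
  show ?case
  proof (rule Cholder_SucI)
    show "((\<lambda>x. f (g x)) has_real_derivative (f' (g x) * g' x)) (at x)" if "x \<in> S" for x
      by (rule DERIV_chain2[OF *(1)[OF T(2)[OF that]] *(3)[OF that]])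
    show "Cholder j \<alpha> S (\<lambda>x. f' (g x) * g' x)"
      by (rule Cholder_mult[OF S \<alpha> Suc.IH[OF *(2) Cholder_Suc_imp[OF S \<alpha> Suc.prems(2)]] *(4)])
  qed
qed

lemma Cholder_exp:
  assumes "0 \<le> \<alpha>" "\<alpha> \<le> 1"
  shows "Cholder j \<alpha> UNIV exp"
proof (induction j)
  case 0
  show ?case by (rule C1_imp_Cholder_0[where f' = exp]) (use assms in \<open>auto intro: continuous_on_exp continuous_on_id\<close>)
next
  case (Suc j)
  show ?case by (rule Cholder_SucI[OF _ Suc]) auto
qed

lemma Cholder_inverse:
  assumes \<alpha>: "0 \<le> \<alpha>" "\<alpha> \<le> 1"
  shows "Cholder j \<alpha> {0<..} inverse"
proof (induction j)
  case 0
  show ?case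
  proof (rule C1_imp_Cholder_0[where f' = "\<lambda>x. - (inverse x ^ 2)"])
    show "(inverse has_real_derivative - (inverse x ^ 2)) (at x)" if "x \<in> {0<..}" for x
      using DERIV_inverse[of x] that by (simp add: numeral_2_eq_2)
  qed (use \<alpha> in \<open>auto intro!: continuous_intros\<close>)
next
  case (Suc j)
  show ?case
  proof (rule Cholder_SucI)
    show "(inverse has_real_derivative (- 1) * (inverse x * inverse x)) (at x)" if "x \<in> {0<..}" for x
      using DERIV_inverse[of x] that by (simp add: numeral_2_eq_2)
    show "Cholder j \<alpha> {0<..} (\<lambda>x. (- 1) * (inverse x * inverse x))"
      by (intro Cholder_mult Suc Cholder_const \<alpha>) auto
  qed
qed

lemma Cholder_ln:
  assumes \<alpha>: "0 \<le> \<alpha>" "\<alpha> \<le> 1"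
  shows "Cholder j \<alpha> {0<..} ln"
proof -
  have "Cholder (Suc j) \<alpha> {0<..} ln"
    by (rule Cholder_SucI[OF _ Cholder_inverse[OF \<alpha>]]) (auto intro: DERIV_ln)
  then show ?thesis by (rule Cholder_Suc_imp[OF _ \<alpha>, rotated]) simp
qed

lemma Cholder_affine:
  assumes "0 \<le> \<alpha>" "\<alpha> \<le> 1"
  shows "Cholder j \<alpha> UNIV (\<lambda>x. c * x + d)"
proof -
  have "Cholder (Suc j) \<alpha> UNIV (\<lambda>x. c * x + d)"
    by (rule Cholder_SucI[OF _ Cholder_const[of j \<alpha> UNIV c]]) (auto intro!: derivative_eq_intros)
  then show ?thesis using Cholder_Suc_imp[OF _ assms] by blast
qed

lemma Cholder_le:
  assumes "convex S" "0 \<le> \<alpha>" "\<alpha> \<le> 1" "i \<le> j" "Cholder j \<alpha> S f"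
  shows "Cholder i \<alpha> S f"
  using assms(4,5)
proof (induction j)
  case (Suc j)
  then show ?case using Cholder_Suc_imp[OF assms(1-3)] by (cases "i = Suc j") auto
qed simp

section \<open>Regularity of the linearization\<close>

lemma scaled_series_bound:
  fixes s \<mu> R :: real and w :: "real \<Rightarrow> real"
  assumes s: "0 < s" "s < 1" and \<mu>: "0 < \<mu>" "\<mu> < 1" and w: "continuous_on UNIV w"
  obtains M where "summable M" "\<And>k y. y \<in> {-R..R} \<Longrightarrow> norm (s ^ k * w (\<mu> ^ k * y)) \<le> M k"
proof -
  have "bounded (w ` {-R..R})"
    by (rule compact_imp_bounded[OF compact_continuous_image[OF continuous_on_subset[OF w]]]) auto
  then obtain C where C: "0 < C" "\<forall>z\<in>w ` {-R..R}. norm z \<le> C" unfolding bounded_pos by blast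
  have "norm (s ^ k * w (\<mu> ^ k * y)) \<le> C * s ^ k" if y: "y \<in> {-R..R}" for k y
  proof -
    have "\<bar>\<mu> ^ k * y\<bar> \<le> 1 * \<bar>y\<bar>"
      unfolding abs_mult using \<mu> by (intro mult_right_mono) (auto simp: power_le_one)
    then have "\<mu> ^ k * y \<in> {-R..R}" using y by auto
    then have "\<bar>w (\<mu> ^ k * y)\<bar> \<le> C" using C(2) by auto
    then have "s ^ k * \<bar>w (\<mu> ^ k * y)\<bar> \<le> s ^ k * C" using s by (intro mult_left_mono) auto
    then show ?thesis using s by (simp add: abs_mult mult.commute)
  qed
  moreover have "summable (\<lambda>k. C * s ^ k)" using s by (intro summable_mult summable_geometric) simp
  ultimately show ?thesis using that by blast
qed

text \<open>Differentiation multiplies the ratio \<open>s\<close> by \<mu>, so the series of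
  derivatives is geometric even for \<open>s = 1\<close>. The original series then has to converge
  at a single point, for which 0 is taken.\<close>

lemma DERIV_scaled_series:
  fixes s \<mu> :: real and w w' :: "real \<Rightarrow> real"
  assumes s: "0 < s" "s \<le> 1" and \<mu>: "0 < \<mu>" "\<mu> < 1"
    and der: "\<And>y. (w has_real_derivative w' y) (at y)" and cont: "continuous_on UNIV w'"
    and sum: "summable (\<lambda>k. s ^ k * w 0)"
  shows "((\<lambda>y. \<Sum>k. s ^ k * w (\<mu> ^ k * y)) has_real_derivative (\<Sum>k. (s * \<mu>) ^ k * w' (\<mu> ^ k * y))) (at y)"
proof -
  define R where "R = \<bar>y\<bar> + 1"
  have "s * \<mu> \<le> 1 * \<mu>" using s \<mu> by (intro mult_right_mono) auto
  then have "s * \<mu> < 1" using \<mu> by linarith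
  then obtain M where M: "summable M" "\<And>k y. y \<in> {-R..R} \<Longrightarrow> norm ((s * \<mu>) ^ k * w' (\<mu> ^ k * y)) \<le> M k"
    using scaled_series_bound[of "s * \<mu>" \<mu> w' R] s \<mu> cont by auto
  show ?thesis
  proof (rule has_field_derivative_series'(2)[where S = "{-R..R}" and ?x0.0 = 0])
    show "((\<lambda>y. s ^ k * w (\<mu> ^ k * y)) has_real_derivative (s * \<mu>) ^ k * w' (\<mu> ^ k * x)) (at x within {-R..R})" for k x
    proof -
      have "((\<lambda>y. \<mu> ^ k * y) has_real_derivative \<mu> ^ k) (at x)" by (auto intro!: derivative_eq_intros)
      moreover have eq: "s ^ k * (w' (\<mu> ^ k * x) * \<mu> ^ k) = (s * \<mu>) ^ k * w' (\<mu> ^ k * x)"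
        by (simp add: power_mult_distrib mult_ac)
      ultimately show ?thesis
        unfolding eq[symmetric] by (intro has_field_derivative_at_within[OF DERIV_cmult[OF DERIV_chain2[OF der]]])
    qed
    show "uniformly_convergent_on {-R..R} (\<lambda>n x. \<Sum>i<n. (s * \<mu>) ^ i * w' (\<mu> ^ i * x))"
      by (rule Weierstrass_m_test'[OF M(2) M(1)])
    show "y \<in> interior {-R..R}" by (auto simp: R_def)
  qed (use sum in \<open>auto simp: R_def\<close>)
qed

lemma Cholder_scaled_series:
  fixes \<mu> :: real
  assumes \<mu>: "0 < \<mu>" "\<mu> < 1" and \<alpha>: "0 \<le> \<alpha>" "\<alpha> \<le> 1"
  shows "Cholder j \<alpha> UNIV w \<Longrightarrow> 0 < s \<Longrightarrow> s < 1 \<Longrightarrow> Cholder j \<alpha> UNIV (\<lambda>y. \<Sum>k. s ^ k * w (\<mu> ^ k * y))"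
proof (induction j arbitrary: w s)
  case 0
  let ?W = "\<lambda>y. \<Sum>k. s ^ k * w (\<mu> ^ k * y)"
  have w: "continuous_on UNIV w" using 0 by simp
  have summ: "summable (\<lambda>k. s ^ k * w (\<mu> ^ k * y))" for y
  proof -
    obtain M where M: "summable M" "\<And>k z. z \<in> {-\<bar>y\<bar>..\<bar>y\<bar>} \<Longrightarrow> norm (s ^ k * w (\<mu> ^ k * z)) \<le> M k"
      using scaled_series_bound[OF 0(2,3) \<mu> w, of "\<bar>y\<bar>"] by blast
    have "norm (s ^ k * w (\<mu> ^ k * y)) \<le> M k" for k by (rule M(2)) auto
    then show ?thesis by (intro summable_comparison_test'[OF M(1), of 0])
  qed
  have "isCont ?W y" for y
  proof -
    define R where "R = \<bar>y\<bar> + 1"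
    obtain M where M: "summable M" "\<And>k z. z \<in> {-R..R} \<Longrightarrow> norm (s ^ k * w (\<mu> ^ k * z)) \<le> M k"
      using scaled_series_bound[OF 0(2,3) \<mu> w, of R] by blast
    have lim: "uniform_limit {-R..R} (\<lambda>n y. \<Sum>k<n. s ^ k * w (\<mu> ^ k * y)) ?W sequentially"
      by (rule Weierstrass_m_test[OF M(2) M(1)])
    have "continuous_on {-R..R} (\<lambda>y. \<Sum>k<n. s ^ k * w (\<mu> ^ k * y))" for n
      by (intro continuous_intros continuous_on_compose2[OF w]) auto
    then have "continuous_on {-R..R} ?W" by (intro uniform_limit_theorem[OF _ lim]) auto
    then show ?thesis by (rule continuous_on_interior) (auto simp: R_def)
  qed
  moreover have "\<exists>C\<ge>0. \<forall>x\<in>K. \<forall>y\<in>K. \<bar>?W x - ?W y\<bar> \<le> C * \<bar>x - y\<bar> powr \<alpha>" if K: "compact K" for K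
  proof -
    \<comment> \<open>\<open>K\<close> is enclosed in a symmetric interval. Multiplication by
      \<open>\<mu> ^ k\<close> maps this interval into itself, so one Hoelder constant serves all
      terms.\<close>
    obtain R where R: "\<And>x. x \<in> K \<Longrightarrow> \<bar>x\<bar> \<le> R" using compact_imp_bounded[OF K] unfolding bounded_iff by auto
    obtain C where C: "0 \<le> C" "\<And>x y. x \<in> {-R..R} \<Longrightarrow> y \<in> {-R..R} \<Longrightarrow> \<bar>w x - w y\<bar> \<le> C * \<bar>x - y\<bar> powr \<alpha>"
      using 0(1) compact_Icc[of "-R" R] by (metis Cholder.simps(1) subset_UNIV)
    have geo: "summable (\<lambda>k. s ^ k)" using 0 by (intro summable_geometric) simp
    have "\<bar>?W x - ?W y\<bar> \<le> ((\<Sum>k. s ^ k) * C) * \<bar>x - y\<bar> powr \<alpha>" if xy: "x \<in> K" "y \<in> K" for x y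
    proof -
      have bd: "norm (s ^ k * w (\<mu> ^ k * x) - s ^ k * w (\<mu> ^ k * y)) \<le> s ^ k * (C * \<bar>x - y\<bar> powr \<alpha>)" for k
      proof -
        have \<mu>k: "0 \<le> \<mu> ^ k" "\<mu> ^ k \<le> 1" using \<mu> by (auto simp: power_le_one)
        have le: "\<bar>\<mu> ^ k * z\<bar> \<le> 1 * \<bar>z\<bar>" for z
          unfolding abs_mult using \<mu>k by (intro mult_right_mono) auto
        have "\<mu> ^ k * x \<in> {-R..R}" "\<mu> ^ k * y \<in> {-R..R}"
          using le[of x] le[of y] R[OF xy(1)] R[OF xy(2)] by auto
        then have "\<bar>w (\<mu> ^ k * x) - w (\<mu> ^ k * y)\<bar> \<le> C * \<bar>\<mu> ^ k * (x - y)\<bar> powr \<alpha>"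
          using C(2) by (simp add: right_diff_distrib)
        also have "\<dots> \<le> C * \<bar>x - y\<bar> powr \<alpha>"
          using le[of "x - y"] C(1) \<alpha> by (intro mult_left_mono powr_mono2) auto
        finally have "s ^ k * \<bar>w (\<mu> ^ k * x) - w (\<mu> ^ k * y)\<bar> \<le> s ^ k * (C * \<bar>x - y\<bar> powr \<alpha>)"
          using 0 by (intro mult_left_mono) auto
        moreover have "norm (s ^ k * w (\<mu> ^ k * x) - s ^ k * w (\<mu> ^ k * y)) = s ^ k * \<bar>w (\<mu> ^ k * x) - w (\<mu> ^ k * y)\<bar>"
          using 0 by (simp add: abs_mult flip: right_diff_distrib)
        ultimately show ?thesis by simp
      qed
      have sb: "summable (\<lambda>k. s ^ k * (C * \<bar>x - y\<bar> powr \<alpha>))" using geo by (rule summable_mult2)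
      have "?W x - ?W y = (\<Sum>k. s ^ k * w (\<mu> ^ k * x) - s ^ k * w (\<mu> ^ k * y))"
        by (rule suminf_diff[OF summ summ])
      then have "\<bar>?W x - ?W y\<bar> \<le> (\<Sum>k. s ^ k * (C * \<bar>x - y\<bar> powr \<alpha>))"
        using norm_suminf_le[OF bd sb] by simp
      also have "\<dots> = (\<Sum>k. s ^ k) * (C * \<bar>x - y\<bar> powr \<alpha>)" by (rule suminf_mult2[OF geo, symmetric])
      finally show ?thesis by (simp add: mult.assoc)
    qed
    moreover have "0 \<le> (\<Sum>k. s ^ k) * C" using C(1) geo 0 by (intro mult_nonneg_nonneg suminf_nonneg) auto
    ultimately show ?thesis by blast
  qed
  ultimately show ?case by (auto intro: continuous_at_imp_continuous_on)
next
  case (Suc j)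
  then obtain w' where w': "\<And>y. (w has_real_derivative w' y) (at y)" "Cholder j \<alpha> UNIV w'" by auto
  have s\<mu>: "0 < s * \<mu>" "s * \<mu> < 1" using Suc.prems \<mu> mult_strict_mono[of s 1 \<mu> 1] by auto
  show ?case
  proof (rule Cholder_SucI)
    show "((\<lambda>y. \<Sum>k. s ^ k * w (\<mu> ^ k * y)) has_real_derivative (\<Sum>k. (s * \<mu>) ^ k * w' (\<mu> ^ k * y))) (at y)" for y
      using Suc.prems by (intro DERIV_scaled_series \<mu> w' Cholder_imp_continuous[OF w'(2)] summable_mult2 summable_geometric) auto
    show "Cholder j \<alpha> UNIV (\<lambda>y. \<Sum>k. (s * \<mu>) ^ k * w' (\<mu> ^ k * y))"
      by (rule Suc.IH[OF w'(2) s\<mu>])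
  qed
qed

text \<open>With \<open>q = ln \<psi>\<close> the conjugacy gives \<open>q (\<mu> y) = q y + ln (a' (\<Psi> y)) - ln \<mu>\<close>, so that \<open>q\<close> is
  recovered from \<open>\<Psi>\<close> by a geometric series; each pass gains one derivative for \<open>\<Psi>\<close>.\<close>

lemma linearization_regular:
  fixes \<mu> :: real
  assumes \<mu>: "0 < \<mu>" "\<mu> < 1" and \<alpha>: "0 \<le> \<alpha>" "\<alpha> \<le> 1" and m: "1 \<le> m"
    and mem: "\<And>y. \<Psi> y \<in> {0<..<1}" and der: "\<And>y. (\<Psi> has_real_derivative \<psi> y) (at y)"
    and pos: "\<And>y. 0 < \<psi> y" and cont: "continuous_on UNIV \<psi>"
    and conj: "\<And>y. a (\<Psi> y) = \<Psi> (\<mu> * y)"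
    and a': "\<And>x. x \<in> {0<..<1} \<Longrightarrow> (a has_real_derivative a' x) (at x)" "\<And>x. x \<in> {0<..<1} \<Longrightarrow> 0 < a' x"
      "Cholder m \<alpha> {0<..<1} a'"
  shows "Cholder m \<alpha> UNIV \<psi>"
proof -
  define q where "q y = ln (\<psi> y)" for y
  define v where "v y = ln (a' (\<Psi> y)) - ln \<mu>" for y
  have qv: "v y = q (\<mu> * y) - q y" for y
  proof -
    have lin: "((\<lambda>y. \<mu> * y) has_real_derivative \<mu>) (at y)" by (auto intro!: derivative_eq_intros)
    have "((\<lambda>y. a (\<Psi> y)) has_real_derivative a' (\<Psi> y) * \<psi> y) (at y)"
      by (rule DERIV_chain2[OF a'(1)[OF mem] der])
    moreover have "((\<lambda>y. a (\<Psi> y)) has_real_derivative \<psi> (\<mu> * y) * \<mu>) (at y)"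
      unfolding conj by (rule DERIV_chain2[OF der lin])
    ultimately have "a' (\<Psi> y) * \<psi> y = \<psi> (\<mu> * y) * \<mu>" by (rule DERIV_unique)
    then have "ln (a' (\<Psi> y) * \<psi> y) = ln (\<psi> (\<mu> * y) * \<mu>)" by simp
    then show ?thesis using a'(2)[OF mem] pos \<mu> by (simp add: ln_mult_pos q_def v_def)
  qed
  have contq: "continuous_on UNIV q"
    unfolding q_def using pos by (intro continuous_on_ln cont) (metis less_irrefl)
  have sums: "(\<lambda>k. v (\<mu> ^ k * y)) sums (q 0 - q y)" for y
  proof -
    have "(\<lambda>k. \<mu> ^ k * y) \<longlonglongrightarrow> 0"
      using \<mu> by (intro tendsto_mult_left_zero LIMSEQ_power_zero) simp
    moreover have "isCont q 0" using contq by (simp add: continuous_on_eq_continuous_at)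
    ultimately have "(\<lambda>k. q (\<mu> ^ k * y)) \<longlonglongrightarrow> q 0" by (rule isCont_tendsto_compose[rotated])
    from telescope_sums[OF this] show ?thesis by (simp add: qv mult.assoc)
  qed
  have v0: "v 0 = 0" using qv[of 0] by simp
  have c01: "convex {0<..<1::real}" by simp
  have a'10: "Cholder 1 0 {0<..<1} a'"
    by (rule Cholder_weaken[OF Cholder_le[OF c01 \<alpha> m a'(3)]])
  have \<Psi>10: "Cholder 1 0 UNIV \<Psi>"
    unfolding One_nat_def by (rule Cholder_SucI[OF der]) (simp only: Cholder_0_zero_iff cont)
  \<comment> \<open>One pass of the bootstrap: the class of \<Psi> passes to
    \<open>ln (a' (\<Psi> y))\<close>, through the series to \<open>q\<close>, and so to \<psi>,
    which is the derivative of \<Psi>.\<close>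
  have step: "Cholder j \<beta> UNIV \<psi>"
    if \<beta>: "0 \<le> \<beta>" "\<beta> \<le> 1" and j: "1 \<le> j" and \<Psi>: "Cholder j \<beta> UNIV \<Psi>" and aj: "Cholder j \<beta> {0<..<1} a'" for j \<beta>
  proof -
    obtain i where i: "j = Suc i" using j by (cases j) auto
    have "Cholder j \<beta> {0<..<1} (\<lambda>x. ln (a' x))"
      by (rule Cholder_compose[OF c01 \<beta> _ _ a'10 Cholder_ln[OF \<beta>] aj]) (use a'(2) in auto)
    then have "Cholder j \<beta> UNIV (\<lambda>y. ln (a' (\<Psi> y)))"
      by (rule Cholder_compose[OF convex_UNIV \<beta> c01 mem \<Psi>10 _ \<Psi>])
    then have "Cholder j \<beta> UNIV (\<lambda>y. ln (a' (\<Psi> y)) + (- ln \<mu>))"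
      by (rule Cholder_add[OF _ Cholder_const])
    then have "Cholder (Suc i) \<beta> UNIV v" by (simp only: i v_def[abs_def] diff_conv_add_uminus)
    then obtain v' where v': "\<And>y. (v has_real_derivative v' y) (at y)" "Cholder i \<beta> UNIV v'" by auto
    \<comment> \<open>This is the case of ratio 1. Convergence at 0 comes from
      \<open>v 0 = 0\<close>; one differentiation brings in the factor \<mu>, after which the series
      is geometric.\<close>
    have "Cholder (Suc i) \<beta> UNIV (\<lambda>y. \<Sum>k. 1 ^ k * v (\<mu> ^ k * y))"
    proof (rule Cholder_SucI)
      show "((\<lambda>y. \<Sum>k. 1 ^ k * v (\<mu> ^ k * y)) has_real_derivative (\<Sum>k. (1 * \<mu>) ^ k * v' (\<mu> ^ k * y))) (at y)" for y
        by (rule DERIV_scaled_series[OF _ _ \<mu> v'(1) Cholder_imp_continuous[OF v'(2)]]) (auto simp: v0)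
      show "Cholder i \<beta> UNIV (\<lambda>y. \<Sum>k. (1 * \<mu>) ^ k * v' (\<mu> ^ k * y))"
        by (rule Cholder_scaled_series[OF \<mu> \<beta> v'(2)]) (use \<mu> in auto)
    qed
    moreover have "(\<Sum>k. 1 ^ k * v (\<mu> ^ k * y)) = q 0 - q y" for y using sums_unique[OF sums[of y]] by simp
    ultimately have "Cholder j \<beta> UNIV (\<lambda>y. q 0 - q y)" by (simp only: i)
    then have "Cholder j \<beta> UNIV (\<lambda>y. (- 1) * (q 0 - q y) + q 0)"
      by (intro Cholder_add Cholder_mult Cholder_const \<beta>) auto
    then have q: "Cholder j \<beta> UNIV q" by simp
    have "Cholder 1 \<beta> UNIV q" using Cholder_le[OF convex_UNIV \<beta> j q] .
    then have "Cholder 1 0 UNIV q" by (rule Cholder_weaken)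
    then have "Cholder j \<beta> UNIV (\<lambda>y. exp (q y))"
      by (intro Cholder_compose[OF convex_UNIV \<beta> convex_UNIV _ _ Cholder_exp[OF \<beta>] q]) auto
    then show ?thesis using pos by (simp add: q_def)
  qed
  \<comment> \<open>The passes run with exponent 0 until \<Psi> is C^(m+1). That yields exponent
    \<alpha> at order \<open>m\<close> for \<Psi>, and a last pass transfers it to \<psi>.\<close>
  have "Cholder (Suc j) 0 UNIV \<Psi>" if "j \<le> m" for j
    using that
  proof (induction j)
    case 0
    then show ?case using \<Psi>10 by simp
  next
    case (Suc j)
    have "Cholder (Suc j) 0 {0<..<1} a'"
      by (rule Cholder_weaken[OF Cholder_le[OF c01 \<alpha> Suc.prems a'(3)]])
    then have "Cholder (Suc j) 0 UNIV \<psi>" using Suc by (intro step) auto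
    then show ?case by (rule Cholder_SucI[OF der])
  qed
  then have "Cholder m \<alpha> UNIV \<Psi>" using Cholder_Suc_imp[OF convex_UNIV \<alpha>] by blast
  then show ?thesis using step[OF \<alpha> m _ a'(3)] by blast
qed

lemma affine_coordinate_regular:
  fixes \<mu> :: real
  assumes \<mu>: "0 < \<mu>" "\<mu> < 1" and \<alpha>: "0 \<le> \<alpha>" "\<alpha> \<le> 1" and m: "1 \<le> m"
    and der: "\<And>x. x \<in> {0<..<1} \<Longrightarrow> (\<Phi> has_real_derivative D x) (at x)"
    and pos: "\<And>x. x \<in> {0<..<1} \<Longrightarrow> 0 < D x" and contD: "continuous_on {0<..<1} D"
    and onto: "\<Phi> ` {0<..<1} = (UNIV :: real set)"
    and conj: "\<And>x. x \<in> {0<..<1} \<Longrightarrow> a x \<in> {0<..<1} \<and> \<Phi> (a x) = \<mu> * \<Phi> x + c"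
    and a': "\<And>x. x \<in> {0<..<1} \<Longrightarrow> (a has_real_derivative a' x) (at x)" "\<And>x. x \<in> {0<..<1} \<Longrightarrow> 0 < a' x"
      "Cholder m \<alpha> {0<..<1} a'"
  obtains \<Psi> where "\<And>y. \<Psi> y \<in> {0<..<1::real}" "\<And>y. \<Phi> (\<Psi> y) = y"
    "\<And>x. x \<in> {0<..<1} \<Longrightarrow> \<Psi> (\<Phi> x) = x"
    "Cholder (Suc m) \<alpha> {0<..<1} \<Phi>" "Cholder (Suc m) \<alpha> UNIV \<Psi>"
proof -
  obtain \<Psi> where \<Psi>: "\<And>y. \<Psi> y \<in> {0<..<1::real}" "\<And>y. \<Phi> (\<Psi> y) = y"
    "\<And>x. x \<in> {0<..<1} \<Longrightarrow> \<Psi> (\<Phi> x) = x"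
    "\<And>y. (\<Psi> has_real_derivative inverse (D (\<Psi> y))) (at y)"
    by (rule increasing_diffeo_inverse[OF der pos onto]) auto
  define \<psi> where "\<psi> y = inverse (D (\<Psi> y))" for y
  have pos\<psi>: "0 < \<psi> y" for y using pos[OF \<Psi>(1)] by (simp add: \<psi>_def)
  have cont\<Psi>: "continuous_on UNIV \<Psi>"
    using \<Psi>(4) by (intro continuous_at_imp_continuous_on ballI) (blast intro: DERIV_isCont)
  have cont\<psi>: "continuous_on UNIV \<psi>"
    unfolding \<psi>_def
    by (intro continuous_on_inverse continuous_on_compose2[OF contD cont\<Psi>]) (use \<Psi>(1) pos in \<open>auto dest: less_imp_neq[symmetric]\<close>)
  \<comment> \<open>\<open>p\<close> is the fixed point of the affine map; moving it to the origin
    makes the conjugated map linear.\<close>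
  define p where "p = c / (1 - \<mu>)"
  have p: "\<mu> * p + c = p" using \<mu> by (simp add: p_def field_simps)
  have "Cholder m \<alpha> UNIV (\<lambda>y. \<psi> (y + p))"
  proof (rule linearization_regular[OF \<mu> \<alpha> m, where \<Psi> = "\<lambda>y. \<Psi> (y + p)" and a = a and a' = a'])
    show "((\<lambda>y. \<Psi> (y + p)) has_real_derivative \<psi> (y + p)) (at y)" for y
    proof -
      have "((\<lambda>y. y + p) has_real_derivative 1) (at y)" by (auto intro!: derivative_eq_intros)
      from DERIV_chain2[OF \<Psi>(4) this] show ?thesis by (simp add: \<psi>_def)
    qed
    show "continuous_on UNIV (\<lambda>y. \<psi> (y + p))"
      by (rule continuous_on_compose2[OF cont\<psi>]) (auto intro: continuous_intros)
    show "a (\<Psi> (y + p)) = \<Psi> (\<mu> * y + p)" for y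
    proof -
      have *: "a (\<Psi> (y + p)) \<in> {0<..<1}" "\<Phi> (a (\<Psi> (y + p))) = \<mu> * (y + p) + c"
        using conj[OF \<Psi>(1)[of "y + p"]] \<Psi>(2) by auto
      have "\<mu> * (y + p) + c = \<mu> * y + p" using p by (simp add: distrib_left)
      then show ?thesis using \<Psi>(3)[OF *(1)] *(2) by simp
    qed
  qed (use \<Psi>(1) pos\<psi> a' in auto)
  then have "Cholder m \<alpha> UNIV (\<lambda>y. \<psi> ((1 * y + (- p)) + p))"
    by (rule Cholder_compose[OF convex_UNIV \<alpha> convex_UNIV _ Cholder_affine _ Cholder_affine, rotated 3]) (use \<alpha> in auto)
  then have reg\<psi>: "Cholder m \<alpha> UNIV \<psi>" by simp
  then have reg\<Psi>: "Cholder (Suc m) \<alpha> UNIV \<Psi>" using \<Psi>(4) by (intro Cholder_SucI[of _ _ \<psi>]) (auto simp: \<psi>_def)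
  have D: "D x = inverse (\<psi> (\<Phi> x))" if "x \<in> {0<..<1}" for x using \<Psi>(3)[OF that] by (simp add: \<psi>_def)
  have c01: "convex {0<..<1::real}" by simp
  have \<Phi>10: "Cholder 1 0 {0<..<1} \<Phi>"
    unfolding One_nat_def by (rule Cholder_SucI[OF der]) (simp_all only: Cholder_0_zero_iff contD)
  have \<psi>10: "Cholder 1 0 UNIV \<psi>" by (rule Cholder_weaken[OF Cholder_le[OF convex_UNIV \<alpha> m reg\<psi>]])
  \<comment> \<open>Bootstrap for the inverse function:
    \<open>D = 1 / (\<psi> \<circ> \<Phi>)\<close> inherits the class of \<Phi>, as long as \<psi>
    allows it, and \<Phi> thereby gains one derivative.\<close>
  have "Cholder j \<alpha> {0<..<1} \<Phi>" if "j \<le> Suc m" for j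
    using that
  proof (induction j)
    case 0
    show ?case by (rule C1_imp_Cholder_0[OF c01 der contD \<alpha>])
  next
    case (Suc j)
    then have IH: "Cholder j \<alpha> {0<..<1} \<Phi>" and jm: "j \<le> m" by auto
    have \<psi>j: "Cholder j \<alpha> UNIV \<psi>" by (rule Cholder_le[OF convex_UNIV \<alpha> jm reg\<psi>])
    have "Cholder j \<alpha> UNIV (\<lambda>y. inverse (\<psi> y))"
      by (rule Cholder_compose[OF convex_UNIV \<alpha> _ _ \<psi>10 Cholder_inverse[OF \<alpha>] \<psi>j]) (use pos\<psi> in auto)
    then have "Cholder j \<alpha> {0<..<1} (\<lambda>x. inverse (\<psi> (\<Phi> x)))"
      by (rule Cholder_compose[OF c01 \<alpha> convex_UNIV UNIV_I \<Phi>10 _ IH])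
    then have "Cholder j \<alpha> {0<..<1} D"
      by (rule Cholder_cong[rotated 2]) (use D in auto)
    then show ?case by (rule Cholder_SucI[rotated]) (rule der)
  qed
  then show ?thesis using that \<Psi>(1-3) reg\<Psi> by blast
qed

subsection \<open>Bounded orbits of a hyperbolic matrix\<close>

text \<open>This is \<open>p(S) s\<close> for the shift \<open>S\<close> on two-sided sequences. By
  \<open>shift_poly_mult\<close> sequences form a module over the polynomial ring, so identities
  between polynomial matrices can be applied to them.\<close>

definition shift_poly :: "'a::comm_ring_1 poly \<Rightarrow> (int \<Rightarrow> 'a) \<Rightarrow> int \<Rightarrow> 'a" where
  "shift_poly p s n = (\<Sum>k\<le>degree p. coeff p k * s (n + int k))"

lemma shift_poly_upto:
  assumes "degree p \<le> N"
  shows "shift_poly p s n = (\<Sum>k\<le>N. coeff p k * s (n + int k))"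
  unfolding shift_poly_def
  by (rule sum.mono_neutral_left) (use assms in \<open>auto simp: coeff_eq_0\<close>)

lemma shift_poly_0 [simp]: "shift_poly 0 s n = 0"
  by (simp add: shift_poly_def)

lemma shift_poly_1 [simp]: "shift_poly 1 s n = s n"
  by (simp add: shift_poly_def)

lemma shift_poly_zero_seq [simp]: "shift_poly p (\<lambda>n. 0) n = 0"
  by (simp add: shift_poly_def)

lemma shift_poly_add: "shift_poly (p + q) s n = shift_poly p s n + shift_poly q s n"
proof -
  define N where "N = max (degree p) (degree q)"
  have "degree (p + q) \<le> N" unfolding N_def by (rule degree_add_le_max)
  then have "shift_poly (p + q) s n = (\<Sum>k\<le>N. coeff (p + q) k * s (n + int k))"
    by (rule shift_poly_upto)
  moreover have "shift_poly p s n = (\<Sum>k\<le>N. coeff p k * s (n + int k))"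
    "shift_poly q s n = (\<Sum>k\<le>N. coeff q k * s (n + int k))"
    by (rule shift_poly_upto, simp add: N_def)+
  ultimately show ?thesis by (simp add: distrib_right sum.distrib)
qed

lemma shift_poly_pCons: "shift_poly (pCons a p) s n = a * s n + shift_poly p s (n + 1)"
proof -
  have "shift_poly (pCons a p) s n = (\<Sum>k\<le>Suc (degree p). coeff (pCons a p) k * s (n + int k))"
    by (rule shift_poly_upto[OF degree_pCons_le])
  also have "\<dots> = a * s n + (\<Sum>k\<le>degree p. coeff p k * s (n + int (Suc k)))"
    by (subst sum.atMost_Suc_shift) simp
  finally show ?thesis by (simp add: shift_poly_def algebra_simps)
qed

lemma shift_poly_smult: "shift_poly (Polynomial.smult c p) s n = c * shift_poly p s n"
  using shift_poly_upto[OF degree_smult_le[of c p], of s n]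
  by (simp add: shift_poly_def sum_distrib_left mult.assoc)

lemma shift_poly_mult: "shift_poly (p * q) s n = shift_poly p (shift_poly q s) n"
proof (induction p arbitrary: n)
  case (pCons a p)
  then show ?case
    by (simp add: mult_pCons_left shift_poly_add shift_poly_smult shift_poly_pCons)
qed simp

lemma shift_poly_sum: "finite I \<Longrightarrow> shift_poly (\<Sum>i\<in>I. p i) s n = (\<Sum>i\<in>I. shift_poly (p i) s n)"
  by (induction I rule: finite_induct) (simp_all add: shift_poly_add)

lemma shift_poly_sum_seq: "shift_poly p (\<lambda>n. \<Sum>i\<in>I. s i n) n = (\<Sum>i\<in>I. shift_poly p (s i) n)"
  unfolding shift_poly_def by (simp add: sum_distrib_left) (rule sum.swap)

text \<open>The Cayley-Hamilton theorem along an orbit: compare the entries of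
  \<open>adj (x I - A) (x I - A) = \<chi> I\<close> and let \<open>x\<close> act as the shift.\<close>

lemma shift_poly_char_poly_orbit:
  fixes A :: "'a::comm_ring_1 mat" and w :: "int \<Rightarrow> 'a Matrix.vec"
  assumes A: "A \<in> carrier_mat d d" and w: "\<And>n. w n \<in> carrier_vec d"
    and step: "\<And>n. w (n + 1) = A *\<^sub>v w n" and i: "i < d"
  shows "shift_poly (char_poly A) (\<lambda>n. w n $ i) n = 0"
proof -
  define P where "P = char_poly_matrix A"
  define B where "B = adj_mat P"
  define s where "s j n = w n $ j" for j n
  have P: "P \<in> carrier_mat d d" using A by (simp add: P_def)
  have B: "B \<in> carrier_mat d d" and BP: "B * P = char_poly A \<cdot>\<^sub>m 1\<^sub>m d"
    using adj_mat[OF P] by (auto simp: B_def P_def char_poly_def)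
  \<comment> \<open>With \<open>x\<close> acting as the shift, row \<open>l\<close> of
    \<open>x I - A\<close> annihilates the coordinate sequences; this restates
    \<open>w (n + 1) = A w n\<close>.\<close>
  have row0: "(\<Sum>j<d. shift_poly (P $$ (l, j)) (s j) n) = 0" if l: "l < d" for l n
  proof -
    have entry: "shift_poly (P $$ (l, j)) (s j) n = (if l = j then s j (n + 1) else 0) - A $$ (l, j) * s j n"
      if "j < d" for j
      using A l that by (auto simp: P_def char_poly_matrix_def shift_poly_add shift_poly_pCons)
    have "(\<Sum>j<d. shift_poly (P $$ (l, j)) (s j) n) = (\<Sum>j<d. (if l = j then s j (n + 1) else 0) - A $$ (l, j) * s j n)"
      by (rule sum.cong) (auto simp: entry)
    also have "\<dots> = s l (n + 1) - (\<Sum>j<d. A $$ (l, j) * s j n)"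
      using l by (simp add: sum_subtractf)
    also have "s l (n + 1) = (\<Sum>j<d. A $$ (l, j) * s j n)"
    proof -
      have "s l (n + 1) = (\<Sum>j\<in>{0..<d}. row A l $ j * w n $ j)"
        using A w[of n] l by (simp add: s_def step scalar_prod_def)
      also have "\<dots> = (\<Sum>j<d. A $$ (l, j) * s j n)"
        using A l by (intro sum.cong) (auto simp: s_def)
      finally show ?thesis .
    qed
    finally show ?thesis by simp
  qed
  have "shift_poly (char_poly A) (s i) n = (\<Sum>j<d. shift_poly (if i = j then char_poly A else 0) (s j) n)"
    using i by (simp add: if_distrib[where f = "\<lambda>p. shift_poly p _ _"] cong: if_cong)
  also have "\<dots> = (\<Sum>j<d. shift_poly (\<Sum>l<d. B $$ (i, l) * P $$ (l, j)) (s j) n)"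
  proof (rule sum.cong[OF refl])
    fix j assume j: "j \<in> {..<d}"
    have "(B * P) $$ (i, j) = (\<Sum>l\<in>{0..<d}. row B i $ l * col P j $ l)"
      using B P i j by (simp add: scalar_prod_def)
    also have "\<dots> = (\<Sum>l<d. B $$ (i, l) * P $$ (l, j))"
      using B P i j by (intro sum.cong) auto
    finally have "(B * P) $$ (i, j) = (\<Sum>l<d. B $$ (i, l) * P $$ (l, j))" .
    moreover have "(B * P) $$ (i, j) = (if i = j then char_poly A else 0)"
      using i j by (auto simp: BP)
    ultimately have "(\<Sum>l<d. B $$ (i, l) * P $$ (l, j)) = (if i = j then char_poly A else 0)" by simp
    then show "shift_poly (if i = j then char_poly A else 0) (s j) n = shift_poly (\<Sum>l<d. B $$ (i, l) * P $$ (l, j)) (s j) n"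
      by simp
  qed
  also have "\<dots> = (\<Sum>j<d. \<Sum>l<d. shift_poly (B $$ (i, l)) (shift_poly (P $$ (l, j)) (s j)) n)"
    by (simp add: shift_poly_sum shift_poly_mult)
  also have "\<dots> = (\<Sum>l<d. \<Sum>j<d. shift_poly (B $$ (i, l)) (shift_poly (P $$ (l, j)) (s j)) n)"
    by (rule sum.swap)
  also have "\<dots> = (\<Sum>l<d. shift_poly (B $$ (i, l)) (\<lambda>n. \<Sum>j<d. shift_poly (P $$ (l, j)) (s j) n) n)"
    by (simp add: shift_poly_sum_seq)
  also have "\<dots> = 0"
    by (intro sum.neutral ballI) (simp add: row0)
  finally have "shift_poly (char_poly A) (s i) n = 0" .
  moreover have "s i = (\<lambda>n. w n $ i)" by (simp add: s_def fun_eq_iff)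
  ultimately show ?thesis by simp
qed

text \<open>A nonzero two-sided geometric sequence is unbounded in one direction: in the past if
  \<open>cmod a < 1\<close>, in the future if \<open>cmod a > 1\<close>.\<close>

lemma bounded_geometric_eq_0:
  fixes t :: "int \<Rightarrow> complex"
  assumes step: "\<And>n. t (n + 1) = a * t n" and a: "cmod a \<noteq> 1" and bd: "\<And>n. cmod (t n) \<le> C"
  shows "t n = 0"
proof -
  have pow: "t (n + int m) = a ^ m * t n" for n m
  proof (induction m)
    case (Suc m)
    have "t (n + int (Suc m)) = t ((n + int m) + 1)" by (simp add: ac_simps)
    then show ?case using step[of "n + int m"] Suc by simp
  qed simp
  have lim0: "x = 0" if "0 \<le> x" "0 \<le> r" "r < 1" "\<And>m. x \<le> r ^ m * C" for x r :: real
  proof -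
    have "(\<lambda>m. r ^ m * C) \<longlonglongrightarrow> 0" using that by (intro tendsto_mult_left_zero LIMSEQ_power_zero) simp
    then have "x \<le> 0" using that(4) by (intro LIMSEQ_le_const) auto
    then show ?thesis using that(1) by simp
  qed
  have "cmod (t n) = 0"
  proof (cases "cmod a < 1")
    case True
    show ?thesis
    proof (rule lim0[OF _ _ True])
      fix m
      have "cmod (t n) = cmod a ^ m * cmod (t (n - int m))"
        using pow[of "n - int m" m] by (simp add: norm_mult norm_power)
      also have "\<dots> \<le> cmod a ^ m * C" using bd by (intro mult_left_mono) auto
      finally show "cmod (t n) \<le> cmod a ^ m * C" .
    qed auto
  next
    case False
    then have gt: "1 < cmod a" using a by simp
    show ?thesis
    proof (rule lim0)
      show "inverse (cmod a) < 1" using gt by (simp add: inverse_less_1_iff)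
      fix m
      have "cmod a ^ m * cmod (t n) \<le> C" using pow[of n m] bd[of "n + int m"] by (simp add: norm_mult norm_power)
      moreover have "0 < cmod a ^ m" using gt by (intro zero_less_power) linarith
      ultimately show "cmod (t n) \<le> inverse (cmod a) ^ m * C"
        by (simp add: field_simps power_inverse)
    qed (use gt in auto)
  qed
  then show ?thesis by simp
qed

text \<open>Roots are split off one at a time. Applying the product of the remaining factors to
  \<open>s\<close> gives a bounded sequence that is geometric with ratio \<open>a\<close>; it
  vanishes, and the induction hypothesis applies.\<close>

lemma bounded_shift_poly_eq_0:
  fixes s :: "int \<Rightarrow> complex"
  assumes "\<And>n. cmod (s n) \<le> C" "\<And>a. a \<in> set as \<Longrightarrow> cmod a \<noteq> 1"
    "\<And>n. shift_poly (\<Prod>a\<leftarrow>as. [:- a, 1:]) s n = 0"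
  shows "s n = 0"
  using assms(2,3)
proof (induction as arbitrary: n)
  case Nil
  then show ?case by simp
next
  case (Cons a as)
  define q where "q = (\<Prod>a\<leftarrow>as. [:- a, 1:])"
  define t where "t = shift_poly q s"
  have "t n = 0" for n
  proof (rule bounded_geometric_eq_0)
    show "t (n + 1) = a * t n" for n
    proof -
      have "shift_poly [:- a, 1:] t n = 0"
        using Cons.prems(2)[of n] shift_poly_mult[of "[:- a, 1:]" q s n] by (simp add: q_def t_def)
      then show ?thesis by (simp add: shift_poly_pCons)
    qed
    show "cmod a \<noteq> 1" using Cons.prems(1) by simp
    show "cmod (t n) \<le> (\<Sum>k\<le>degree q. cmod (coeff q k) * C)" for n
      unfolding t_def shift_poly_def
      by (rule order_trans[OF norm_sum]) (auto intro!: sum_mono mult_left_mono assms(1) simp: norm_mult)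
  qed
  then show ?case using Cons.IH Cons.prems(1) by (simp add: q_def t_def)
qed

section \<open>Additive functions along orbits of a rational matrix\<close>

lemma common_denominator:
  fixes X :: "rat set"
  assumes "finite X"
  shows "\<exists>N::int. 0 < N \<and> (\<forall>x\<in>X. \<exists>m::int. of_int N * x = of_int m)"
  using assms
proof (induction X rule: finite_induct)
  case empty
  show ?case by (intro exI[of _ 1]) auto
next
  case (insert x X)
  then obtain N :: int where N: "0 < N" "\<And>y. y \<in> X \<Longrightarrow> \<exists>m::int. of_int N * y = of_int m" by blast
  obtain a b where ab: "quotient_of x = (a, b)" by (cases "quotient_of x")
  have b: "0 < b" and x: "x = of_int a / of_int b"
    using quotient_of_denom_pos[OF ab] quotient_of_div[OF ab] by auto
  have "of_int (N * b) * x = of_int (N * a)" using b by (simp add: x)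
  then have ex: "\<exists>m::int. of_int (N * b) * x = of_int m" by blast
  have old: "\<exists>m::int. of_int (N * b) * y = of_int m" if y: "y \<in> X" for y
  proof -
    obtain m :: int where "of_int N * y = of_int m" using N(2)[OF y] by blast
    then have "of_int (N * b) * y = of_int (m * b)" by simp
    then show ?thesis by blast
  qed
  show ?case
  proof (rule exI[of _ "N * b"], intro conjI ballI)
    show "0 < N * b" using N(1) b by simp
    show "\<exists>m::int. of_int (N * b) * y = of_int m" if "y \<in> insert x X" for y
      using that ex old by blast
  qed
qed

text \<open>\<sigma> is additive on a group that need not be closed under division, so integer
  combinations are what can be passed through it. This is why the characteristic polynomial, with
  its rational coefficients, has to be cleared of denominators.\<close>

locale additive_on_subgroup =
  fixes d :: nat and H :: "rat Matrix.vec set" and \<sigma> :: "rat Matrix.vec \<Rightarrow> real"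
  assumes H: "H \<subseteq> carrier_vec d" "0\<^sub>v d \<in> H"
    and H_add: "u \<in> H \<Longrightarrow> v \<in> H \<Longrightarrow> u + v \<in> H" and H_uminus: "u \<in> H \<Longrightarrow> - u \<in> H"
    and \<sigma>_add: "u \<in> H \<Longrightarrow> v \<in> H \<Longrightarrow> \<sigma> (u + v) = \<sigma> u + \<sigma> v"
begin

lemma \<sigma>_zero: "\<sigma> (0\<^sub>v d) = 0"
  using \<sigma>_add[OF H(2) H(2)] by simp

lemma int_multiple:
  fixes v :: "rat Matrix.vec"
  assumes v: "v \<in> H"
  shows "\<exists>y\<in>H. (\<forall>i<d. y $ i = of_int m * v $ i) \<and> \<sigma> y = of_int m * \<sigma> v"
proof -
  have vd: "v \<in> carrier_vec d" using v H by auto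
  have neg: "\<sigma> (- v) = - \<sigma> v"
    using \<sigma>_add[OF v H_uminus[OF v]] \<sigma>_zero vd by (simp add: uminus_r_inv_vec)
  show ?thesis
  proof (induction m rule: int_induct[where k = 0])
    case base
    then show ?case using H(2) \<sigma>_zero by (intro bexI[of _ "0\<^sub>v d"]) auto
  next
    case (step1 m)
    then obtain y where y: "y \<in> H" "\<forall>i<d. y $ i = of_int m * v $ i" "\<sigma> y = of_int m * \<sigma> v" by blast
    then have "\<forall>i<d. (y + v) $ i = of_int (m + 1) * v $ i" using vd by (auto simp: algebra_simps)
    then show ?case using y v \<sigma>_add H_add by (intro bexI[of _ "y + v"]) (auto simp: algebra_simps)
  next
    case (step2 m)
    then obtain y where y: "y \<in> H" "\<forall>i<d. y $ i = of_int m * v $ i" "\<sigma> y = of_int m * \<sigma> v" by blast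
    then have "\<forall>i<d. (y + (- v)) $ i = of_int (m - 1) * v $ i" using vd by (auto simp: algebra_simps)
    then show ?case using y v \<sigma>_add H_add H_uminus neg by (intro bexI[of _ "y + (- v)"]) (auto simp: algebra_simps)
  qed
qed

lemma int_combination:
  fixes m :: "nat \<Rightarrow> int" and v :: "nat \<Rightarrow> rat Matrix.vec"
  assumes v: "\<And>k. v k \<in> H"
  shows "\<exists>y\<in>H. (\<forall>i<d. y $ i = (\<Sum>k<n. of_int (m k) * v k $ i)) \<and> \<sigma> y = (\<Sum>k<n. of_int (m k) * \<sigma> (v k))"
proof (induction n)
  case 0
  then show ?case using H(2) \<sigma>_zero by (intro bexI[of _ "0\<^sub>v d"]) auto
next
  case (Suc n)
  obtain y where y: "y \<in> H" "\<forall>i<d. y $ i = (\<Sum>k<n. of_int (m k) * v k $ i)" "\<sigma> y = (\<Sum>k<n. of_int (m k) * \<sigma> (v k))"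
    using Suc by blast
  obtain z where z: "z \<in> H" "\<forall>i<d. z $ i = of_int (m n) * v n $ i" "\<sigma> z = of_int (m n) * \<sigma> (v n)"
    using int_multiple[OF v] by blast
  have zd: "z \<in> carrier_vec d" using z H by auto
  show ?case using y z zd \<sigma>_add H_add by (intro bexI[of _ "y + z"]) auto
qed

text \<open>Cayley-Hamilton gives a recurrence for the orbit; multiplied by a common denominator it
  is an integer relation in \<open>H\<close>, and \<sigma> turns it into the same recurrence for the
  numbers \<open>\<sigma> (w n)\<close>. Over the complex numbers the polynomial splits, with no
  root on the unit circle.\<close>

lemma bounded_orbit_imp_zero:
  fixes A :: "rat mat" and w :: "int \<Rightarrow> rat Matrix.vec"
  assumes A: "A \<in> carrier_mat d d" and ev: "\<And>z :: complex. eigenvalue (map_mat of_rat A) z \<Longrightarrow> cmod z \<noteq> 1"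
    and w: "\<And>n. w n \<in> H" and step: "\<And>n. w (n + 1) = A *\<^sub>v w n" and bd: "\<And>n. \<bar>\<sigma> (w n)\<bar> \<le> C"
  shows "\<sigma> (w n) = 0"
proof -
  define p where "p = char_poly A"
  obtain N :: int where N: "0 < N" "\<forall>x\<in>coeff p ` {..degree p}. \<exists>m::int. of_int N * x = of_int m"
    using common_denominator[of "coeff p ` {..degree p}"] by auto
  then have "\<forall>k. \<exists>m::int. k \<le> degree p \<longrightarrow> of_int N * coeff p k = of_int m" by auto
  then obtain m :: "nat \<Rightarrow> int" where m: "\<And>k. k \<le> degree p \<Longrightarrow> of_int N * coeff p k = of_int (m k)" by metis
  have mr: "of_int (m k) = of_int N * (of_rat (coeff p k) :: real)" if "k \<le> degree p" for k
    using arg_cong[OF m[OF that], of "of_rat :: rat \<Rightarrow> real"] by (simp add: of_rat_mult)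
  have rec: "(\<Sum>k\<le>degree p. of_rat (coeff p k) * \<sigma> (w (n + int k))) = 0" for n
  proof -
    obtain y where y: "y \<in> H" "\<forall>i<d. y $ i = (\<Sum>k<Suc (degree p). of_int (m k) * w (n + int k) $ i)"
      "\<sigma> y = (\<Sum>k<Suc (degree p). of_int (m k) * \<sigma> (w (n + int k)))"
      using int_combination[where v = "\<lambda>k. w (n + int k)" and n = "Suc (degree p)" and m = m] w by blast
    have "y $ i = 0" if i: "i < d" for i
    proof -
      have "(\<Sum>k\<le>degree p. of_int (m k) * w (n + int k) $ i) = (\<Sum>k\<le>degree p. of_int N * (coeff p k * w (n + int k) $ i))"
        by (rule sum.cong) (auto simp: m[symmetric])
      also have "\<dots> = of_int N * shift_poly p (\<lambda>n. w n $ i) n"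
        by (simp add: shift_poly_def sum_distrib_left)
      also have "shift_poly p (\<lambda>n. w n $ i) n = 0"
        unfolding p_def by (rule shift_poly_char_poly_orbit[where w = w, OF A _ step i]) (use w H in auto)
      finally show ?thesis using y(2) i by (simp add: lessThan_Suc_atMost)
    qed
    then have "y = 0\<^sub>v d" using y(1) H by (intro eq_vecI) auto
    then have "(\<Sum>k\<le>degree p. of_int (m k) * \<sigma> (w (n + int k))) = 0"
      using y(3) \<sigma>_zero by (simp add: lessThan_Suc_atMost)
    moreover have "(\<Sum>k\<le>degree p. of_int (m k) * \<sigma> (w (n + int k)))
        = of_int N * (\<Sum>k\<le>degree p. of_rat (coeff p k) * \<sigma> (w (n + int k)))"
      unfolding sum_distrib_left by (rule sum.cong) (auto simp: mr)
    ultimately show ?thesis using N(1) by simp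
  qed
  have of_real_of_rat: "complex_of_real (of_rat x) = of_rat x" for x
    by (cases x) (simp add: of_rat_rat)
  define s where "s n = complex_of_real (\<sigma> (w n))" for n
  define Ac :: "complex mat" where "Ac = map_mat of_rat A"
  have Ac: "Ac \<in> carrier_mat d d" using A by (simp add: Ac_def)
  obtain as where as: "char_poly Ac = (\<Prod>a\<leftarrow>as. [:- a, 1:])" using char_poly_factorized[OF Ac] by blast
  have cp: "char_poly Ac = map_poly of_rat p" unfolding Ac_def p_def by (rule of_rat_hom.char_poly_hom[OF A])
  have "s n = 0"
  proof (rule bounded_shift_poly_eq_0[where as = as])
    show "cmod (s n) \<le> C" for n using bd by (simp add: s_def)
    show "cmod a \<noteq> 1" if "a \<in> set as" for a
    proof -
      have "poly (char_poly Ac) a = 0" unfolding as using that by (simp add: poly_prod_list_zero_iff)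
      then show ?thesis using ev eigenvalue_root_char_poly[OF Ac] by (simp add: Ac_def)
    qed
    show "shift_poly (\<Prod>a\<leftarrow>as. [:- a, 1:]) s n = 0" for n
    proof -
      have "shift_poly (map_poly of_rat p) s n = (\<Sum>k\<le>degree p. of_rat (coeff p k) * s (n + int k))"
        by (simp add: shift_poly_def coeff_map_poly)
      also have "\<dots> = complex_of_real (\<Sum>k\<le>degree p. of_rat (coeff p k) * \<sigma> (w (n + int k)))"
        unfolding s_def of_real_sum by (rule sum.cong) (simp_all add: of_real_of_rat)
      finally show ?thesis using rec[of n] by (simp add: as[symmetric] cp)
    qed
  qed
  then show ?thesis by (simp add: s_def)
qed

end

subsection \<open>Diffeomorphisms of class \<open>C\<^sup>r\<close>\<close>

lemma Cholder_imp_derivatives: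
  assumes "Cholder k \<alpha> S f"
  shows "\<exists>F :: nat \<Rightarrow> real \<Rightarrow> real. F 0 = f \<and>
    (\<forall>i<k. \<forall>x\<in>S. (F i has_real_derivative F (Suc i) x) (at x)) \<and> Cholder 0 \<alpha> S (F k)"
  using assms
proof (induction k arbitrary: f)
  case 0
  then show ?case by (intro exI[of _ "\<lambda>i. f"]) blast
next
  case (Suc k)
  obtain f' where f': "\<And>x. x \<in> S \<Longrightarrow> (f has_real_derivative f' x) (at x)" "Cholder k \<alpha> S f'"
    using Cholder_SucE[OF Suc.prems] by blast
  obtain F :: "nat \<Rightarrow> real \<Rightarrow> real" where F: "F 0 = f'"
    "\<forall>i<k. \<forall>x\<in>S. (F i has_real_derivative F (Suc i) x) (at x)" "Cholder 0 \<alpha> S (F k)"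
    using Suc.IH[OF f'(2)] by blast
  define F' where "F' = case_nat f F"
  have F': "F' 0 = f" "F' (Suc i) = F i" for i by (simp_all add: F'_def)
  have "(F' i has_real_derivative F' (Suc i) x) (at x)" if "i < Suc k" "x \<in> S" for i x
    using that F f'(1) by (cases i) (auto simp: F')
  then show ?case using F(3) by (intro exI[of _ F']) (auto simp: F' simp del: Cholder.simps)
qed

lemma Cholder_imp_Cr_on:
  assumes "Cholder (nat \<lfloor>r\<rfloor>) (frac r) S f"
  shows "Cr_on r S f"
proof -
  obtain F :: "nat \<Rightarrow> real \<Rightarrow> real" where F: "F 0 = f"
    "\<And>i x. i < nat \<lfloor>r\<rfloor> \<Longrightarrow> x \<in> S \<Longrightarrow> (F i has_real_derivative F (Suc i) x) (at x)"
    "Cholder 0 (frac r) S (F (nat \<lfloor>r\<rfloor>))"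
    using Cholder_imp_derivatives[OF assms] by blast
  have "\<forall>i<nat \<lfloor>r\<rfloor>. \<forall>x\<in>S. (F i has_real_derivative F (Suc i) x) (at x within S)"
    using F(2) has_field_derivative_at_within by blast
  moreover have "\<exists>C. \<forall>x\<in>K. \<forall>y\<in>K. \<bar>F (nat \<lfloor>r\<rfloor>) x - F (nat \<lfloor>r\<rfloor>) y\<bar> \<le> C * \<bar>x - y\<bar> powr frac r"
    if "compact K \<and> K \<subseteq> S" for K
    using F(3) that unfolding Cholder.simps by blast
  moreover have "continuous_on S (F (nat \<lfloor>r\<rfloor>))" using F(3) by simp
  ultimately show ?thesis unfolding Cr_on_def Let_def using F(1) by blast
qed

lemma Cholder_derivatives:
  assumes T: "open T" "T \<subseteq> S"
    and F: "\<And>i x. i < k \<Longrightarrow> x \<in> S \<Longrightarrow> (F i has_real_derivative F (Suc i) x) (at x within S)"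
    and F0: "Cholder 0 \<alpha> T (F k)"
  shows "j \<le> k \<Longrightarrow> Cholder j \<alpha> T (F (k - j))"
proof (induction j)
  case 0
  then show ?case using F0 by simp
next
  case (Suc j)
  have "(F (k - Suc j) has_real_derivative F (k - j) x) (at x)" if x: "x \<in> T" for x
  proof -
    have "(F (k - Suc j) has_real_derivative F (Suc (k - Suc j)) x) (at x within S)"
      by (rule F) (use Suc.prems x T in auto)
    then have "(F (k - Suc j) has_real_derivative F (Suc (k - Suc j)) x) (at x within T)"
      by (rule DERIV_subset) (rule T)
    moreover have "Suc (k - Suc j) = k - j" using Suc.prems by simp
    ultimately show ?thesis using T(1) x by (simp add: at_within_open[of x T])
  qed
  then show ?case using Suc by (intro Cholder_SucI[of T _ "F (k - j)"]) auto
qed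

text \<open>The derivative is nonzero because the inverse is differentiable too, and nonnegative by
  monotonicity. The Lipschitz constant of \<open>ln f'\<close> bounds the quotient of the second
  derivative by the first; this is where \<open>2 \<le> r\<close> enters.\<close>

lemma Cr_diffeo_imp_smooth01:
  assumes r: "2 \<le> r" and diffeo: "Cr_diffeo r {0..1} {0..1} f" and mono: "strict_mono_on {0..1} f"
  obtains f' where "smooth01 f f'" "Cholder (nat \<lfloor>r\<rfloor> - 1) (frac r) {0<..<1} f'"
proof -
  define k where "k = nat \<lfloor>r\<rfloor>"
  have k: "2 \<le> k" using r by (simp add: k_def le_nat_iff le_floor_iff)
  obtain g where g: "homeomorphism {0..1} {0..1} f g" "Cr_on r {0..1} f" "Cr_on r {0..1} g"
    using diffeo by (auto simp: Cr_diffeo_def)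
  obtain F where F0: "F 0 = f"
    and Fder: "\<forall>i<k. \<forall>x\<in>{0..1}. (F i has_real_derivative F (Suc i) x) (at x within {0..1})"
    and Fcont: "continuous_on {0..1} (F k)"
    and FK: "0 < frac r \<longrightarrow> (\<forall>K. compact K \<and> K \<subseteq> {0..1} \<longrightarrow>
      (\<exists>C. \<forall>x\<in>K. \<forall>y\<in>K. \<bar>F k x - F k y\<bar> \<le> C * \<bar>x - y\<bar> powr frac r))"
    using g(2) unfolding Cr_on_def Let_def k_def[symmetric] by (elim exE conjE)
  have F: "(F i has_real_derivative F (Suc i) x) (at x within {0..1})" if "i < k" "x \<in> {0..1}" for i x
    using Fder that by blast
  obtain G where G0: "G 0 = g"
    and Gder: "\<forall>i<k. \<forall>x\<in>{0..1}. (G i has_real_derivative G (Suc i) x) (at x within {0..1})"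
    using g(3) unfolding Cr_on_def Let_def k_def[symmetric] by (elim exE conjE)
  have f01: "f ` {0..1} = {0..1}" and gf: "\<And>x. x \<in> {0..1} \<Longrightarrow> g (f x) = x"
    using g(1) by (auto simp: homeomorphism_def)
  have le: "f x \<le> f y" if "x \<in> {0..1}" "y \<in> {0..1}" "x \<le> y" for x y
    using strict_mono_onD[OF mono that(1,2)] that(3) by (cases "x = y") auto
  have f0: "f 0 = 0"
  proof -
    obtain z where "z \<in> {0..1}" "f z = 0" using f01 by (metis atLeastAtMost_iff imageE order_refl zero_le_one)
    moreover have "f 0 \<in> {0..1}" using f01 by auto
    ultimately show ?thesis using le[of 0 z] by auto
  qed
  have f1: "f 1 = 1"
  proof -
    obtain z where "z \<in> {0..1}" "f z = 1" using f01 by (metis atLeastAtMost_iff imageE order_refl zero_le_one)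
    moreover have "f 1 \<in> {0..1}" using f01 by auto
    ultimately show ?thesis using le[of z 1] by auto
  qed
  have der: "(f has_real_derivative F 1 x) (at x within {0..1})" if "x \<in> {0..1}" for x
    using F[of 0 x] that k F0 by simp
  have pos: "0 < F 1 x" if x: "x \<in> {0..1}" for x
  proof -
    have nontriv: "at x within {0..1} \<noteq> bot" using x by (auto simp: trivial_limit_within islimpt_Icc)
    have fx: "f x \<in> {0..1}" using f01 x by auto
    have "(g has_real_derivative G 1 (f x)) (at (f x) within (f ` {0..1}))"
      using Gder[rule_format, of 0 "f x"] fx k G0 f01 by simp
    from DERIV_image_chain[OF this der[OF x]]
    have "((\<lambda>y. g (f y)) has_real_derivative G 1 (f x) * F 1 x) (at x within {0..1})" by (simp add: o_def)
    moreover have "((\<lambda>y. g (f y)) has_real_derivative 1) (at x within {0..1})"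
      by (rule has_field_derivative_transform_within[OF DERIV_ident, of 1]) (use x gf in auto)
    ultimately have "G 1 (f x) * F 1 x = 1" using has_field_derivative_unique nontriv by blast
    then have "F 1 x \<noteq> 0" by auto
    moreover have "0 \<le> F 1 x"
    proof (rule tendsto_lowerbound[OF _ _ nontriv])
      show "((\<lambda>y. (f y - f x) / (y - x)) \<longlongrightarrow> F 1 x) (at x within {0..1})"
        using der[OF x] by (simp add: has_field_derivative_iff)
      have "0 \<le> (f y - f x) / (y - x)" if "y \<in> {0..1}" for y
        using le[of x y] le[of y x] x that by (cases "x \<le> y") (auto intro: divide_nonneg_nonneg divide_nonpos_nonpos)
      then show "\<forall>\<^sub>F y in at x within {0..1}. 0 \<le> (f y - f x) / (y - x)"
        by (auto simp: eventually_at_filter)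
    qed
    ultimately show ?thesis by simp
  qed
  have der1: "(F 1 has_real_derivative F 2 x) (at x within {0..1})" if "x \<in> {0..1}" for x
    using F[of 1 x] that k by (simp add: numeral_2_eq_2)
  have cont1: "continuous_on {0..1} (F 1)" using der1 by (rule DERIV_continuous_on)
  \<comment> \<open>If \<open>k = 2\<close>, the continuity of \<open>F 2\<close> is part of
    \<open>Cr_on\<close>; otherwise \<open>F 2\<close> has a further derivative.\<close>
  have cont2: "continuous_on {0..1} (F 2)"
  proof (cases "k = 2")
    case False
    then have "(F 2 has_real_derivative F 3 x) (at x within {0..1})" if "x \<in> {0..1}" for x
      using F[of 2 x] that k by (simp add: numeral_3_eq_3 numeral_2_eq_2)
    then show ?thesis by (rule DERIV_continuous_on)
  qed (use Fcont in simp)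
  have "continuous_on {0..1} (\<lambda>x. F 2 x / F 1 x)"
    by (intro continuous_on_divide cont1 cont2) (use pos in force)
  then have "bounded ((\<lambda>x. F 2 x / F 1 x) ` {0..1})"
    by (intro compact_imp_bounded compact_continuous_image) auto
  then obtain L where L: "0 < L" "\<forall>z\<in>(\<lambda>x. F 2 x / F 1 x) ` {0..1}. norm z \<le> L" unfolding bounded_pos by blast
  have "norm (ln (F 1 x) - ln (F 1 y)) \<le> L * norm (x - y)" if "x \<in> {0..1}" "y \<in> {0..1}" for x y
  proof (rule field_differentiable_bound[of "{0..1}" "\<lambda>x. ln (F 1 x)" "\<lambda>x. F 2 x / F 1 x"])
    show "((\<lambda>x. ln (F 1 x)) has_real_derivative F 2 z / F 1 z) (at z within {0..1})" if z: "z \<in> {0..1}" for z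
      using DERIV_chain2[OF DERIV_ln[OF pos[OF z]] der1[OF z]] by (simp add: divide_inverse mult.commute)
  qed (use L that in auto)
  then have smooth: "smooth01 f (F 1)"
    unfolding smooth01_def using f0 f1 der pos L(1) by (intro conjI ballI exI[of _ L]) auto
  \<comment> \<open>For integer \<open>r\<close>, \<open>Cr_on\<close> contains no Hoelder
    condition; then the exponent is 0 and continuity is enough.\<close>
  have base: "Cholder 0 (frac r) {0<..<1} (F k)"
  proof (cases "frac r = 0")
    case True
    show ?thesis unfolding True Cholder_0_zero_iff using Fcont by (rule continuous_on_subset) auto
  next
    case False
    then have fr: "0 < frac r" using frac_ge_0[of r] by linarith
    have "\<exists>C\<ge>0. \<forall>x\<in>K. \<forall>y\<in>K. \<bar>F k x - F k y\<bar> \<le> C * \<bar>x - y\<bar> powr frac r" if K: "compact K" "K \<subseteq> {0<..<1}" for K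
    proof -
      have K01: "K \<subseteq> {0..1}" using K(2) by (rule order_trans) auto
      obtain C where C: "\<And>x y. x \<in> K \<Longrightarrow> y \<in> K \<Longrightarrow> \<bar>F k x - F k y\<bar> \<le> C * \<bar>x - y\<bar> powr frac r"
        using FK[THEN mp, OF fr, THEN spec, THEN mp, OF conjI[OF K(1) K01]] by blast
      have "\<bar>F k x - F k y\<bar> \<le> \<bar>C\<bar> * \<bar>x - y\<bar> powr frac r" if "x \<in> K" "y \<in> K" for x y
        by (rule order_trans[OF C[OF that]]) (intro mult_right_mono, auto)
      then show ?thesis by (intro exI[of _ "\<bar>C\<bar>"]) auto
    qed
    moreover have "continuous_on {0<..<1} (F k)" using Fcont by (rule continuous_on_subset) auto
    ultimately show ?thesis by simp
  qed
  have "Cholder (k - 1) (frac r) {0<..<1} (F (k - (k - 1)))"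
  proof (rule Cholder_derivatives[where F = F and S = "{0..1}" and k = k])
    show "(F i has_real_derivative F (Suc i) x) (at x within {0..1})" if "i < k" "x \<in> {0..1}" for i x
      by (rule F[OF that])
    show "{0<..<1} \<subseteq> {0..1::real}" by auto
  qed (use base in simp_all)
  moreover have "k - (k - 1) = 1" using k by simp
  ultimately show ?thesis using that smooth by (simp add: k_def)
qed

subsection \<open>The semidirect product\<close>

text \<open>Together with \<open>1 \<le> d\<close>, this turns the rank hypothesis into the
  nontriviality of \<open>H\<close>.\<close>

lemma rank_rat_trivial: "rank_rat ((monoid_vec TYPE(rat) d)\<lparr>carrier := {0\<^sub>v d}\<rparr>) = 0"
proof -
  have "\<exists>f. f \<in> hom ((monoid_vec TYPE(rat) d)\<lparr>carrier := {0\<^sub>v d}\<rparr>) (monoid_vec TYPE(rat) 0) \<and>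
     inj_on f (carrier ((monoid_vec TYPE(rat) d)\<lparr>carrier := {0\<^sub>v d}\<rparr>))"
    by (intro exI[of _ "\<lambda>_. 0\<^sub>v 0"]) (auto simp: hom_def monoid_vec_simps)
  then show ?thesis unfolding rank_rat_def by (intro Least_eq_0)
qed

lemma GL_rat_powers:
  assumes "A \<in> carrier (GL_rat d)"
  obtains Ai where "A \<in> carrier_mat d d" "Ai \<in> carrier_mat d d" "A * Ai = 1\<^sub>m d" "Ai * A = 1\<^sub>m d"
    "\<one>\<^bsub>GL_rat d\<^esub> = 1\<^sub>m d" "A [^]\<^bsub>GL_rat d\<^esub> (1::int) = A" "A [^]\<^bsub>GL_rat d\<^esub> (- 1::int) = Ai"
proof -
  interpret R: ring "ring_mat TYPE(rat) d ()" by (rule ring_mat)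
  interpret GL: group "GL_rat d" unfolding GL_rat_def by (rule R.units_group)
  define Ai where "Ai = inv\<^bsub>GL_rat d\<^esub> A"
  have Ai: "Ai \<in> carrier (GL_rat d)" using assms by (simp add: Ai_def)
  have mat: "X \<in> carrier_mat d d" if "X \<in> carrier (GL_rat d)" for X
    using that by (auto simp: GL_rat_def units_of_carrier Units_def ring_mat_simps)
  have mult: "X \<otimes>\<^bsub>GL_rat d\<^esub> Y = X * Y" for X Y by (simp add: GL_rat_def units_of_mult ring_mat_simps)
  have one: "\<one>\<^bsub>GL_rat d\<^esub> = 1\<^sub>m d" by (simp add: GL_rat_def units_of_one ring_mat_simps)
  show ?thesis
  proof (rule that[of Ai])
    show "A * Ai = 1\<^sub>m d" "Ai * A = 1\<^sub>m d"
      using GL.r_inv[OF assms] GL.l_inv[OF assms] by (simp_all add: mult one Ai_def)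
    show "A [^]\<^bsub>GL_rat d\<^esub> (- 1::int) = Ai"
      using assms by (simp add: GL.int_pow_neg Ai_def)
  qed (use assms Ai mat one in auto)
qed

theorem proposition4p17:
  fixes d :: nat and A :: "rat mat" and H :: "rat Matrix.vec set" and r :: real
    and \<rho> :: "int \<times> rat Matrix.vec \<Rightarrow> real \<Rightarrow> real"
  assumes "1 \<le> d"
    and "A \<in> carrier (GL_rat d)"
    and "\<And>z :: complex. eigenvalue (map_mat of_rat A) z \<Longrightarrow> cmod z \<noteq> 1"
    and "subgroup H (monoid_vec TYPE(rat) d)"
    and "(\<lambda>v. A *\<^sub>v v) ` H = H"
    and "rank_rat ((monoid_vec TYPE(rat) d)\<lparr>carrier := H\<rparr>) = d"
    and "2 \<le> r"
    and "faithful_action (Z_ltimes d A H) {0..1} \<rho>"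
    and "\<And>g. g \<in> carrier (Z_ltimes d A H) \<Longrightarrow>
           Cr_diffeo r {0..1} {0..1} (\<rho> g) \<and> strict_mono_on {0..1} (\<rho> g)"
    and "\<not> (\<exists>x\<in>{0<..<1}. \<forall>g\<in>carrier (Z_ltimes d A H). \<rho> g x = x)"
  shows "\<exists>\<phi>. conj_to_affine_by (Z_ltimes d A H) \<rho> \<phi> \<and> Cr_diffeo r {0<..<1} UNIV \<phi>"
proof -
  define G where "G = Z_ltimes d A H"
  have action: "faithful_action G {0..1} \<rho>" using assms(8) by (simp add: G_def)
  then have hom: "group_hom G (BijGroup {0..1}) \<rho>" and inj: "inj_on \<rho> (carrier G)"
    by (auto simp: faithful_action_def group_action_def faithful_action_axioms_def)
  interpret hom: group_hom G "BijGroup {0..1}" \<rho> by (rule hom)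
  obtain Ai where A: "A \<in> carrier_mat d d" and Ai: "Ai \<in> carrier_mat d d"
    and inv: "A * Ai = 1\<^sub>m d" "Ai * A = 1\<^sub>m d"
    and pow: "\<one>\<^bsub>GL_rat d\<^esub> = 1\<^sub>m d" "A [^]\<^bsub>GL_rat d\<^esub> (1::int) = A"
      "A [^]\<^bsub>GL_rat d\<^esub> (- 1::int) = Ai"
    using GL_rat_powers[OF assms(2)] by blast
  interpret V: comm_group "monoid_vec TYPE(rat) d" by (rule comm_group_vec)
  interpret HV: subgroup H "monoid_vec TYPE(rat) d" by (rule assms(4))
  have Hc: "h \<in> carrier_vec d" if "h \<in> H" for h using HV.mem_carrier[OF that] by (simp add: monoid_vec_simps)
  have H0: "0\<^sub>v d \<in> H" using HV.one_closed by (simp add: monoid_vec_simps)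
  have H_add: "h + k \<in> H" if "h \<in> H" "k \<in> H" for h k using HV.m_closed[OF that] by (simp add: monoid_vec_simps)
  have H_neg: "- h \<in> H" if h: "h \<in> H" for h
  proof -
    have "inv\<^bsub>monoid_vec TYPE(rat) d\<^esub> h = - h"
      by (rule V.inv_equality) (use Hc[OF h] in \<open>auto simp: monoid_vec_simps\<close>)
    then show ?thesis using HV.m_inv_closed[OF h] by simp
  qed
  have AAi: "A *\<^sub>v (Ai *\<^sub>v h) = h" "Ai *\<^sub>v (A *\<^sub>v h) = h" if "h \<in> H" for h
    using assoc_mult_mat_vec[OF A Ai Hc[OF that]] assoc_mult_mat_vec[OF Ai A Hc[OF that]] Hc[OF that]
    by (simp_all add: inv)
  have AH: "A *\<^sub>v h \<in> H" if "h \<in> H" for h using assms(5) that by blast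
  have AiH: "Ai *\<^sub>v h \<in> H" if "h \<in> H" for h
  proof -
    obtain k where "k \<in> H" "h = A *\<^sub>v k" using assms(5) \<open>h \<in> H\<close> by blast
    then show ?thesis using AAi(2) by simp
  qed
  have mem: "(m, h) \<in> carrier G \<longleftrightarrow> h \<in> H" for m h by (simp add: G_def Z_ltimes_def)
  have mult: "(m, u) \<otimes>\<^bsub>G\<^esub> (n, v) = (m + n, u + (A [^]\<^bsub>GL_rat d\<^esub> m) *\<^sub>v v)" for m n u v
    by (simp add: G_def Z_ltimes_def)
  have one: "\<one>\<^bsub>G\<^esub> = (0, 0\<^sub>v d)" by (simp add: G_def Z_ltimes_def)
  have bij: "\<rho> g \<in> Bij {0..1}" if "g \<in> carrier G" for g
    using hom.hom_closed[OF that] by (simp add: BijGroup_def)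
  have comp: "\<rho> g (\<rho> h x) = \<rho> (g \<otimes>\<^bsub>G\<^esub> h) x" if "g \<in> carrier G" "h \<in> carrier G" "x \<in> {0..1}" for g h x
    using hom.hom_mult[OF that(1,2)] bij[OF that(1)] bij[OF that(2)] that(3) by (simp add: BijGroup_def compose_def)
  have \<rho>_one: "\<rho> (0, 0\<^sub>v d) x = x" if "x \<in> {0..1}" for x
    using hom.hom_one that by (simp add: one BijGroup_def)
  let ?k = "nat \<lfloor>r\<rfloor>" and ?\<alpha> = "frac r"
  have "\<forall>g\<in>carrier G. \<exists>f'. smooth01 (\<rho> g) f' \<and> Cholder (?k - 1) ?\<alpha> {0<..<1} f'"
    using Cr_diffeo_imp_smooth01[OF assms(7)] assms(9) unfolding G_def by metis
  then obtain \<rho>' where \<rho>': "\<And>g. g \<in> carrier G \<Longrightarrow> smooth01 (\<rho> g) (\<rho>' g)"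
    "\<And>g. g \<in> carrier G \<Longrightarrow> Cholder (?k - 1) ?\<alpha> {0<..<1} (\<rho>' g)"
    by metis
  let ?a = "(1::int, 0\<^sub>v d :: rat Matrix.vec)" and ?b = "(- 1::int, 0\<^sub>v d :: rat Matrix.vec)"
  let ?T = "\<lambda>h. \<rho> (0, h)" and ?T' = "\<lambda>h. \<rho>' (0, h)"
  have Mz: "1\<^sub>m d *\<^sub>v (0\<^sub>v d :: rat Matrix.vec) = 0\<^sub>v d" "A *\<^sub>v 0\<^sub>v d = 0\<^sub>v d" "Ai *\<^sub>v 0\<^sub>v d = 0\<^sub>v d"
    using A Ai by auto
  have TT: "\<rho> (0, h) (\<rho> (0, k) x) = \<rho> (0, h + k) x" if "h \<in> H" "k \<in> H" "x \<in> {0..1}" for h k x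
    using comp[of "(0, h)" "(0, k)" x] that Hc[OF that(2)] by (simp add: mem mult pow)
  have aT: "\<rho> ?a (\<rho> (0, h) x) = \<rho> (1, A *\<^sub>v h) x" "\<rho> ?b (\<rho> (0, h) x) = \<rho> (- 1, Ai *\<^sub>v h) x"
    if "h \<in> H" "x \<in> {0..1}" for h x
    using comp[of ?a "(0, h)" x] comp[of ?b "(0, h)" x] that H0 Hc[OF AH[OF that(1)]] Hc[OF AiH[OF that(1)]]
    by (simp_all add: mem mult pow)
  \<comment> \<open>Every element is an element of \<open>H\<close> times a power of the generator,
    so statements about the action reduce to these two kinds.\<close>
  have Tg: "\<rho> (0, h) (\<rho> (m, 0\<^sub>v d) x) = \<rho> (m, h) x" if "h \<in> H" "x \<in> {0..1}" for h m x
    using comp[of "(0, h)" "(m, 0\<^sub>v d)" x] that H0 Hc[OF that(1)] by (simp add: mem mult pow)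
  have ag: "\<rho> ?a (\<rho> (m, 0\<^sub>v d) x) = \<rho> (m + 1, 0\<^sub>v d) x" "\<rho> ?b (\<rho> (m, 0\<^sub>v d) x) = \<rho> (m - 1, 0\<^sub>v d) x"
    if "x \<in> {0..1}" for m x
    using comp[of ?a "(m, 0\<^sub>v d)" x] comp[of ?b "(m, 0\<^sub>v d)" x] that H0
    by (simp_all add: mem mult pow Mz add.commute)
  have open_maps: "\<rho> g x \<in> {0<..<1}" if "g \<in> carrier G" "x \<in> {0<..<1}" for g x
    by (rule smooth01_open_maps[OF \<rho>'(1)[OF that(1)] that(2)])
  interpret hyperbolic_action H "(+)" ?T ?T' "\<lambda>h. A *\<^sub>v h" "\<lambda>h. Ai *\<^sub>v h" "\<rho> ?a" "\<rho>' ?a" "\<rho> ?b" "\<rho>' ?b"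
  proof
    show "h + k \<in> H" if "h \<in> H" "k \<in> H" for h k by (rule H_add[OF that])
    show "h + k = k + h" if "h \<in> H" "k \<in> H" for h k by (rule comm_add_vec[OF Hc[OF that(1)] Hc[OF that(2)]])
    show "\<exists>k\<in>H. \<forall>x\<in>{0..1}. ?T k (?T h x) = x \<and> ?T h (?T k x) = x" if h: "h \<in> H" for h
      using TT[OF h H_neg[OF h]] TT[OF H_neg[OF h] h] H_neg[OF h] Hc[OF h] \<rho>_one
      by (intro bexI[of _ "- h"]) auto
    show "?T (h + k) x = ?T h (?T k x)" if "h \<in> H" "k \<in> H" "x \<in> {0..1}" for h k x
      using TT[OF that] by simp
    show "smooth01 (?T h) (?T' h)" if "h \<in> H" for h using \<rho>'(1) that by (simp add: mem)
    show "smooth01 (\<rho> ?a) (\<rho>' ?a)" "smooth01 (\<rho> ?b) (\<rho>' ?b)" using \<rho>'(1) H0 by (simp_all add: mem)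
    show "A *\<^sub>v h \<in> H" "Ai *\<^sub>v h \<in> H" "A *\<^sub>v (Ai *\<^sub>v h) = h" "Ai *\<^sub>v (A *\<^sub>v h) = h" if "h \<in> H" for h
      using AH AiH AAi that by auto
    show "\<rho> ?a (\<rho> ?b x) = x" "\<rho> ?b (\<rho> ?a x) = x" if "x \<in> {0..1}" for x
      using ag(1)[OF that, of "- 1"] ag(2)[OF that, of 1] \<rho>_one[OF that] by simp_all
    show "\<rho> ?a (?T h x) = ?T (A *\<^sub>v h) (\<rho> ?a x)" "\<rho> ?b (?T h x) = ?T (Ai *\<^sub>v h) (\<rho> ?b x)"
      if "h \<in> H" "x \<in> {0..1}" for h x
      using aT[OF that] Tg[OF AH[OF that(1)] that(2)] Tg[OF AiH[OF that(1)] that(2)] by simp_all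
    show "\<sigma> h = 0"
      if add: "\<And>h k. h \<in> H \<Longrightarrow> k \<in> H \<Longrightarrow> \<sigma> (h + k) = \<sigma> h + \<sigma> k"
        and bdA: "\<And>h. h \<in> H \<Longrightarrow> \<exists>C. \<forall>n. \<bar>\<sigma> (((\<lambda>h. A *\<^sub>v h) ^^ n) h)\<bar> \<le> C"
        and bdB: "\<And>h. h \<in> H \<Longrightarrow> \<exists>C. \<forall>n. \<bar>\<sigma> (((\<lambda>h. Ai *\<^sub>v h) ^^ n) h)\<bar> \<le> C"
        and h: "h \<in> H" for \<sigma> :: "rat Matrix.vec \<Rightarrow> real" and h
    proof -
      interpret additive_on_subgroup d H \<sigma>
        by unfold_locales (use Hc H0 H_add H_neg add in auto)
      \<comment> \<open>The two-sided orbit of \<open>h\<close>, glued from the forward iterates of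
        \<open>A\<close> and of its inverse.\<close>
      define w where "w n = (if 0 \<le> n then ((\<lambda>h. A *\<^sub>v h) ^^ nat n) h else ((\<lambda>h. Ai *\<^sub>v h) ^^ nat (- n)) h)" for n :: int
      have itA: "((\<lambda>h. A *\<^sub>v h) ^^ n) h \<in> H" for n by (induction n) (use h AH in auto)
      have itB: "((\<lambda>h. Ai *\<^sub>v h) ^^ n) h \<in> H" for n by (induction n) (use h AiH in auto)
      obtain C where C: "\<And>n. \<bar>\<sigma> (((\<lambda>h. A *\<^sub>v h) ^^ n) h)\<bar> \<le> C" using bdA[OF h] by blast
      obtain D where D: "\<And>n. \<bar>\<sigma> (((\<lambda>h. Ai *\<^sub>v h) ^^ n) h)\<bar> \<le> D" using bdB[OF h] by blast
      have "\<sigma> (w 0) = 0"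
      proof (rule bounded_orbit_imp_zero[OF A assms(3), where C = "max C D"])
        show "w n \<in> H" for n using itA itB by (simp add: w_def)
        show "\<bar>\<sigma> (w n)\<bar> \<le> max C D" for n using C D by (auto simp: w_def intro: max.coboundedI1 max.coboundedI2)
        show "w (n + 1) = A *\<^sub>v w n" for n
        proof (cases "0 \<le> n")
          case True
          then have "nat (n + 1) = Suc (nat n)" by simp
          then show ?thesis using True by (simp add: w_def)
        next
          case False
          define m where "m = nat (- n - 1)"
          \<comment> \<open>Here \<open>w n\<close> consists of \<open>Suc m\<close> factors
            \<open>Ai\<close> and \<open>w (n + 1)\<close> of \<open>m\<close>; applying
            \<open>A\<close> cancels the outermost one. The case \<open>m = 0\<close> crosses the
            seam of the definition.\<close>
          have n: "n = - int (Suc m)" using False by (simp add: m_def)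
          have wn: "w n = Ai *\<^sub>v ((\<lambda>h. Ai *\<^sub>v h) ^^ m) h" by (simp add: w_def n nat_add_distrib)
          have "w (n + 1) = ((\<lambda>h. Ai *\<^sub>v h) ^^ m) h" by (cases m) (simp_all add: w_def n nat_add_distrib)
          then show ?thesis using AAi(1)[OF itB[of m]] by (simp add: wn)
        qed
      qed
      then show ?thesis by (simp add: w_def)
    qed
    show "\<rho> ?a x \<noteq> x" if x: "x \<in> {0<..<1}" and fixT: "\<And>h. h \<in> H \<Longrightarrow> ?T h x = x" for x
    proof
      assume ax: "\<rho> ?a x = x"
      have x01: "x \<in> {0..1}" using x by auto
      have bx: "\<rho> ?b x = x" using ag(2)[OF x01, of 1] ax \<rho>_one[OF x01] by simp
      have gx: "\<rho> (m, 0\<^sub>v d) x = x" for m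
      proof (induction m rule: int_induct[where k = 0])
        case (step1 i)
        then show ?case using ag(1)[OF x01, of i] ax by simp
      next
        case (step2 i)
        then show ?case using ag(2)[OF x01, of i] bx by simp
      qed (rule \<rho>_one[OF x01])
      have "\<rho> g x = x" if "g \<in> carrier G" for g
        using Tg[OF _ x01, of "snd g" "fst g"] gx fixT that mem[of "fst g" "snd g"] by simp
      then show False using assms(10) x unfolding G_def by blast
    qed
    show "\<exists>h\<in>H. \<exists>x\<in>{0..1}. ?T h x \<noteq> x"
    proof -
      have "H \<noteq> {0\<^sub>v d}" using assms(1,6) rank_rat_trivial[of d] by auto
      then obtain h where h: "h \<in> H" "h \<noteq> 0\<^sub>v d" using H0 by blast
      have "\<rho> (0, h) \<noteq> \<rho> (0, 0\<^sub>v d)"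
        using inj_onD[OF inj, of "(0, h)" "(0, 0\<^sub>v d)"] h H0 by (auto simp: mem)
      \<comment> \<open>Bijections of [0, 1] are extensional, so two different ones differ at a
        point of [0, 1].\<close>
      moreover have "\<rho> (0, h) \<in> extensional {0..1}" "\<rho> (0, 0\<^sub>v d) \<in> extensional {0..1}"
        using Bij_imp_extensional[OF bij] h H0 by (auto simp: mem)
      ultimately obtain x where "x \<in> {0..1}" "\<rho> (0, h) x \<noteq> \<rho> (0, 0\<^sub>v d) x"
        using extensionalityI by blast
      then show ?thesis using h \<rho>_one by auto
    qed
  qed
  obtain \<Phi> D \<tau> \<mu> c where \<Phi>: "\<And>x. x \<in> {0<..<1} \<Longrightarrow> (\<Phi> has_real_derivative D x) (at x)"
    "\<And>x. x \<in> {0<..<1} \<Longrightarrow> 0 < D x" "continuous_on {0<..<1} D" "\<Phi> ` {0<..<1} = (UNIV :: real set)"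
    and \<Phi>T: "\<And>k x. k \<in> H \<Longrightarrow> x \<in> {0<..<1} \<Longrightarrow> \<Phi> (?T k x) = \<Phi> x + \<tau> k"
    and \<Phi>a: "\<And>x. x \<in> {0<..<1} \<Longrightarrow> \<Phi> (\<rho> ?a x) = \<mu> * \<Phi> x + c" and \<mu>: "0 < (\<mu>::real)" "\<mu> \<noteq> 1"
  proof (rule affine_coordinate, goal_cases)
    case (1 \<Phi> D \<tau> \<mu> c)
    show ?case by (rule that[OF 1(2-)])
  qed
  have ga: "?a \<in> carrier G" "?b \<in> carrier G" using H0 by (simp_all add: mem)
  have \<Phi>b: "\<Phi> (\<rho> ?b x) = inverse \<mu> * \<Phi> x + (- c / \<mu>)" if x: "x \<in> {0<..<1}" for x
  proof -
    have "\<rho> ?a (\<rho> ?b x) = x" using ab[of x] x by auto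
    then have "\<Phi> x = \<mu> * \<Phi> (\<rho> ?b x) + c" using \<Phi>a[OF open_maps[OF ga(2) x]] by simp
    then show ?thesis using \<mu>(1) by (simp add: field_simps)
  qed
  have k: "2 \<le> ?k" using assms(7) by (simp add: le_nat_iff le_floor_iff)
  \<comment> \<open>The index \<open>k - 1\<close> counts the derivatives of
    \<open>\<rho>' g\<close>; it is at least 1 since \<open>2 \<le> r\<close>.\<close>
  then have Suck: "Suc (?k - 1) = ?k" "1 \<le> ?k - 1" by auto
  have \<alpha>: "0 \<le> ?\<alpha>" "?\<alpha> \<le> 1" using frac_ge_0[of r] frac_lt_1[of r] by auto
  have a': "(\<rho> g has_real_derivative \<rho>' g x) (at x)" "0 < \<rho>' g x" if "g \<in> carrier G" "x \<in> {0<..<1}" for g x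
    using smooth01_deriv_at[OF \<rho>'(1)[OF that(1)] that(2)] smooth01_pos[OF \<rho>'(1)[OF that(1)], of x] that(2) by auto
  have regular: "\<exists>\<Psi>. (\<forall>y. \<Psi> y \<in> {0<..<1}) \<and> (\<forall>y. \<Phi> (\<Psi> y) = y) \<and> (\<forall>x\<in>{0<..<1}. \<Psi> (\<Phi> x) = x) \<and>
      Cholder ?k ?\<alpha> {0<..<1} \<Phi> \<and> Cholder ?k ?\<alpha> UNIV \<Psi>"
    if g: "g \<in> carrier G" and \<nu>: "0 < \<nu>" "\<nu> < 1"
      and conj: "\<And>x. x \<in> {0<..<1} \<Longrightarrow> \<Phi> (\<rho> g x) = \<nu> * \<Phi> x + e" for g \<nu> e
  proof (rule affine_coordinate_regular[OF \<nu> \<alpha> Suck(2) \<Phi>, of "\<rho> g" e "\<rho>' g"], goal_cases)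
    case (1 x)
    then show ?case .
  next
    case (2 x)
    then show ?case .
  next
    case (3 x)
    then show ?case using open_maps[OF g] conj by blast
  next
    case (4 x)
    then show ?case by (rule a'(1)[OF g])
  next
    case (5 x)
    then show ?case by (rule a'(2)[OF g])
  next
    case 6
    show ?case by (rule \<rho>'(2)[OF g])
  next
    case (7 \<Psi>)
    then show ?case unfolding Suck(1) by blast
  qed
  \<comment> \<open>The regularity argument needs a contraction: \<open>a\<close> itself if \<mu> <
    1, and otherwise its inverse, of slope \<open>inverse \<mu>\<close>.\<close>
  have "\<exists>\<Psi>. (\<forall>y. \<Psi> y \<in> {0<..<1}) \<and> (\<forall>y. \<Phi> (\<Psi> y) = y) \<and> (\<forall>x\<in>{0<..<1}. \<Psi> (\<Phi> x) = x) \<and>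
      Cholder ?k ?\<alpha> {0<..<1} \<Phi> \<and> Cholder ?k ?\<alpha> UNIV \<Psi>"
  proof (cases "\<mu> < 1")
    case True
    show ?thesis by (rule regular[OF ga(1) \<mu>(1) True \<Phi>a])
  next
    case False
    then have inv\<mu>: "0 < inverse \<mu>" "inverse \<mu> < 1" using \<mu> by (auto simp: inverse_less_1_iff)
    show ?thesis by (rule regular[OF ga(2) inv\<mu> \<Phi>b])
  qed
  then obtain \<Psi> where \<Psi>: "\<And>y. \<Psi> y \<in> {0<..<1::real}" "\<And>y. \<Phi> (\<Psi> y) = y"
    "\<And>x. x \<in> {0<..<1} \<Longrightarrow> \<Psi> (\<Phi> x) = x" "Cholder ?k ?\<alpha> {0<..<1} \<Phi>" "Cholder ?k ?\<alpha> UNIV \<Psi>"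
    by blast
  have "x \<in> range \<Psi>" if "x \<in> {0<..<1}" for x using \<Psi>(3)[OF that] by (metis rangeI)
  then have "range \<Psi> = {0<..<1}" using \<Psi>(1) by blast
  then have homeo: "homeomorphism {0<..<1} UNIV \<Phi> \<Psi>"
    using \<Psi>(2,3) Cholder_imp_continuous[OF \<Psi>(4)] Cholder_imp_continuous[OF \<Psi>(5)] \<Phi>(4)
    by (simp add: homeomorphism_def)
  have affine: "\<exists>s t. 0 < s \<and> (\<forall>x\<in>{0<..<1}. \<Phi> (\<rho> g x) = s * \<Phi> x + t)" if g: "g \<in> carrier G" for g
  proof -
    have *: "\<exists>s t. 0 < s \<and> (\<forall>x\<in>{0<..<1}. \<Phi> (\<rho> (m, 0\<^sub>v d) x) = s * \<Phi> x + t)" for m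
    proof (induction m rule: int_induct[where k = 0])
      case base
      show ?case by (rule exI[of _ 1], rule exI[of _ 0]) (auto simp: \<rho>_one)
    next
      case (step1 i)
      then obtain s t where st: "0 < s" "\<And>x. x \<in> {0<..<1} \<Longrightarrow> \<Phi> (\<rho> (i, 0\<^sub>v d) x) = s * \<Phi> x + t" by blast
      have "\<Phi> (\<rho> (i + 1, 0\<^sub>v d) x) = (\<mu> * s) * \<Phi> x + (\<mu> * t + c)" if x: "x \<in> {0<..<1}" for x
        using ag(1)[of x i] \<Phi>a[OF open_maps[of "(i, 0\<^sub>v d)" x]] st(2)[OF x] x H0 by (simp add: mem algebra_simps)
      then show ?case using st(1) \<mu>(1) by (metis mult_pos_pos)
    next
      case (step2 i)
      then obtain s t where st: "0 < s" "\<And>x. x \<in> {0<..<1} \<Longrightarrow> \<Phi> (\<rho> (i, 0\<^sub>v d) x) = s * \<Phi> x + t" by blast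
      have "\<Phi> (\<rho> (i - 1, 0\<^sub>v d) x) = (inverse \<mu> * s) * \<Phi> x + (inverse \<mu> * t + (- c / \<mu>))" if x: "x \<in> {0<..<1}" for x
        using ag(2)[of x i] \<Phi>b[OF open_maps[of "(i, 0\<^sub>v d)" x]] st(2)[OF x] x H0 by (simp add: mem algebra_simps)
      then show ?case using st(1) \<mu>(1) by (metis mult_pos_pos positive_imp_inverse_positive)
    qed
    obtain m h where mh: "g = (m, h)" "h \<in> H" using g mem by (cases g) auto
    obtain s t where st: "0 < s" "\<And>x. x \<in> {0<..<1} \<Longrightarrow> \<Phi> (\<rho> (m, 0\<^sub>v d) x) = s * \<Phi> x + t" using * by blast
    have "\<Phi> (\<rho> g x) = s * \<Phi> x + (t + \<tau> h)" if x: "x \<in> {0<..<1}" for x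
      using Tg[OF mh(2), of x m] \<Phi>T[OF mh(2) open_maps[of "(m, 0\<^sub>v d)" x]] st(2)[OF x] x H0 by (simp add: mem mh)
    then show ?thesis using st(1) by blast
  qed
  define \<psi> where "\<psi> g y = \<Phi> (\<rho> g (\<Psi> y))" for g y
  have \<psi>_affine: "\<exists>s t. 0 < s \<and> \<psi> g = (\<lambda>y. s * y + t)" if "g \<in> carrier G" for g
    using affine[OF that] \<Psi>(1,2) unfolding \<psi>_def fun_eq_iff by metis
  \<comment> \<open>The product of \<open>BijGroup\<close> is composition restricted to bijections,
    so membership is needed before it can be unfolded.\<close>
  have \<psi>_Bij: "\<psi> g \<in> Bij UNIV" if g: "g \<in> carrier G" for g
  proof -
    obtain s t where st: "0 < s" "\<psi> g = (\<lambda>y. s * y + t)" using \<psi>_affine[OF g] by blast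
    have "bij (\<psi> g)"
      by (rule bij_betw_byWitness[where f' = "\<lambda>y. (y - t) / s"]) (use st in auto)
    then show ?thesis by (simp add: Bij_def)
  qed
  have \<psi>: "\<psi> \<in> hom G Aff_plus"
  proof (rule homI)
    show "\<psi> g \<in> carrier Aff_plus" if "g \<in> carrier G" for g
      using \<psi>_affine[OF that] by (simp add: Aff_plus_def)
    show "\<psi> (g \<otimes>\<^bsub>G\<^esub> h) = \<psi> g \<otimes>\<^bsub>Aff_plus\<^esub> \<psi> h" if gh: "g \<in> carrier G" "h \<in> carrier G" for g h
    proof -
      have "\<psi> (g \<otimes>\<^bsub>G\<^esub> h) y = \<psi> g (\<psi> h y)" for y
      proof -
        have "\<Psi> (\<Phi> (\<rho> h (\<Psi> y))) = \<rho> h (\<Psi> y)" by (rule \<Psi>(3)[OF open_maps[OF gh(2) \<Psi>(1)]])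
        then show ?thesis using comp[OF gh, of "\<Psi> y"] \<Psi>(1)[of y] by (simp add: \<psi>_def)
      qed
      then show ?thesis using \<psi>_Bij[OF gh(1)] \<psi>_Bij[OF gh(2)]
        by (simp add: Aff_plus_def BijGroup_def compose_def fun_eq_iff)
    qed
  qed
  have "conj_to_affine_by G \<rho> \<Phi>"
    unfolding conj_to_affine_by_def
    using homeo \<psi> \<Psi>(3) by (auto simp: \<psi>_def intro!: bexI[of _ \<psi>])
  moreover have "Cr_diffeo r {0<..<1} UNIV \<Phi>"
    unfolding Cr_diffeo_def using homeo Cholder_imp_Cr_on[OF \<Psi>(4)] Cholder_imp_Cr_on[OF \<Psi>(5)] by blast
  ultimately show ?thesis unfolding G_def by blast
qed

end
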